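(* Let $d=4$, let $r>0$, and let $M\ge 1$ be an integer. Then there exist a real constant $\sigma^{(1)}$ and real numbers $\sigma^{(2)}_{n,k}$, $\sigma^{(3)}_{n,k}$ (not depending on $t$) such that, as $t\to\infty$, $$ \begin{aligned} L(t)=2\pi^2r^2\Biggl[&t+\frac12 r^2\log t+r^2\sigma^{(1)} +\sum_{n=1}^M\frac{r^{2n+2}}{t^n}\sum_{k=0}^n\sigma^{(2)}_{n,k}(\log t)^k\\ &+\sum_{n=1}^M\frac{r^{2n+3}}{t^{n+1/2}}\sum_{k=0}^n\sigma^{(3)}_{n,k}(\log t)^k\Biggr] +O\left(\frac{(\log t)^{M+1}}{t^{M+1}}\right). \end{aligned} $$
   Context: Let $\{B(t)\}_{t\ge 0}$ be a standard Brownian motion on $\mathbb{R}^d$ (here $d=4$) and let $P_x$ denote the probability measure for the Brownian motion starting from $x\in\mathbb{R}^d$. Let $D$ be the closed ball in $\mathbb{R}^d$ with center $0$ and radius $r>0$, and $\tau_D=\inf\{t\ge 0: B(t)\in D\}$. For $t>0$ define $$L(t)=\int_{\mathbb{R}^d\setminus D}P_x[\tau_D\le t]\,dx.$$ (The expected volume of the Wiener sausage $\{x\in\mathbb{R}^d: x+B(s)\in D\text{ for some }s\in[0,t]\}$ equals $L(t)$ plus the volume of $D$.) *)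

theory Defs
  imports "HOL-Probability.Probability" "HOL-Library.Landau_Symbols"
begin

text \<open>
  Standard Brownian motion started at \<open>x\<close>: the increment over a time interval of length \<open>h\<close> is
  a centred Gaussian with covariance \<open>h\<close> times the identity, so the generator is half the Laplacian.
  The start is prescribed only almost surely because one process \<open>B\<close> is used under all
  measures \<open>P x\<close> below. The paths are continuous surely, which makes hitting times of
  closed sets measurable without completing the measure.
\<close>

locale brownian_motion = prob_space M
  for M :: "'w measure" +
  fixes B :: "real \<Rightarrow> 'w \<Rightarrow> 'a :: euclidean_space"
    and x :: 'a
  assumes measurable_at: "0 \<le> t \<Longrightarrow> B t \<in> borel_measurable M"
    and starts_at: "AE \<omega> in M. B 0 \<omega> = x"
    and gaussian_increments:
      "0 \<le> s \<Longrightarrow> s < t \<Longrightarrow>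
        distributed M lborel (\<lambda>\<omega>. B t \<omega> - B s \<omega>)
          (\<lambda>z. ennreal (\<Prod>b\<in>Basis. normal_density 0 (sqrt (t - s)) (z \<bullet> b)))"
    and independent_increments:
      "0 \<le> u 0 \<Longrightarrow> (\<And>i. i < n \<Longrightarrow> u i < u (Suc i)) \<Longrightarrow>
        indep_vars (\<lambda>_. borel) (\<lambda>i \<omega>. B (u (Suc i)) \<omega> - B (u i) \<omega>) {..<n::nat}"
    and continuous_paths: "\<omega> \<in> space M \<Longrightarrow> continuous_on {0..} (\<lambda>t. B t \<omega>)"

text \<open>
  The measures \<open>P x\<close> live on a common measurable space, on which \<open>B\<close> is a single process.
\<close>

locale brownian_family =
  fixes \<Omega> :: "'w measure"
    and P :: "'a :: euclidean_space \<Rightarrow> 'w measure"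
    and B :: "real \<Rightarrow> 'w \<Rightarrow> 'a"
  assumes sets_P: "sets (P x) = sets \<Omega>"
    and brownian_motion_P: "brownian_motion (P x) B x"

text \<open>Extended-real valued, so that the infimum is infinite for a path that never hits \<open>D\<close>.\<close>

definition hitting_time :: "(real \<Rightarrow> 'w \<Rightarrow> 'a) \<Rightarrow> 'a set \<Rightarrow> 'w \<Rightarrow> ereal" where
  "hitting_time B D \<omega> = Inf (ereal ` {t. 0 \<le> t \<and> B t \<omega> \<in> D})"

definition hitting_integral ::
  "('a :: euclidean_space \<Rightarrow> 'w measure) \<Rightarrow> (real \<Rightarrow> 'w \<Rightarrow> 'a) \<Rightarrow> 'a set \<Rightarrow> real \<Rightarrow> real" where
  "hitting_integral P B D t =
    (LINT x:(UNIV - D)|lborel. measure (P x) {\<omega> \<in> space (P x). hitting_time B D \<omega> \<le> ereal t})"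

end

theory Submission
  imports Defs "HOL-Complex_Analysis.Complex_Analysis" "HOL-Real_Asymp.Real_Asymp"
begin

text \<open>
  Write \<open>\<tau>\<close> for the hitting time of the ball and \<open>p\<close> for the heat kernel. The integrals
  \<open>\<integral> E\<^sub>x e\<^sup>-\<^sup>n\<^sup>\<tau> dx\<close> over the outside of the ball are explicit for \<open>n = 1, 2, \<dots>\<close>; they determine
  \<open>L(t)\<close>, as an exact integral over a density, and the behaviour of the density at \<open>0\<close> gives the
  expansion.

  \<^emph>\<open>Exponential moments.\<close> For fixed \<open>t\<close> the process \<open>p (t - s) (B s)\<close> is a martingale, and \<open>p\<close>
  is constant on the sphere that carries \<open>B \<tau>\<close>. Stopping at \<open>\<tau>\<close> gives that \<open>p t x\<close> is the
  expectation of \<open>p (t - \<tau>)\<close> at distance \<open>r\<close>, taken over \<open>\<tau> < t\<close> (\<open>expectation_delayed_gauss\<close>).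
  A Laplace transform in \<open>t\<close> factors this identity, so \<open>E\<^sub>x e\<^sup>-\<^sup>n\<^sup>\<tau>\<close> is a quotient of two resolvent
  kernels (\<open>laplace_hitting_time\<close>). In dimension four the resolvent kernel and its integral over
  the complement of the ball are expressed by Macdonald functions, which leaves
  \<open>2 \<pi>\<^sup>2 r\<^sup>2 (1 / n + r\<^sup>2 / z \<cdot> K\<^sub>0(z) / K\<^sub>1(z))\<close> with \<open>z = r \<surd>(2 n)\<close> (\<open>hitting_moment_mass\<close>).

  \<^emph>\<open>A Stieltjes representation.\<close> On the right half-plane \<open>K\<^sub>0 / K\<^sub>1\<close> is holomorphic and bounded
  by \<open>1\<close>: the function \<open>|K\<^sub>1|\<^sup>2 - |K\<^sub>0|\<^sup>2\<close> decreases to \<open>0\<close> along horizontal lines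
  (\<open>norm_cosh_moment_0_le_1\<close>). The Poisson formula therefore recovers it from its values on the
  imaginary axis, where the classical series with a logarithm are available and a Wronskian makes
  the real part positive and explicit. The outcome is
  \<open>K\<^sub>0(x) / K\<^sub>1(x) = x / 2 \<integral> \<rho>(u) / (x\<^sup>2 + u) du\<close> with a positive density \<open>\<rho>\<close>
  (\<open>macdonald_ratio_stieltjes\<close>).

  \<^emph>\<open>Inversion.\<close> With \<open>g(v) = \<rho>(2 r\<^sup>2 v)\<close> the \<open>n\<close>-th moment is \<open>2 \<pi>\<^sup>2 r\<^sup>2\<close> times
  \<open>1 / n + r\<^sup>2 / 2 \<integral> g(v) / (n + v) dv\<close>. It is linear in \<open>1 / (n + v)\<close>, the value at \<open>n\<close> of the
  Laplace transform of \<open>e\<^sup>-\<^sup>v\<^sup>s\<close>, with \<open>v = 0\<close> for the first summand. Since the indicator of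
  \<open>\<tau> \<le> t\<close> is a bounded limit of polynomials in \<open>e\<^sup>-\<^sup>\<tau>\<close> without constant term, one may replace
  \<open>1 / (n + v)\<close> by \<open>\<integral> e\<^sup>-\<^sup>v\<^sup>s ds\<close> over \<open>0 \<le> s \<le> t\<close>. This proves the exact formula
  \<open>L(t) = 2 \<pi>\<^sup>2 r\<^sup>2 (t + r\<^sup>2 / 2 \<integral> (1 - e\<^sup>-\<^sup>v\<^sup>t) g(v) / v dv)\<close> (\<open>hitting_integral_formula\<close>).

  \<^emph>\<open>Expansion.\<close> Near \<open>0\<close> the density has the value \<open>1\<close> and corrections \<open>v\<^sup>i (v ln v)\<^sup>j\<close> with
  \<open>i + j \<ge> 1\<close>. A version of Watson's lemma (\<open>watson_log\<close>) turns the value \<open>1\<close> into \<open>ln t\<close> plus a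
  constant, and a correction with \<open>i + j = n\<close> into \<open>t\<^sup>-\<^sup>n\<close> times a polynomial in \<open>ln t\<close> of degree
  at most \<open>n\<close>. Only integer powers occur, so all the coefficients \<open>\<sigma>\<^sup>(\<^sup>3\<^sup>)\<close> of the half-integer
  powers can be taken to be \<open>0\<close>.
\<close>

section \<open>Integral representation of the Macdonald functions\<close>

text \<open>
  Dominated convergence applies to difference quotients because a bound on the derivative over a
  ball bounds every difference quotient with both points in the ball.
\<close>

lemma has_field_derivative_integral_dominated:
  fixes f f' :: "complex \<Rightarrow> real \<Rightarrow> complex"
  assumes S: "open S" "z0 \<in> S"
    and deriv: "\<And>z u. z \<in> S \<Longrightarrow> ((\<lambda>z. f z u) has_field_derivative f' z u) (at z)"
    and int: "\<And>z. z \<in> S \<Longrightarrow> integrable lborel (f z)"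
    and bound: "\<And>z u. z \<in> S \<Longrightarrow> norm (f' z u) \<le> g u"
    and g: "integrable lborel g"
    and meas: "f' z0 \<in> borel_measurable lborel"
  shows "((\<lambda>z. LINT u|lborel. f z u) has_field_derivative (LINT u|lborel. f' z0 u)) (at z0)"
proof -
  obtain d where d: "d > 0" "ball z0 d \<subseteq> S" using S openE by blast
  let ?B = "ball z0 d"
  have "((\<lambda>z. ((LINT u|lborel. f z u) - (LINT u|lborel. f z0 u)) / (z - z0)) \<longlongrightarrow> (LINT u|lborel. f' z0 u)) (at z0 within ?B)"
    unfolding tendsto_at_iff_sequentially
  proof (intro allI impI)
    fix X assume X: "\<forall>i. X i \<in> ?B - {z0}" "X \<longlonglongrightarrow> z0"
    have XS: "X i \<in> S" "X i \<noteq> z0" for i using X(1) d by auto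
    have lim: "(\<lambda>i. LINT u|lborel. (f (X i) u - f z0 u) / (X i - z0)) \<longlonglongrightarrow> (LINT u|lborel. f' z0 u)"
    proof (rule integral_dominated_convergence[where w = g])
      show "f' z0 \<in> borel_measurable lborel" by fact
      show "(\<lambda>u. (f (X i) u - f z0 u) / (X i - z0)) \<in> borel_measurable lborel" for i
        using int[OF XS(1)[of i]] int[OF S(2)] by measurable
      show "integrable lborel g" by fact
      show "AE u in lborel. (\<lambda>i. (f (X i) u - f z0 u) / (X i - z0)) \<longlonglongrightarrow> f' z0 u"
      proof (rule AE_I2)
        fix u
        have "((\<lambda>z. (f z u - f z0 u) / (z - z0)) \<longlongrightarrow> f' z0 u) (at z0)"
          using deriv[OF S(2), of u] by (simp add: has_field_derivative_iff)
        then show "(\<lambda>i. (f (X i) u - f z0 u) / (X i - z0)) \<longlonglongrightarrow> f' z0 u"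
          unfolding tendsto_at_iff_sequentially using X XS by (auto simp: o_def)
      qed
      show "AE u in lborel. norm ((f (X i) u - f z0 u) / (X i - z0)) \<le> g u" for i
      proof (rule AE_I2)
        fix u
        have "norm (f (X i) u - f z0 u) \<le> g u * norm (X i - z0)"
        proof (rule field_differentiable_bound[of ?B])
          show "((\<lambda>z. f z u) has_field_derivative f' z u) (at z within ?B)" if "z \<in> ?B" for z
            using deriv[of z u] that d(2) by (blast intro: has_field_derivative_at_within)
        qed (use X(1) d bound in auto)
        then show "norm ((f (X i) u - f z0 u) / (X i - z0)) \<le> g u"
          using XS(2)[of i] by (simp add: norm_divide divide_simps)
      qed
    qed
    have "(LINT u|lborel. (f (X i) u - f z0 u) / (X i - z0)) =
        ((LINT u|lborel. f (X i) u) - (LINT u|lborel. f z0 u)) / (X i - z0)" for i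
      using int[OF XS(1)[of i]] int[OF S(2)] XS(2)[of i] by simp
    then show "((\<lambda>z. ((LINT u|lborel. f z u) - (LINT u|lborel. f z0 u)) / (z - z0)) \<circ> X) \<longlonglongrightarrow> (LINT u|lborel. f' z0 u)"
      using lim unfolding o_def by presburger
  qed
  then have "((\<lambda>z. LINT u|lborel. f z u) has_field_derivative (LINT u|lborel. f' z0 u)) (at z0 within ?B)"
    by (simp add: has_field_derivative_iff)
  then show ?thesis using d(1) at_within_open[of z0 ?B] by simp
qed

lemma cosh_real_ge_quadratic: "cosh (u::real) \<ge> (1 + u\<^sup>2) / 4"
proof -
  have *: "cosh u \<ge> (1 + u\<^sup>2) / 4" if "u \<ge> 0" for u :: real
  proof -
    have "exp u \<ge> 1 + u + u\<^sup>2 / 2" using exp_lower_Taylor_quadratic[OF that] by simp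
    moreover have "exp (- u) \<ge> 1 + (- u)" by (rule exp_ge_add_one_self)
    ultimately have "exp u + exp (- u) \<ge> 2 + u\<^sup>2 / 2" by linarith
    then show ?thesis unfolding cosh_def by (simp add: field_simps)
  qed
  show ?thesis using *[of "\<bar>u\<bar>"] by (cases "u \<ge> 0") auto
qed

lemma power_div_fact_le_exp:
  assumes "x \<ge> (0::real)"
  shows "x ^ k / fact k \<le> exp x"
proof -
  have "(\<Sum>k\<in>{k}. x ^ k /\<^sub>R fact k) \<le> exp x"
    unfolding exp_def using assms by (intro sum_le_suminf summable_exp_generic) auto
  then show ?thesis by (simp add: divide_inverse mult.commute)
qed

lemma power_exp_bound:
  fixes c x :: real
  assumes "c > 0" "x > 0"
  shows "c ^ n * exp (- (x * c)) \<le> fact (Suc n) / x ^ Suc n / c"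
proof -
  have "(x * c) ^ Suc n / fact (Suc n) \<le> exp (x * c)"
    using assms by (intro power_div_fact_le_exp) simp
  then have "(x*c) ^ Suc n * exp (- (x * c)) \<le> fact (Suc n)"
    by (simp add: exp_minus field_simps del: fact_Suc power_Suc)
  then have "c ^ n * exp (- (x * c)) * (x ^ Suc n * c) \<le> fact (Suc n)"
    by (simp only: power_mult_distrib power_Suc mult_ac)
  then show ?thesis using assms
    by (simp add: pos_le_divide_eq del: power_Suc fact_Suc)
qed

text \<open>
  The moments \<open>0\<close> and \<open>1\<close> are \<open>2 K\<^sub>0\<close> and \<open>2 K\<^sub>1\<close>. Higher moments make differentiation an
  index shift.
\<close>

definition cosh_moment :: "nat \<Rightarrow> complex \<Rightarrow> complex" where
  "cosh_moment n z = (LINT u|lborel. of_real (cosh u) ^ n * exp (- (z * of_real (cosh u))))"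

lemma integrable_inverse_1_plus_square':
  "integrable lborel (\<lambda>u::real. inverse (1 + u\<^sup>2))" "(LINT u|lborel. inverse (1 + u\<^sup>2)) = pi"
  using integrable_inverse_1_plus_square LBINT_inverse_1_plus_square
  by (auto simp: set_integrable_def set_lebesgue_integral_def interval_lebesgue_integral_def)

text \<open>
  The factor \<open>1 / (1 + u\<^sup>2)\<close> is an integrable majorant that is uniform in \<open>x\<close> away from \<open>0\<close>; it
  serves both for the existence of the moments and for differentiating them.
\<close>

lemma cosh_moment_bound:
  fixes u :: real
  assumes "x > 0"
  shows "cosh u ^ n * exp (- (x * cosh u)) \<le> 4 * fact (Suc n) / x ^ Suc n * inverse (1 + u\<^sup>2)"
proof -
  have "cosh u ^ n * exp (- (x * cosh u)) \<le> fact (Suc n) / x ^ Suc n / cosh u"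
    using power_exp_bound[of "cosh u" x n] assms by (simp add: cosh_real_pos)
  also have "\<dots> \<le> fact (Suc n) / x ^ Suc n / ((1 + u\<^sup>2) / 4)"
    using assms cosh_real_ge_quadratic[of u]
    by (intro divide_left_mono) (auto simp: cosh_real_pos intro!: mult_pos_pos add_pos_nonneg)
  finally show ?thesis by (simp add: field_simps)
qed

lemma norm_cosh_moment_integrand:
  "norm (of_real (cosh u) ^ n * exp (- (z * of_real (cosh u))) :: complex) = cosh u ^ n * exp (- (Re z * cosh u))"
  by (simp add: norm_mult norm_power cosh_real_nonneg)

lemma borel_measurable_cosh_moment [measurable]:
  "(\<lambda>u. of_real (cosh u) ^ n * exp (- (z * of_real (cosh u))) :: complex) \<in> borel_measurable borel"
  by (intro borel_measurable_continuous_onI continuous_intros)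

lemma integrable_cosh_moment:
  assumes "Re z > 0"
  shows "integrable lborel (\<lambda>u. of_real (cosh u) ^ n * exp (- (z * of_real (cosh u))))"
proof (rule Bochner_Integration.integrable_bound)
  show "integrable lborel (\<lambda>u. 4 * fact (Suc n) / Re z ^ Suc n * inverse (1 + u\<^sup>2) :: real)"
    by (intro integrable_mult_right integrable_inverse_1_plus_square')
  have "norm (of_real (cosh u) ^ n * exp (- (z * of_real (cosh u))) :: complex)
      \<le> norm (4 * fact (Suc n) / Re z ^ Suc n * inverse (1 + u\<^sup>2))" for u
    unfolding norm_cosh_moment_integrand real_norm_def
    by (rule order_trans[OF cosh_moment_bound[OF assms, of u n] abs_ge_self])
  then show "AE u in lborel. norm (of_real (cosh u) ^ n * exp (- (z * of_real (cosh u))) :: complex)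
      \<le> norm (4 * fact (Suc n) / Re z ^ Suc n * inverse (1 + u\<^sup>2))"
    by (rule AE_I2)
qed (simp add: borel_measurable_cosh_moment)

lemma cosh_moment_of_real:
  "cosh_moment n (of_real x) = of_real (LINT u|lborel. cosh u ^ n * exp (- (x * cosh u)))"
proof -
  have *: "of_real (cosh u) ^ n * exp (- (of_real x * of_real (cosh u))) = (of_real (cosh u ^ n * exp (- (x * cosh u))) :: complex)" for u
    by (simp flip: exp_of_real)
  show ?thesis unfolding cosh_moment_def * by (rule integral_complex_of_real)
qed

lemma cosh_moment_cnj: "cosh_moment n (cnj z) = cnj (cosh_moment n z)"
proof -
  have "cosh_moment n (cnj z) = (LINT u|lborel. cnj (of_real (cosh u) ^ n * exp (- (z * of_real (cosh u)))))"
    unfolding cosh_moment_def by (simp add: exp_cnj)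
  then show ?thesis unfolding cosh_moment_def by (simp only: Bochner_Integration.integral_cnj)
qed

lemma norm_cosh_moment_le:
  assumes "Re z > 0"
  shows "norm (cosh_moment n z) \<le> 4 * fact (Suc n) / Re z ^ Suc n * pi"
proof -
  have "norm (cosh_moment n z) \<le> (LINT u|lborel. norm (of_real (cosh u) ^ n * exp (- (z * of_real (cosh u))) :: complex))"
    unfolding cosh_moment_def by (rule integral_norm_bound)
  also have "\<dots> \<le> (LINT u|lborel. 4 * fact (Suc n) / Re z ^ Suc n * inverse (1 + u\<^sup>2))"
  proof (rule integral_mono)
    show "norm (of_real (cosh u) ^ n * exp (- (z * of_real (cosh u))) :: complex)
        \<le> 4 * fact (Suc n) / Re z ^ Suc n * inverse (1 + u\<^sup>2)" for u
      unfolding norm_cosh_moment_integrand by (rule cosh_moment_bound[OF assms])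
  qed (intro integrable_norm integrable_cosh_moment assms integrable_mult_right integrable_inverse_1_plus_square')+
  also have "\<dots> = 4 * fact (Suc n) / Re z ^ Suc n * pi"
    using integrable_inverse_1_plus_square' by simp
  finally show ?thesis .
qed

lemma has_field_derivative_cosh_moment:
  assumes "Re z > 0"
  shows "(cosh_moment n has_field_derivative - cosh_moment (Suc n) z) (at z)"
proof -
  define S where "S = {w. Re w > Re z / 2}"
  have S: "open S" "z \<in> S" using assms open_halfspace_Re_gt[of "Re z / 2"] by (simp_all add: S_def)
  have pos: "Re w > 0" if "w \<in> S" for w using that assms by (auto simp: S_def)
  have "((\<lambda>z. LINT u|lborel. of_real (cosh u) ^ n * exp (- (z * of_real (cosh u)))) has_field_derivative
      (LINT u|lborel. - (of_real (cosh u) ^ Suc n * exp (- (z * of_real (cosh u)))))) (at z)"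
  proof (rule has_field_derivative_integral_dominated[OF S,
        where f' = "\<lambda>z u. - (of_real (cosh u) ^ Suc n * exp (- (z * of_real (cosh u))))"
          and g = "\<lambda>u. 4 * fact (Suc (Suc n)) / (Re z / 2) ^ Suc (Suc n) * inverse (1 + u\<^sup>2)"])
    show "integrable lborel (\<lambda>u. of_real (cosh u) ^ n * exp (- (w * of_real (cosh u))))" if "w \<in> S" for w
      using integrable_cosh_moment[OF pos[OF that]] .
    show "((\<lambda>z. of_real (cosh u) ^ n * exp (- (z * of_real (cosh u)))) has_field_derivative
        - (of_real (cosh u) ^ Suc n * exp (- (w * of_real (cosh u))))) (at w)" for w :: complex and u :: real
      by (auto intro!: derivative_eq_intros)
    show "norm (- (of_real (cosh u) ^ Suc n * exp (- (w * of_real (cosh u)))) :: complex)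
        \<le> 4 * fact (Suc (Suc n)) / (Re z / 2) ^ Suc (Suc n) * inverse (1 + u\<^sup>2)" if "w \<in> S" for w u
    proof -
      have "norm (- (of_real (cosh u) ^ Suc n * exp (- (w * of_real (cosh u)))) :: complex)
          = cosh u ^ Suc n * exp (- (Re w * cosh u))"
        using norm_cosh_moment_integrand[of u "Suc n" w] by simp
      also have "\<dots> \<le> cosh u ^ Suc n * exp (- (Re z / 2 * cosh u))"
        using that by (intro mult_left_mono) (auto simp: S_def cosh_real_nonneg intro!: mult_right_mono)
      also have "\<dots> \<le> 4 * fact (Suc (Suc n)) / (Re z / 2) ^ Suc (Suc n) * inverse (1 + u\<^sup>2)"
        using assms by (intro cosh_moment_bound) auto
      finally show ?thesis .
    qed
    show "integrable lborel (\<lambda>u. 4 * fact (Suc (Suc n)) / (Re z / 2) ^ Suc (Suc n) * inverse (1 + u\<^sup>2) :: real)"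
      by (intro integrable_mult_right integrable_inverse_1_plus_square')
    show "(\<lambda>u. - (of_real (cosh u) ^ Suc n * exp (- (z * of_real (cosh u))))) \<in> borel_measurable lborel"
      using borel_measurable_cosh_moment[of "Suc n" z] by (simp del: power_Suc)
  qed
  then show ?thesis
    unfolding cosh_moment_def [abs_def] by (simp del: power_Suc)
qed

lemma tendsto_mult_exp_neg: "x > 0 \<Longrightarrow> ((\<lambda>c::real. c * exp (- (x * c))) \<longlongrightarrow> 0) at_top"
  by real_asymp

lemma filterlim_sinh_exp_cosh:
  assumes "Re z > 0" "filterlim cosh at_top F"
  shows "((\<lambda>u. of_real (sinh u) * exp (- (z * of_real (cosh u))) :: complex) \<longlongrightarrow> 0) F"
proof (rule Lim_null_comparison)
  let ?x = "Re z"
  have "((\<lambda>c. c * exp (- (?x * c))) \<longlongrightarrow> 0) at_top"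
    using tendsto_mult_exp_neg[OF assms(1)] .
  from filterlim_compose[OF this assms(2)]
  show "((\<lambda>u. cosh u * exp (- (?x * cosh u))) \<longlongrightarrow> 0) F" .
  have "\<bar>sinh u\<bar> \<le> cosh u" for u :: real
    using sinh_le_cosh_real[of u] sinh_le_cosh_real[of "- u"] by (simp add: abs_le_iff)
  then show "\<forall>\<^sub>F u in F. norm (of_real (sinh u) * exp (- (z * of_real (cosh u))) :: complex) \<le> cosh u * exp (- (?x * cosh u))"
    by (auto simp: norm_mult intro!: always_eventually)
qed

lemma integral_total_derivative:
  fixes F :: "real \<Rightarrow> complex"
  assumes "\<And>u. (F has_vector_derivative f u) (at u)" "\<And>u. isCont f u" "integrable lborel f"
    "(F \<longlongrightarrow> A) at_bot" "(F \<longlongrightarrow> B) at_top"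
  shows "(LINT u|lborel. f u) = B - A"
proof -
  have "(LBINT u=-\<infinity>..\<infinity>. f u) = B - A"
  proof (rule interval_integral_FTC_integrable[where F = F])
    show "set_integrable lborel (einterval (-\<infinity>) \<infinity>) f" using assms(3) by (simp add: set_integrable_def)
    show "((F \<circ> real_of_ereal) \<longlongrightarrow> A) (at_right (-\<infinity>))" "((F \<circ> real_of_ereal) \<longlongrightarrow> B) (at_left \<infinity>)"
      using assms(4,5) by (simp_all only: ereal_tendsto_simps1)
  qed (use assms in auto)
  then show ?thesis by (simp add: interval_lebesgue_integral_def set_lebesgue_integral_def)
qed

text \<open>
  The integral over the line of the derivative of \<open>sinh u \<cdot> exp (- z cosh u)\<close> vanishes. With
  \<open>sinh\<^sup>2 = cosh\<^sup>2 - 1\<close> this is the modified Bessel equation, written as a relation between moments.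
\<close>

lemma cosh_moment_recurrence:
  assumes "Re z > 0"
  shows "z * (cosh_moment 2 z - cosh_moment 0 z) = cosh_moment 1 z"
proof -
  define E where "E u = exp (- (z * of_real (cosh u)))" for u
  define f where "f u = of_real (cosh u) ^ 1 * E u - z * (of_real (cosh u) ^ 2 * E u - of_real (cosh u) ^ 0 * E u)" for u
  have int: "integrable lborel (\<lambda>u. of_real (cosh u) ^ n * E u)" for n
    unfolding E_def by (rule integrable_cosh_moment[OF assms])
  have "(LINT u|lborel. f u) = 0 - 0"
  proof (rule integral_total_derivative[where F = "\<lambda>u. of_real (sinh u) * E u"])
    fix u
    have "of_real (cosh u)^2 = (1 + of_real (sinh u)^2 :: complex)"
      using cosh_square_eq[of u] by (metis of_real_1 of_real_add of_real_power add.commute)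
    then have sq: "of_real (sinh u) * of_real (sinh u) = (of_real (cosh u)^2 - 1 :: complex)"
      by (simp add: power2_eq_square)
    have ds: "((\<lambda>u. complex_of_real (sinh u)) has_vector_derivative of_real (cosh u)) (at u)"
      by (rule has_vector_derivative_of_real) (auto intro!: derivative_eq_intros)
    have dc: "((\<lambda>u. complex_of_real (cosh u)) has_vector_derivative of_real (sinh u)) (at u)"
      by (rule has_vector_derivative_of_real) (auto intro!: derivative_eq_intros)
    have "((\<lambda>c. exp (- z * c)) has_field_derivative - z * exp (- (z * of_real (cosh u)))) (at (of_real (cosh u)))"
      by (auto intro!: derivative_eq_intros)
    from field_vector_diff_chain_at[OF dc this]
    have dE: "(E has_vector_derivative (of_real (sinh u) * (- z * E u))) (at u)"
      by (simp add: E_def[abs_def] o_def)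
    have "((\<lambda>u. of_real (sinh u) * E u) has_vector_derivative
        (of_real (sinh u) * (of_real (sinh u) * (- z * E u)) + of_real (cosh u) * E u)) (at u)"
      by (rule has_vector_derivative_mult[OF ds dE])
    also have "of_real (sinh u) * (of_real (sinh u) * (- z * E u)) + of_real (cosh u) * E u =
      of_real (cosh u) * E u + of_real (sinh u) * (- z * of_real (sinh u) * E u)" by (simp add: algebra_simps)
    also have "of_real (cosh u) * E u + of_real (sinh u) * (- z * of_real (sinh u) * E u) =
        of_real (cosh u) * E u - z * (of_real (sinh u) * of_real (sinh u)) * E u"
      by (simp add: algebra_simps)
    also have "\<dots> = f u" unfolding sq f_def by (simp add: algebra_simps)
    finally show "((\<lambda>u. of_real (sinh u) * E u) has_vector_derivative f u) (at u)" .
    show "isCont f u" unfolding f_def E_def by (intro continuous_intros)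
  next
    show "integrable lborel f" unfolding f_def
      by (intro Bochner_Integration.integrable_diff integrable_mult_right int)
    have "filterlim (\<lambda>u::real. (1 + u\<^sup>2) / 4) at_top at_top" "filterlim (\<lambda>u::real. (1 + u\<^sup>2) / 4) at_top at_bot"
      by real_asymp+
    then have "filterlim (cosh::real\<Rightarrow>real) at_top at_top" "filterlim (cosh::real\<Rightarrow>real) at_top at_bot"
      by (auto elim!: filterlim_at_top_mono intro!: always_eventually cosh_real_ge_quadratic)
    note this [THEN filterlim_sinh_exp_cosh[OF assms]]
    then show "((\<lambda>u. of_real (sinh u) * E u) \<longlongrightarrow> 0) at_bot" "((\<lambda>u. of_real (sinh u) * E u) \<longlongrightarrow> 0) at_top"
      unfolding E_def by auto
  qed
  moreover have "(LINT u|lborel. f u) = cosh_moment 1 z - z * (cosh_moment 2 z - cosh_moment 0 z)"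
    unfolding f_def cosh_moment_def E_def [symmetric]
    using int[of 0] int[of 1] int[of 2] by simp
  ultimately show ?thesis by simp
qed

lemma has_field_derivative_times_cosh_moment_1:
  assumes "Re z > 0"
  shows "((\<lambda>z. z * cosh_moment 1 z) has_field_derivative - z * cosh_moment 0 z) (at z)"
proof -
  have "((\<lambda>z. z * cosh_moment 1 z) has_field_derivative 1 * cosh_moment 1 z + - cosh_moment (Suc 1) z * z) (at z)"
    by (intro DERIV_mult DERIV_ident has_field_derivative_cosh_moment assms)
  also have "1 * cosh_moment 1 z + - cosh_moment (Suc 1) z * z = - z * cosh_moment 0 z"
    using cosh_moment_recurrence[OF assms] by (simp add: algebra_simps numeral_2_eq_2)
  finally show ?thesis .
qed

lemma cosh_moment_1_deriv:
  assumes "Re z > 0"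
  shows "(cosh_moment 1 has_field_derivative - cosh_moment 0 z - cosh_moment 1 z / z) (at z)"
proof -
  have "z \<noteq> 0" using assms by auto
  then have "- cosh_moment (Suc 1) z = - cosh_moment 0 z - cosh_moment 1 z / z"
    using cosh_moment_recurrence[OF assms] by (simp add: field_simps numeral_2_eq_2)
  then show ?thesis using has_field_derivative_cosh_moment[OF assms, of 1] by simp
qed

lemma cosh_moment_real_pos:
  assumes "x > 0"
  shows "(LINT u|lborel. cosh u ^ n * exp (- (x * cosh u)) :: real) > 0" (is "?I > 0")
proof -
  let ?f = "\<lambda>u::real. cosh u ^ n * exp (- (x * cosh u))"
  have int: "integrable lborel ?f"
    using integrable_norm[OF integrable_cosh_moment[of "of_real x" n]] assms
    by (simp add: norm_mult norm_power cosh_real_nonneg)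
  have pos: "?f u > 0" for u by (simp add: cosh_real_pos)
  have "?I \<noteq> 0"
  proof
    assume "?I = 0"
    then have "AE u in lborel. ?f u = 0"
      using integral_nonneg_eq_0_iff_AE[OF int] pos by (simp add: less_imp_le)
    then have "AE u in (lborel :: real measure). False"
      by (rule eventually_mono) (metis less_irrefl pos)
    then show False by (simp add: eventually_False ae_filter_eq_bot_iff emeasure_lborel_UNIV)
  qed
  moreover have "?I \<ge> 0" using pos by (intro integral_nonneg_AE AE_I2) (auto simp: less_imp_le)
  ultimately show ?thesis by linarith
qed

text \<open>
  The derivatives \<open>K\<^sub>0' = - K\<^sub>1\<close> and \<open>K\<^sub>1' = - K\<^sub>0 - K\<^sub>1 / z\<close> contribute the same mixed term to the
  derivatives of \<open>|K\<^sub>0|\<^sup>2\<close> and \<open>|K\<^sub>1|\<^sup>2\<close>, so only the term with \<open>1 / z\<close> survives, and it has a sign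
  in the right half-plane.
\<close>

lemma cosh_moment_gap_deriv:
  fixes x y :: real
  assumes "x > 0"
  defines "z \<equiv> Complex x y"
  shows "((\<lambda>x. (norm (cosh_moment 1 (Complex x y)))\<^sup>2 - (norm (cosh_moment 0 (Complex x y)))\<^sup>2)
     has_real_derivative - 2 * Re (1 / z) * (norm (cosh_moment 1 z))\<^sup>2) (at x)"
proof -
  have z: "Re z > 0" using assms by simp
  have line: "((\<lambda>x. Complex x y) has_vector_derivative 1) (at x)"
    unfolding Complex_eq by (auto intro!: derivative_eq_intros)
  have d: "((\<lambda>x. f (Complex x y)) has_vector_derivative f') (at x)"
    if "(f has_field_derivative f') (at z)" for f f'
    using field_vector_diff_chain_at[OF line, of f f'] that by (simp add: z_def o_def)
  have sq: "((\<lambda>x. (norm (f (Complex x y)))\<^sup>2) has_real_derivative 2 * Re (f' * cnj (f z))) (at x)"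
    if "(f has_field_derivative f') (at z)" for f f'
  proof -
    have "((\<lambda>x. f (Complex x y) \<bullet> f (Complex x y)) has_vector_derivative f (Complex x y) \<bullet> f' + f' \<bullet> f (Complex x y)) (at x)"
      by (rule bounded_bilinear.has_vector_derivative[OF bounded_bilinear_inner]) (rule d[OF that])+
    then show ?thesis
      by (simp add: has_real_derivative_iff_has_vector_derivative power2_norm_eq_inner inner_complex_def z_def algebra_simps)
  qed
  have "((\<lambda>x. (norm (cosh_moment 1 (Complex x y)))\<^sup>2 - (norm (cosh_moment 0 (Complex x y)))\<^sup>2) has_real_derivative
     2 * Re ((- cosh_moment 0 z - cosh_moment 1 z / z) * cnj (cosh_moment 1 z)) - 2 * Re (- cosh_moment 1 z * cnj (cosh_moment 0 z))) (at x)"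
    using has_field_derivative_cosh_moment[OF z, of 0]
    by (intro DERIV_diff sq cosh_moment_1_deriv[OF z]) simp
  also have "2 * Re ((- cosh_moment 0 z - cosh_moment 1 z / z) * cnj (cosh_moment 1 z)) - 2 * Re (- cosh_moment 1 z * cnj (cosh_moment 0 z))
     = - 2 * Re (1 / z * (cosh_moment 1 z * cnj (cosh_moment 1 z)))"
    by (simp add: algebra_simps)
  also have "\<dots> = - 2 * Re (1 / z) * (norm (cosh_moment 1 z))\<^sup>2"
    unfolding complex_norm_square[symmetric]
    by (simp only: times_complex.sel Re_complex_of_real Im_complex_of_real) simp
  finally show ?thesis .
qed

text \<open>
  Along a horizontal line the gap \<open>|K\<^sub>1|\<^sup>2 - |K\<^sub>0|\<^sup>2\<close> decreases to its limit \<open>0\<close>, hence it is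
  nonnegative. If \<open>K\<^sub>1\<close> vanished at a point, the gap would be \<open>0\<close> from there on, its derivative too,
  and \<open>K\<^sub>1\<close> would vanish on a ray and then everywhere.
\<close>

lemma norm_cosh_moment_0_le_1:
  assumes "Re z > 0"
  shows "norm (cosh_moment 0 z) \<le> norm (cosh_moment 1 z)" "cosh_moment 1 z \<noteq> 0"
proof -
  define y where "y = Im z"
  define D where "D x = (norm (cosh_moment 1 (Complex x y)))\<^sup>2 - (norm (cosh_moment 0 (Complex x y)))\<^sup>2" for x
  have dec: "D a \<ge> D b" if "0 < a" "a \<le> b" for a b
  proof (rule DERIV_nonpos_imp_nonincreasing[OF that(2)])
    fix x assume "a \<le> x" "x \<le> b"
    then have x: "x > 0" using that by simp
    then have "Re (1 / Complex x y) \<ge> 0" by (simp add: Re_divide)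
    then have "- 2 * Re (1 / Complex x y) * (norm (cosh_moment 1 (Complex x y)))\<^sup>2 \<le> 0" by simp
    then show "\<exists>y. (D has_real_derivative y) (at x) \<and> y \<le> 0"
      using cosh_moment_gap_deriv[OF x, of y] unfolding D_def by blast
  qed
  have lim: "(D \<longlongrightarrow> 0) at_top"
  proof -
    have "((\<lambda>x. cosh_moment n (Complex x y)) \<longlongrightarrow> 0) at_top" for n
    proof (rule Lim_null_comparison)
      show "\<forall>\<^sub>F x in at_top. norm (cosh_moment n (Complex x y)) \<le> 4 * fact (Suc n) / x ^ Suc n * pi"
        using norm_cosh_moment_le[of "Complex _ y" n] by (intro eventually_mono[OF eventually_gt_at_top[of 0]]) simp
      have "((\<lambda>x::real. 4 * fact (Suc n) / x ^ Suc n * pi) \<longlongrightarrow> 4 * fact (Suc n) * 0 * pi) at_top"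
        unfolding divide_inverse
        by (intro tendsto_intros tendsto_inverse_0_at_top filterlim_pow_at_top filterlim_ident) auto
      then show "((\<lambda>x::real. 4 * fact (Suc n) / x ^ Suc n * pi) \<longlongrightarrow> 0) at_top" by simp
    qed
    from tendsto_norm[OF this]
    have *: "((\<lambda>x. norm (cosh_moment n (Complex x y))) \<longlongrightarrow> 0) at_top" for n by simp
    have "(D \<longlongrightarrow> 0\<^sup>2 - 0\<^sup>2) at_top" unfolding D_def by (intro tendsto_intros *)
    then show ?thesis by simp
  qed
  have nonneg: "D x \<ge> 0" if "x > 0" for x
    by (rule tendsto_upperbound[OF lim]) (use dec[OF that] in \<open>auto intro: eventually_at_top_linorderI[of x]\<close>)
  have z: "z = Complex (Re z) y" by (simp add: y_def)
  have le: "norm (cosh_moment 0 w) \<le> norm (cosh_moment 1 w)" if "Re w > 0" "Im w = y" for w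
  proof -
    have "Complex (Re w) y = w" unfolding that(2)[symmetric] by (rule complex_surj)
    with nonneg[OF that(1)] have "(norm (cosh_moment 0 w))\<^sup>2 \<le> (norm (cosh_moment 1 w))\<^sup>2"
      by (simp add: D_def)
    then show ?thesis by (rule power2_le_imp_le) simp
  qed
  show "norm (cosh_moment 0 z) \<le> norm (cosh_moment 1 z)" using le[of z] assms by (simp add: y_def)
  show "cosh_moment 1 z \<noteq> 0"
  proof
    assume 0: "cosh_moment 1 z = 0"
    have D0: "D x = 0" if "x \<ge> Re z" for x
    proof (rule antisym)
      have "D x \<le> D (Re z)" using dec assms that by simp
      also have "\<dots> \<le> 0" using 0 z by (simp add: D_def)
      finally show "D x \<le> 0" .
    qed (use nonneg assms that in auto)
    have zero: "cosh_moment 1 (Complex x y) = 0" if "x > Re z" for x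
    proof -
      have x: "x > 0" using that assms by simp
      have "(D has_real_derivative 0) (at x)"
      proof (rule has_field_derivative_transform_within_open[where S = "{Re z<..}" and f = "\<lambda>_. 0"])
      qed (use D0 that in auto)
      with cosh_moment_gap_deriv[OF x, of y]
      have "- 2 * Re (1 / Complex x y) * (norm (cosh_moment 1 (Complex x y)))\<^sup>2 = 0"
        unfolding D_def using DERIV_unique by blast
      moreover have "Re (1 / Complex x y) \<noteq> 0" using x by (simp add: Re_divide sum_power2_eq_zero_iff)
      ultimately show ?thesis by simp
    qed
    let ?S = "{w. Re w > 0}"
    have hol: "cosh_moment 1 holomorphic_on ?S"
      using has_field_derivative_cosh_moment by (auto simp: holomorphic_on_open open_halfspace_Re_gt)
    have "cosh_moment 1 1 = 0"
    proof (rule analytic_continuation[OF hol, of "(\<lambda>x. Complex x y) ` {Re z<..}" "Complex (Re z + 1) y"])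
      show "Complex (Re z + 1) y islimpt (\<lambda>x. Complex x y) ` {Re z<..}"
        unfolding islimpt_approachable
      proof (intro allI impI)
        fix e :: real assume "e > 0"
        then show "\<exists>x'\<in>(\<lambda>x. Complex x y) ` {Re z<..}. x' \<noteq> Complex (Re z + 1) y \<and> dist x' (Complex (Re z + 1) y) < e"
          by (intro bexI[of _ "Complex (Re z + 1 + e / 2) y"]) (auto simp: dist_norm cmod_def)
      qed
    qed (use assms zero open_halfspace_Re_gt[of 0] in \<open>auto intro!: convex_connected convex_halfspace_Re_gt\<close>)
    then show False using cosh_moment_of_real[of 1 1] cosh_moment_real_pos[of 1 1] by simp
  qed
qed

section \<open>Series with a logarithm and boundary values\<close>

text \<open>
  One definition serves the reals and the complex numbers, since the same coefficients are evaluated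
  at \<open>z\<^sup>2 / 4\<close> in the half-plane and at a negative real argument on the imaginary axis.
\<close>

definition pseries :: "(nat \<Rightarrow> real) \<Rightarrow> 'a \<Rightarrow> 'a::{real_normed_field,banach}" where
  "pseries c w = (\<Sum>n. of_real (c n) * w ^ n)"

lemma summable_pseries:
  fixes w :: "'a::{real_normed_field,banach}"
  assumes "\<And>n. \<bar>c n\<bar> \<le> C / fact n"
  shows "summable (\<lambda>n. of_real (c n) * w ^ n)"
proof (rule summable_comparison_test'[where N = 0])
  show "summable (\<lambda>n. C * (inverse (fact n) * norm w ^ n))"
    by (intro summable_mult summable_exp)
  show "norm (of_real (c n) * w ^ n) \<le> C * (inverse (fact n) * norm w ^ n)" for n
    using mult_right_mono[OF assms[of n], of "norm w ^ n"] by (simp add: norm_mult norm_power divide_inverse mult.assoc)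
qed

lemma pseries_of_real:
  assumes "\<And>n. \<bar>c n\<bar> \<le> C / fact n"
  shows "pseries c (of_real x) = (of_real (pseries c x) :: 'a::{real_normed_field,banach})"
  unfolding pseries_def using suminf_of_real[OF summable_pseries[OF assms, of x], where 'a = 'a] by simp

lemma has_field_derivative_pseries:
  fixes w :: "'a::{real_normed_field,banach}"
  assumes "\<And>n. \<bar>c n\<bar> \<le> C / fact n"
  shows "(pseries c has_field_derivative pseries (\<lambda>n. real (Suc n) * c (Suc n)) w) (at w)"
proof -
  have "((\<lambda>w. \<Sum>n. of_real (c n) * w ^ n) has_field_derivative (\<Sum>n. diffs (\<lambda>n. of_real (c n)) n * w ^ n)) (at w)"
    by (rule termdiffs_strong_converges_everywhere) (rule summable_pseries[OF assms])
  then show ?thesis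
    by (simp add: pseries_def[abs_def] diffs_def)
qed

lemma has_field_derivative_times_pseries:
  fixes w :: "'a::{real_normed_field,banach}"
  assumes "\<And>n. \<bar>real (Suc n) * c n\<bar> \<le> C / fact n"
  shows "((\<lambda>w. w * pseries c w) has_field_derivative pseries (\<lambda>n. real (Suc n) * c n) w) (at w)"
proof -
  define b where "b n = (case n of 0 \<Rightarrow> 0 | Suc n \<Rightarrow> c n)" for n
  have C: "C \<ge> 0" using order_trans[OF abs_ge_zero assms[of 0]] by simp
  have c: "\<bar>c n\<bar> \<le> C / fact n" for n
  proof -
    have "\<bar>c n\<bar> \<le> \<bar>real (Suc n) * c n\<bar>" by (simp add: abs_mult mult_le_cancel_right1)
    with assms[of n] show ?thesis by linarith
  qed
  have b: "\<bar>b n\<bar> \<le> C / fact n" for n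
  proof (cases n)
    case (Suc m)
    have "\<bar>real (Suc m) * c m\<bar> / real (Suc m) \<le> C / fact m / real (Suc m)"
      by (rule divide_right_mono[OF assms]) simp
    then show ?thesis by (simp add: b_def Suc abs_mult mult.commute)
  qed (use C in \<open>simp add: b_def\<close>)
  have *: "pseries b v = v * pseries c v" for v :: 'a
  proof -
    have "pseries b v = (\<Sum>n. of_real (b (Suc n)) * v ^ Suc n)"
      unfolding pseries_def using suminf_split_head[OF summable_pseries[OF b, of v]] by (simp add: b_def)
    also have "\<dots> = (\<Sum>n. v * (of_real (c n) * v ^ n))"
      by (simp add: b_def algebra_simps)
    also have "\<dots> = v * pseries c v"
      unfolding pseries_def by (rule suminf_mult[OF summable_pseries[OF c]])
    finally show ?thesis .
  qed
  have "(pseries b has_field_derivative pseries (\<lambda>n. real (Suc n) * b (Suc n)) w) (at w)"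
    by (rule has_field_derivative_pseries[OF b])
  moreover have "pseries b = (\<lambda>v :: 'a. v * pseries c v)" using * by (rule ext)
  ultimately show ?thesis by (simp add: b_def)
qed

text \<open>
  The solutions of the modified Bessel equation of order \<open>0\<close> are, in the variable \<open>w = z\<^sup>2 / 4\<close>, the
  series \<open>I\<^sub>0\<close> with coefficients \<open>I0_coeff\<close>, and \<open>ln z \<cdot> I\<^sub>0\<close> minus the series with coefficients
  \<open>N0_coeff\<close>. The primed sequences are the coefficients of the derivatives in \<open>w\<close>.
\<close>

definition I0_coeff :: "nat \<Rightarrow> real" where "I0_coeff n = 1 / (fact n)\<^sup>2"
definition N0_coeff :: "nat \<Rightarrow> real" where "N0_coeff n = harm n / (fact n)\<^sup>2"
definition I0_coeff' :: "nat \<Rightarrow> real" where "I0_coeff' n = real (Suc n) * I0_coeff (Suc n)"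
definition N0_coeff' :: "nat \<Rightarrow> real" where "N0_coeff' n = real (Suc n) * N0_coeff (Suc n)"

lemma harm_le: "harm n \<le> real n"
proof (induction n)
  case (Suc n)
  have "inverse (real (Suc n)) \<le> 1" by (simp add: divide_simps)
  with Suc show ?case by (simp add: harm_Suc)
qed (simp add: harm_def)

lemma coeff_recurrences:
  "real (Suc n) * I0_coeff' n = I0_coeff n" "real (Suc n) * N0_coeff' n = N0_coeff n + I0_coeff' n"
proof -
  have *: "(fact (Suc n))\<^sup>2 = (real (Suc n))\<^sup>2 * (fact n :: real)\<^sup>2"
    by (simp add: power_mult_distrib)
  have gen: "m * (m * ((h + inverse m) / (m\<^sup>2 * f))) = h / f + m * (1 / (m\<^sup>2 * f))"
    if "m \<noteq> 0" "f \<noteq> 0" for m h f :: real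
    using that by (simp add: field_simps power2_eq_square)
  show "real (Suc n) * I0_coeff' n = I0_coeff n"
    unfolding I0_coeff'_def I0_coeff_def * by (simp add: power2_eq_square del: of_nat_Suc)
  show "real (Suc n) * N0_coeff' n = N0_coeff n + I0_coeff' n"
    unfolding I0_coeff'_def I0_coeff_def N0_coeff'_def N0_coeff_def * harm_Suc
    by (rule gen) auto
qed

text \<open>
  All the bounds are of the form \<open>C / n!\<close>, which is the hypothesis of the general facts about
  \<open>pseries\<close>.
\<close>

lemma coeff_bounds:
  "\<bar>I0_coeff n\<bar> \<le> 1 / fact n" "\<bar>N0_coeff n\<bar> \<le> 1 / fact n" "\<bar>I0_coeff' n\<bar> \<le> 1 / fact n" "\<bar>N0_coeff' n\<bar> \<le> 1 / fact n"
  "\<bar>N0_coeff n + I0_coeff' n\<bar> \<le> 2 / fact n"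
proof -
  have f: "fact n \<ge> (1::real)" by (rule fact_ge_1)
  show U: "\<bar>I0_coeff n\<bar> \<le> 1 / fact n" using f by (simp add: I0_coeff_def power2_eq_square divide_simps)
  have n: "real n \<le> fact n" using fact_ge_self[of n] by (metis of_nat_fact of_nat_le_iff)
  have h: "0 \<le> (harm n :: real)" "harm n \<le> (fact n :: real)"
    using harm_le[of n] n by (auto simp: harm_nonneg)
  then show V: "\<bar>N0_coeff n\<bar> \<le> 1 / fact n" using f by (simp add: N0_coeff_def power2_eq_square divide_simps)
  have c: "I0_coeff' n = I0_coeff n / real (Suc n)" using coeff_recurrences(1)[of n] by (simp add: field_simps)
  have "\<bar>I0_coeff' n\<bar> \<le> \<bar>I0_coeff n\<bar>" unfolding c by (simp add: divide_simps abs_mult mult_le_cancel_left1)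
  with U show U': "\<bar>I0_coeff' n\<bar> \<le> 1 / fact n" by linarith
  show "\<bar>N0_coeff n + I0_coeff' n\<bar> \<le> 2 / fact n" using V U' by linarith
  have "harm (Suc n) \<le> real (Suc n)" by (rule harm_le)
  moreover have "N0_coeff' n = (harm (Suc n) / real (Suc n)) * (1 / (fact n)\<^sup>2)"
    by (simp add: N0_coeff'_def N0_coeff_def power2_eq_square)
  moreover have "0 \<le> (harm (Suc n) :: real)" by (rule harm_nonneg)
  ultimately have "N0_coeff' n \<ge> 0" "N0_coeff' n \<le> 1 * (1 / (fact n)\<^sup>2)"
    by (auto intro!: mult_right_mono mult_nonneg_nonneg divide_nonneg_pos simp del: of_nat_Suc simp: pos_divide_le_eq)
  with U show "\<bar>N0_coeff' n\<bar> \<le> 1 / fact n" by (auto simp: I0_coeff_def)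
qed

lemma pseries_derivs:
  fixes w :: "'a::{real_normed_field,banach}"
  shows "(pseries I0_coeff has_field_derivative pseries I0_coeff' w) (at w)"
    "(pseries N0_coeff has_field_derivative pseries N0_coeff' w) (at w)"
    "((\<lambda>w. w * pseries I0_coeff' w) has_field_derivative pseries I0_coeff w) (at w)"
    "((\<lambda>w. w * pseries N0_coeff' w) has_field_derivative pseries N0_coeff w + pseries I0_coeff' w) (at w)"
proof -
  show "(pseries I0_coeff has_field_derivative pseries I0_coeff' w) (at w)"
    using has_field_derivative_pseries[OF coeff_bounds(1), of w] by (simp add: I0_coeff'_def[abs_def])
  show "(pseries N0_coeff has_field_derivative pseries N0_coeff' w) (at w)"
    using has_field_derivative_pseries[OF coeff_bounds(2), of w] by (simp add: N0_coeff'_def[abs_def])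
  show "((\<lambda>w. w * pseries I0_coeff' w) has_field_derivative pseries I0_coeff w) (at w)"
    using has_field_derivative_times_pseries[where c = I0_coeff' and w = w and C = 1] coeff_bounds unfolding coeff_recurrences by simp
  have "pseries (\<lambda>n. N0_coeff n + I0_coeff' n) w = pseries N0_coeff w + pseries I0_coeff' w"
    unfolding pseries_def
    using suminf_add[OF summable_pseries[OF coeff_bounds(2)] summable_pseries[OF coeff_bounds(3)], of w w]
    by (simp add: algebra_simps)
  then show "((\<lambda>w. w * pseries N0_coeff' w) has_field_derivative pseries N0_coeff w + pseries I0_coeff' w) (at w)"
    using has_field_derivative_times_pseries[where c = N0_coeff' and w = w and C = 2] coeff_bounds unfolding coeff_recurrences by simp
qed

text \<open>
  Here \<open>f1\<close> and \<open>g1\<close> stand for \<open>z f'\<close> and \<open>z g'\<close>. With these in place of the derivatives the modified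
  Bessel equation of order \<open>0\<close> becomes \<open>f1' = z f\<close> and the Wronskian is constant without a factor
  \<open>z\<close>.
\<close>

lemma wronskian_constant:
  fixes S :: "complex set"
  assumes S: "convex S" "0 \<notin> S" "open S"
    and "\<And>z. z \<in> S \<Longrightarrow> (f has_field_derivative f1 z / z) (at z)"
    and "\<And>z. z \<in> S \<Longrightarrow> (f1 has_field_derivative z * f z) (at z)"
    and "\<And>z. z \<in> S \<Longrightarrow> (g has_field_derivative g1 z / z) (at z)"
    and "\<And>z. z \<in> S \<Longrightarrow> (g1 has_field_derivative z * g z) (at z)"
  shows "\<exists>c. \<forall>z\<in>S. f1 z * g z - f z * g1 z = c"
proof -
  have "((\<lambda>z. f1 z * g z - f z * g1 z) has_field_derivative 0) (at z within S)" if z: "z \<in> S" for z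
  proof -
    have "((\<lambda>z. f1 z * g z - f z * g1 z) has_field_derivative
        (z * f z * g z + g1 z / z * f1 z) - (f1 z / z * g1 z + z * g z * f z)) (at z)"
      by (intro DERIV_diff DERIV_mult assms z)
    then show ?thesis by (simp add: algebra_simps has_field_derivative_at_within)
  qed
  from has_field_derivative_zero_constant[OF S(1) this] show ?thesis by metis
qed

text \<open>
  The primed functions are \<open>z d/dz\<close> of the unprimed ones. This operator avoids the pole that the
  derivative of the logarithm has at \<open>0\<close>.
\<close>

definition bessel_I0 :: "complex \<Rightarrow> complex" where "bessel_I0 z = pseries I0_coeff (z\<^sup>2 / 4)"
definition bessel_I0' :: "complex \<Rightarrow> complex" where "bessel_I0' z = 2 * (z\<^sup>2 / 4 * pseries I0_coeff' (z\<^sup>2 / 4))"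
definition bessel_N0 :: "complex \<Rightarrow> complex" where
  "bessel_N0 z = Ln z * bessel_I0 z - pseries N0_coeff (z\<^sup>2 / 4)"
definition bessel_N0' :: "complex \<Rightarrow> complex" where
  "bessel_N0' z = bessel_I0 z + Ln z * bessel_I0' z - 2 * (z\<^sup>2 / 4 * pseries N0_coeff' (z\<^sup>2 / 4))"

lemma DERIV_quarter_square:
  assumes "(f has_field_derivative D) (at (z\<^sup>2 / 4 :: complex))"
  shows "((\<lambda>z. f (z\<^sup>2 / 4)) has_field_derivative D * (z / 2)) (at z)"
proof -
  have "((\<lambda>z. z\<^sup>2 / 4) has_field_derivative z / 2) (at z)"
    by (auto intro!: derivative_eq_intros)
  from DERIV_chain2[OF assms this] show ?thesis .
qed

lemma bessel_derivs:
  assumes "z \<notin> \<real>\<^sub>\<le>\<^sub>0"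
  shows "(bessel_I0 has_field_derivative bessel_I0' z / z) (at z)"
    "(bessel_I0' has_field_derivative z * bessel_I0 z) (at z)"
    "(bessel_N0 has_field_derivative bessel_N0' z / z) (at z)"
    "(bessel_N0' has_field_derivative z * bessel_N0 z) (at z)"
proof -
  have z: "z \<noteq> 0" using assms by auto
  note d = pseries_derivs[of "z\<^sup>2 / 4", THEN DERIV_quarter_square]
  have L: "(Ln has_field_derivative inverse z) (at z)" using assms by (rule has_field_derivative_Ln)
  show A: "(bessel_I0 has_field_derivative bessel_I0' z / z) (at z)"
    unfolding bessel_I0_def[abs_def] bessel_I0'_def
    by (rule DERIV_cong[OF d(1)]) (use z in \<open>simp add: field_simps power2_eq_square\<close>)
  show B: "(bessel_I0' has_field_derivative z * bessel_I0 z) (at z)"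
    unfolding bessel_I0'_def[abs_def] bessel_I0_def
    by (rule DERIV_cong[OF DERIV_cmult[OF d(3)]]) simp
  show "(bessel_N0 has_field_derivative bessel_N0' z / z) (at z)"
    unfolding bessel_N0_def[abs_def] bessel_N0'_def
    by (rule DERIV_cong[OF DERIV_diff[OF DERIV_mult[OF L A] d(2)]])
      (use z in \<open>simp add: field_simps power2_eq_square\<close>)
  have e: "bessel_I0' z / z = z / 2 * pseries I0_coeff' (z\<^sup>2 / 4)"
    using z by (simp add: bessel_I0'_def field_simps power2_eq_square)
  have e2: "inverse z * bessel_I0' z = z / 2 * pseries I0_coeff' (z\<^sup>2 / 4)"
    using e by (simp add: field_simps)
  have "(bessel_N0' has_field_derivative
      bessel_I0' z / z + (inverse z * bessel_I0' z + z * bessel_I0 z * Ln z) - 2 * ((pseries N0_coeff (z\<^sup>2 / 4) + pseries I0_coeff' (z\<^sup>2 / 4)) * (z / 2))) (at z)"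
    unfolding bessel_N0'_def[abs_def]
    by (intro DERIV_diff DERIV_add DERIV_mult A B L DERIV_cmult d(4))
  then show "(bessel_N0' has_field_derivative z * bessel_N0 z) (at z)"
    unfolding e e2 bessel_N0_def by (rule DERIV_cong) (simp add: algebra_simps)
qed

text \<open>
  The Wronskian of \<open>I\<^sub>0\<close> and \<open>N\<^sub>0\<close>, after the logarithms have cancelled, is an entire function of
  \<open>w = z\<^sup>2 / 4\<close>; its derivative vanishes and its value at \<open>0\<close> is \<open>1\<close>. Being a statement about
  series, it holds also on the imaginary axis.
\<close>

lemma pseries_wronskian:
  fixes w :: "'a::{real_normed_field,banach}"
  shows "(pseries I0_coeff w)\<^sup>2 + 2 * (w * pseries I0_coeff' w * pseries N0_coeff w - pseries I0_coeff w * (w * pseries N0_coeff' w)) = 1"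
proof -
  let ?W = "\<lambda>w::'a. (pseries I0_coeff w)\<^sup>2 + 2 * (w * pseries I0_coeff' w * pseries N0_coeff w - pseries I0_coeff w * (w * pseries N0_coeff' w))"
  have "(?W has_field_derivative 0) (at w within UNIV)" for w
  proof -
    have "(?W has_field_derivative
      2 * pseries I0_coeff w * pseries I0_coeff' w + 2 * ((pseries I0_coeff w * pseries N0_coeff w + pseries N0_coeff' w * (w * pseries I0_coeff' w))
        - (pseries I0_coeff' w * (w * pseries N0_coeff' w) + (pseries N0_coeff w + pseries I0_coeff' w) * pseries I0_coeff w))) (at w)"
      by (intro DERIV_add DERIV_diff DERIV_mult DERIV_cmult pseries_derivs)
        (use DERIV_power[OF pseries_derivs(1), of 2 w] in \<open>simp add: mult_ac\<close>)
    then show ?thesis by (simp add: algebra_simps)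
  qed
  from has_field_derivative_zero_constant[OF convex_UNIV this]
  obtain c where c: "?W w = c" for w by blast
  have p0: "pseries a (0::'a) = of_real (a 0)" for a
    unfolding pseries_def by (subst suminf_finite[of "{0}"]) auto
  have "c = ?W 0" using c[of 0] by simp
  also have "\<dots> = 1" by (simp add: p0 I0_coeff_def N0_coeff_def I0_coeff'_def N0_coeff'_def)
  finally show ?thesis using c[of w] by simp
qed

lemma bessel_wronskian: "bessel_I0 z * bessel_N0' z - bessel_I0' z * bessel_N0 z = 1"
proof -
  let ?w = "z\<^sup>2 / 4"
  have "bessel_I0 z * bessel_N0' z - bessel_I0' z * bessel_N0 z =
     (pseries I0_coeff ?w)\<^sup>2 + 2 * (?w * pseries I0_coeff' ?w * pseries N0_coeff ?w - pseries I0_coeff ?w * (?w * pseries N0_coeff' ?w))"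
    unfolding bessel_N0_def bessel_N0'_def unfolding bessel_I0_def bessel_I0'_def
    by (simp only: algebra_simps power2_eq_square)
  then show ?thesis using pseries_wronskian[of ?w] by simp
qed

lemma pseries_I0_coeff_ge_1:
  assumes "x \<ge> (0::real)"
  shows "pseries I0_coeff x \<ge> 1"
proof -
  have "(\<Sum>n\<in>{0}. I0_coeff n * x ^ n) \<le> (\<Sum>n. I0_coeff n * x ^ n)"
    using summable_pseries[OF coeff_bounds(1), of x] assms by (intro sum_le_suminf) (auto simp: I0_coeff_def)
  then show ?thesis by (simp add: pseries_def I0_coeff_def)
qed

text \<open>
  The Wronskians of \<open>K\<^sub>0\<close> with \<open>I\<^sub>0\<close> and with \<open>N\<^sub>0\<close> are constants \<open>c1\<close> and \<open>c2\<close>, and Cramer's rule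
  with the Wronskian \<open>1\<close> of \<open>I\<^sub>0\<close> and \<open>N\<^sub>0\<close> expresses \<open>K\<^sub>0\<close> by them. The constants are real because
  everything is real at \<open>z = 1\<close>. The coefficient of \<open>N\<^sub>0\<close> cannot vanish, since \<open>I\<^sub>0 \<ge> 1\<close> on the
  positive axis whereas \<open>K\<^sub>0\<close> tends to \<open>0\<close>.
\<close>

lemma macdonald_representation:
  obtains \<alpha> \<beta> :: real where "\<beta> \<noteq> 0"
    "\<And>z. Re z > 0 \<Longrightarrow> cosh_moment 0 z = \<alpha> * bessel_I0 z + \<beta> * bessel_N0 z"
    "\<And>z. Re z > 0 \<Longrightarrow> - z * cosh_moment 1 z = \<alpha> * bessel_I0' z + \<beta> * bessel_N0' z"
proof -
  define S where "S = {z. Re z > 0}"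
  have S: "convex S" "0 \<notin> S" "open S" "1 \<in> S"
    by (auto simp: S_def convex_halfspace_Re_gt open_halfspace_Re_gt)
  have nS: "z \<notin> \<real>\<^sub>\<le>\<^sub>0" "z \<noteq> 0" "Re z > 0" if "z \<in> S" for z
    using that by (auto simp: S_def complex_nonpos_Reals_iff)
  define K1 where "K1 z = - (z * cosh_moment 1 z)" for z
  have dK0: "(cosh_moment 0 has_field_derivative K1 z / z) (at z)" if "z \<in> S" for z
    using has_field_derivative_cosh_moment[OF nS(3)[OF that], of 0] nS[OF that] by (simp add: K1_def)
  have dK1: "(K1 has_field_derivative z * cosh_moment 0 z) (at z)" if "z \<in> S" for z
    using DERIV_minus[OF has_field_derivative_times_cosh_moment_1[OF nS(3)[OF that]]] by (simp add: K1_def[abs_def])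
  obtain c1 where c1: "\<And>z. z \<in> S \<Longrightarrow> K1 z * bessel_I0 z - cosh_moment 0 z * bessel_I0' z = c1"
    using wronskian_constant[OF S(1,2,3) dK0 dK1 bessel_derivs(1) bessel_derivs(2)] nS(1) by blast
  obtain c2 where c2: "\<And>z. z \<in> S \<Longrightarrow> K1 z * bessel_N0 z - cosh_moment 0 z * bessel_N0' z = c2"
    using wronskian_constant[OF S(1,2,3) dK0 dK1 bessel_derivs(3) bessel_derivs(4)] nS(1) by blast
  have r0: "cosh_moment 0 z = - c2 * bessel_I0 z + c1 * bessel_N0 z" if "z \<in> S" for z
  proof -
    have "- c2 * bessel_I0 z + c1 * bessel_N0 z = cosh_moment 0 z * (bessel_I0 z * bessel_N0' z - bessel_I0' z * bessel_N0 z)"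
      unfolding c1[OF that, symmetric] c2[OF that, symmetric] by (simp add: algebra_simps)
    then show ?thesis by (simp add: bessel_wronskian)
  qed
  have r1: "K1 z = - c2 * bessel_I0' z + c1 * bessel_N0' z" if "z \<in> S" for z
  proof -
    have "- c2 * bessel_I0' z + c1 * bessel_N0' z = K1 z * (bessel_I0 z * bessel_N0' z - bessel_I0' z * bessel_N0 z)"
      unfolding c1[OF that, symmetric] c2[OF that, symmetric] by (simp add: algebra_simps)
    then show ?thesis by (simp add: bessel_wronskian)
  qed
  have real_ps: "pseries c (1/4 :: complex) \<in> \<real>" if "\<And>n. \<bar>c n\<bar> \<le> 1 / fact n" for c
    using pseries_of_real[OF that, of "1/4", where 'a = complex] by (metis Reals_of_real of_real_divide of_real_numeral of_real_1)
  have real1: "bessel_I0 1 \<in> \<real>" "bessel_I0' 1 \<in> \<real>" "bessel_N0 1 \<in> \<real>" "bessel_N0' 1 \<in> \<real>"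
    unfolding bessel_N0_def bessel_N0'_def unfolding bessel_I0_def bessel_I0'_def
    by (auto intro!: Reals_mult Reals_diff Reals_add Reals_divide real_ps coeff_bounds)
  have K1real: "cosh_moment n 1 \<in> \<real>" for n
    using cosh_moment_of_real[of n 1] by (metis Reals_of_real of_real_1)
  have "c1 \<in> \<real>" "c2 \<in> \<real>"
    using c1[OF S(4)] c2[OF S(4)] real1 K1real
    by (auto simp: K1_def intro!: Reals_diff Reals_mult Reals_minus)
  then obtain \<alpha> \<beta> where ab: "- c2 = of_real \<alpha>" "c1 = of_real \<beta>"
    by (metis Reals_cases Reals_minus)
  have "\<beta> \<noteq> 0"
  proof
    assume "\<beta> = 0"
    have bound: "\<bar>\<alpha>\<bar> \<le> 4 * pi / x" if "x > 0" for x
    proof -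
      have x: "of_real x \<in> S" using that by (simp add: S_def)
      have q: "(of_real x)\<^sup>2 / 4 = (of_real (x\<^sup>2 / 4) :: complex)" by simp
      have "norm (cosh_moment 0 (of_real x)) = \<bar>\<alpha>\<bar> * \<bar>pseries I0_coeff (x\<^sup>2 / 4)\<bar>"
        using r0[OF x] ab \<open>\<beta> = 0\<close> unfolding bessel_I0_def q pseries_of_real[OF coeff_bounds(1)] by (simp add: norm_mult)
      moreover have "\<bar>\<alpha>\<bar> * 1 \<le> \<bar>\<alpha>\<bar> * \<bar>pseries I0_coeff (x\<^sup>2 / 4)\<bar>"
        using pseries_I0_coeff_ge_1[of "x\<^sup>2 / 4"] by (intro mult_left_mono) auto
      moreover have "norm (cosh_moment 0 (of_real x)) \<le> 4 * pi / x"
        using norm_cosh_moment_le[of "of_real x" 0] that by simp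
      ultimately show ?thesis by linarith
    qed
    have "\<alpha> = 0"
    proof (rule ccontr)
      assume "\<alpha> \<noteq> 0"
      \<comment> \<open>At \<open>x = 8 \<pi> / |\<alpha>|\<close> the bound reads \<open>|\<alpha>| \<le> |\<alpha>| / 2\<close>.\<close>
      then have "\<bar>\<alpha>\<bar> \<le> 4 * pi / (8 * pi / \<bar>\<alpha>\<bar>)" by (intro bound) simp
      then show False using \<open>\<alpha> \<noteq> 0\<close> by simp
    qed
    then have "cosh_moment 0 1 = 0" using r0[OF S(4)] ab \<open>\<beta> = 0\<close> by simp
    then show False using cosh_moment_of_real[of 0 1] cosh_moment_real_pos[of 1 0] by simp
  qed
  then show ?thesis
    using that[of \<beta> \<alpha>] r0 r1 unfolding ab K1_def by (auto simp: S_def)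
qed

section \<open>The Poisson formula for the half-plane\<close>

lemma tendsto_zero_sandwich_inverse:
  assumes "\<And>n. n \<ge> n0 \<Longrightarrow> norm (X n :: complex) \<le> C / (real n)"
  shows "X \<longlonglongrightarrow> 0"
proof (rule Lim_null_comparison)
  show "\<forall>\<^sub>F n in sequentially. norm (X n) \<le> C / real n"
    using assms by (auto simp: eventually_sequentially)
  show "(\<lambda>n. C / real n) \<longlonglongrightarrow> 0" by (rule lim_const_over_n)
qed

lemma integrable_poisson_kernel:
  fixes x :: real
  assumes "x > 0"
  shows "integrable lborel (\<lambda>y. 1 / (x\<^sup>2 + y\<^sup>2))"
proof -
  have "integrable lborel (\<lambda>u::real. inverse (1 + u\<^sup>2))"
    using integrable_inverse_1_plus_square by (simp add: set_integrable_def)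
  then have "integrable lborel (\<lambda>y. inverse (1 + (0 + inverse x * y)\<^sup>2))"
    using assms by (subst lborel_integrable_real_affine_iff) auto
  then have "integrable lborel (\<lambda>y. inverse (x\<^sup>2) * inverse (1 + (inverse x * y)\<^sup>2))"
    by (intro integrable_mult_right) simp
  also have "(\<lambda>y. inverse (x\<^sup>2) * inverse (1 + (inverse x * y)\<^sup>2)) = (\<lambda>y. 1 / (x\<^sup>2 + y\<^sup>2))"
    using assms by (auto simp: fun_eq_iff field_simps power2_eq_square)
  finally show ?thesis .
qed

text \<open>
  Cauchy's formula at \<open>x\<close> is applied to \<open>f z / (z + x)\<close> on rectangles with corners \<open>\<delta> \<plusminus> i n\<close> and
  \<open>n \<plusminus> i n\<close>. The factor \<open>z + x\<close> reflects the pole: it makes the integrand \<open>O(n\<^sup>-\<^sup>2)\<close> on the three far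
  sides and turns the kernel on the near side into \<open>- 1 / (x\<^sup>2 + y\<^sup>2)\<close>. As \<open>\<delta>\<close> tends to \<open>0\<close> the near
  side converges by dominated convergence, so boundary limits along the sequence \<open>\<delta> n\<close>, almost
  everywhere, are enough.
\<close>

lemma half_plane_poisson:
  fixes f :: "complex \<Rightarrow> complex" and x :: real
  assumes hol: "f holomorphic_on {z. Re z > 0}"
    and bound: "\<And>z. Re z > 0 \<Longrightarrow> norm (f z) \<le> 1"
    and x: "x > 0"
    and lim: "AE y in lborel. (\<lambda>n. f (Complex (1 / real (Suc n)) y)) \<longlonglongrightarrow> \<psi> y"
    and meas [measurable]: "\<psi> \<in> borel_measurable borel"
  shows "f (of_real x) = of_real (x / pi) * (LINT y|lborel. \<psi> y / of_real (x\<^sup>2 + y\<^sup>2))"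
proof -
  let ?S = "{z. Re z > 0}"
  define \<delta> where "\<delta> n = 1 / real (Suc n)" for n
  define g where "g z = f z / (z + of_real x) / (z - of_real x)" for z
  define a b c d where "a n = Complex (\<delta> n) (- real n)" and "b n = Complex (real n) (- real n)"
    and "c n = Complex (real n) (real n)" and "d n = Complex (\<delta> n) (real n)" for n
  \<comment> \<open>From \<open>n0\<close> on, \<open>x\<close> lies inside the rectangle, at distance at least \<open>x / 2\<close> from its near side,
    and both \<open>z + x\<close> and \<open>z - x\<close> have norm at least \<open>n / 2\<close> on the far sides.\<close>
  obtain n0 :: nat where n0: "real n0 > 2 * x + 2 / x + 2" using reals_Archimedean2 by blast
  have n0': "real n > 2 * x" "real n > 2" "1 / real (Suc n) < x / 2" if "n \<ge> n0" for n
  proof -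
    have "real n > 2 * x + 2 / x + 2" using n0 that by (meson less_le_trans of_nat_le_iff)
    moreover have "2 / x > 0" using x by simp
    ultimately show "real n > 2 * x" "real n > 2" using x by linarith+
    have "real (Suc n) > 2 / x" using \<open>real n > 2 * x + 2 / x + 2\<close> x by simp
    then show "1 / real (Suc n) < x / 2" using x by (simp add: field_simps)
  qed
  have contf: "continuous_on ?S f" using hol by (rule holomorphic_on_imp_continuous_on)
  have gbound: "norm (g z) \<le> 4 / (real n)\<^sup>2" if z: "norm z \<ge> real n" "Re z > 0" and n: "n \<ge> n0" for z n
  proof -
    have "norm (z + of_real x) \<ge> real n / 2" "norm (z - of_real x) \<ge> real n / 2"
      using norm_diff_ineq[of z "of_real x"] norm_triangle_ineq2[of z "of_real x"] z n0'[OF n] x by auto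
    then have "norm (z + of_real x) * norm (z - of_real x) \<ge> (real n / 2) * (real n / 2)"
      by (intro mult_mono) auto
    moreover have "norm (g z) = norm (f z) / (norm (z + of_real x) * norm (z - of_real x))"
      by (simp add: g_def norm_divide norm_mult)
    moreover have "norm (f z) / (norm (z + of_real x) * norm (z - of_real x)) \<le> 1 / (norm (z + of_real x) * norm (z - of_real x))"
      using bound[OF z(2)] by (intro divide_right_mono) auto
    moreover have "1 / (norm (z + of_real x) * norm (z - of_real x)) \<le> 1 / ((real n / 2) * (real n / 2))"
      using calculation(1) n0'[OF n] by (intro frac_le) (auto intro!: mult_pos_pos)
    ultimately show ?thesis by (simp add: power2_eq_square)
  qed
  define I where "I n = (LINT y|lborel. indicator {- real n..real n} y *\<^sub>R g (Complex (\<delta> n) y))" for n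
  have gcont: "continuous_on (?S - {of_real x}) g"
    unfolding g_def using x
    by (intro continuous_intros continuous_on_subset[OF contf]) (auto simp: complex_eq_iff)
  have main: "norm (\<i> * I n + of_real pi * \<i> * f (of_real x) / of_real x) \<le> 24 / real n" if n: "n \<ge> n0" for n
  proof -
    note nn = n0'[OF n]
    have d: "\<delta> n > 0" "\<delta> n < x / 2" "\<delta> n < real n" using nn x by (auto simp: \<delta>_def)
    have xbox: "of_real x \<in> box (a n) (c n)" using d nn x by (auto simp: in_box_complex_iff a_def c_def)
    have sub: "path_image (rectpath (a n) (c n)) \<subseteq> ?S - {of_real x}"
    proof -
      have "path_image (rectpath (a n) (c n)) = cbox (a n) (c n) - box (a n) (c n)"
        using d nn by (intro path_image_rectpath_cbox_minus_box) (auto simp: a_def c_def)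
      then have "z \<in> cbox (a n) (c n)" "z \<noteq> of_real x" if "z \<in> path_image (rectpath (a n) (c n))" for z
        using that xbox by blast+
      then show ?thesis using d(1) unfolding in_cbox_complex_iff a_def complex.sel by fastforce
    qed
    have "((\<lambda>z. (f z / (z + of_real x)) / (z - of_real x)) has_contour_integral
        (2 * pi * \<i> * winding_number (rectpath (a n) (c n)) (of_real x) * (f (of_real x) / (of_real x + of_real x)))) (rectpath (a n) (c n))"
    proof (rule Cauchy_integral_formula_convex_simple)
      show "convex ?S" by (rule convex_halfspace_Re_gt)
      show "(\<lambda>z. f z / (z + of_real x)) holomorphic_on ?S"
        using x by (intro holomorphic_intros hol) (auto simp: complex_eq_iff)
      show "of_real x \<in> interior ?S" using x interior_open[OF open_halfspace_Re_gt[of 0]] by simp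
      show "path_image (rectpath (a n) (c n)) \<subseteq> ?S - {of_real x}" by (rule sub)
    qed auto
    moreover have "2 * pi * \<i> * winding_number (rectpath (a n) (c n)) (of_real x) * (f (of_real x) / (of_real x + of_real x))
        = of_real pi * \<i> * f (of_real x) / of_real x"
      unfolding winding_number_rectpath[OF xbox] using x by (simp add: field_simps)
    ultimately have "(g has_contour_integral of_real pi * \<i> * f (of_real x) / of_real x) (rectpath (a n) (c n))"
      by (simp only: g_def[abs_def])
    moreover have "rectpath (a n) (c n) = linepath (a n) (b n) +++ linepath (b n) (c n) +++ linepath (c n) (d n) +++ linepath (d n) (a n)"
      by (simp add: rectpath_def Let_def a_def b_def c_def d_def)
    ultimately have hci: "(g has_contour_integral of_real pi * \<i> * f (of_real x) / of_real x)
        (linepath (a n) (b n) +++ linepath (b n) (c n) +++ linepath (c n) (d n) +++ linepath (d n) (a n))" by simp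
    have seg: "closed_segment (a n) (b n) \<subseteq> {z. Re z > 0 \<and> norm z \<ge> real n}"
        "closed_segment (b n) (c n) \<subseteq> {z. Re z > 0 \<and> norm z \<ge> real n}"
        "closed_segment (c n) (d n) \<subseteq> {z. Re z > 0 \<and> norm z \<ge> real n}"
    proof -
      have 1: "z \<in> {z. Re z > 0 \<and> norm z \<ge> real n}" if "Re z \<ge> \<delta> n" "\<bar>Im z\<bar> = real n \<or> \<bar>Re z\<bar> = real n" for z
        using that d abs_Re_le_cmod[of z] abs_Im_le_cmod[of z] by auto
      show "closed_segment (a n) (b n) \<subseteq> {z. Re z > 0 \<and> norm z \<ge> real n}"
        using d by (intro subsetI 1) (auto simp: closed_segment_same_Im a_def b_def closed_segment_eq_real_ivl)
      show "closed_segment (b n) (c n) \<subseteq> {z. Re z > 0 \<and> norm z \<ge> real n}"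
        using d by (intro subsetI 1) (auto simp: closed_segment_same_Re b_def c_def closed_segment_eq_real_ivl)
      show "closed_segment (c n) (d n) \<subseteq> {z. Re z > 0 \<and> norm z \<ge> real n}"
        using d by (intro subsetI 1) (auto simp: closed_segment_same_Im c_def d_def closed_segment_eq_real_ivl)
    qed
    have notx: "{z. Re z > 0 \<and> norm z \<ge> real n} \<subseteq> ?S - {of_real x}" using nn x by auto
    have seg4: "closed_segment (d n) (a n) \<subseteq> ?S - {of_real x}"
      using d by (auto simp: closed_segment_same_Re d_def a_def)
    have ci: "g contour_integrable_on linepath p q" if "closed_segment p q \<subseteq> ?S - {of_real x}" for p q
      by (intro contour_integrable_continuous_linepath continuous_on_subset[OF gcont] that)
    note ci1 = ci[OF order_trans[OF seg(1) notx]] and ci2 = ci[OF order_trans[OF seg(2) notx]]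
      and ci3 = ci[OF order_trans[OF seg(3) notx]] and ci4 = ci[OF seg4]
    have sum: "contour_integral (linepath (a n) (b n)) g + (contour_integral (linepath (b n) (c n)) g
        + (contour_integral (linepath (c n) (d n)) g + contour_integral (linepath (d n) (a n)) g))
        = of_real pi * \<i> * f (of_real x) / of_real x"
      using contour_integral_unique[OF hci] ci1 ci2 ci3 ci4 by (simp add: contour_integrable_joinI)
    have len: "norm (contour_integral (linepath p q) g) \<le> 4 / (real n)\<^sup>2 * norm (q - p)"
      if "closed_segment p q \<subseteq> {z. Re z > 0 \<and> norm z \<ge> real n}" for p q
      by (rule contour_integral_bound_linepath)
        (use that gbound[OF _ _ n] ci[OF order_trans[OF that notx]] in auto)
    have nb: "norm (b n - a n) \<le> real n" "norm (c n - b n) \<le> 2 * real n" "norm (d n - c n) \<le> real n"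
      using d by (auto simp: a_def b_def c_def d_def cmod_def real_sqrt_mult)
    have l1: "4 / (real n)\<^sup>2 * L \<le> k * 4 / real n" if "L \<le> k * real n" for L k
    proof -
      have "4 / (real n)\<^sup>2 * L \<le> 4 / (real n)\<^sup>2 * (k * real n)" using that by (intro mult_left_mono) auto
      also have "\<dots> = k * 4 / real n" using nn by (simp add: field_simps power2_eq_square)
      finally show ?thesis .
    qed
    have small: "norm (contour_integral (linepath (a n) (b n)) g) \<le> 1 * 4 / real n"
       "norm (contour_integral (linepath (b n) (c n)) g) \<le> 2 * 4 / real n"
       "norm (contour_integral (linepath (c n) (d n)) g) \<le> 1 * 4 / real n"
      using order_trans[OF len[OF seg(1)] l1[of _ 1]] order_trans[OF len[OF seg(2)] l1[of _ 2]] order_trans[OF len[OF seg(3)] l1[of _ 1]] nb by auto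
    have "contour_integral (linepath (d n) (a n)) g = - contour_integral (linepath (a n) (d n)) g"
      using contour_integral_reversepath[of "linepath (a n) (d n)" g] by simp
    also have "contour_integral (linepath (a n) (d n)) g = \<i> * integral {- real n..real n} (\<lambda>y. g (Complex (\<delta> n) y))"
      using nn by (intro contour_integral_linepath_same_Re) (auto simp: a_def d_def)
    also have "integral {- real n..real n} (\<lambda>y. g (Complex (\<delta> n) y)) = I n"
    proof -
      have "continuous_on {- real n..real n} (\<lambda>y. g (Complex (\<delta> n) y))"
        by (rule continuous_on_compose2[OF gcont]) (use d in \<open>auto intro!: continuous_intros simp: Complex_eq complex_eq_iff\<close>)
      then have "set_integrable lborel {- real n..real n} (\<lambda>y. g (Complex (\<delta> n) y))"
        by (rule borel_integrable_atLeastAtMost')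
      from set_borel_integral_eq_integral(2)[OF this] show ?thesis
        by (simp add: I_def set_lebesgue_integral_def)
    qed
    finally have left: "contour_integral (linepath (d n) (a n)) g = - (\<i> * I n)" .
    have "\<i> * I n + of_real pi * \<i> * f (of_real x) / of_real x =
       contour_integral (linepath (a n) (b n)) g + (contour_integral (linepath (b n) (c n)) g + contour_integral (linepath (c n) (d n)) g)"
      using sum unfolding left by (simp add: algebra_simps)
    also have "norm \<dots> \<le> 1 * 4 / real n + (2 * 4 / real n + 1 * 4 / real n)"
      by (intro norm_triangle_le add_mono small order_refl)
    also have "\<dots> \<le> 24 / real n" using nn by (simp add: field_simps)
    finally show ?thesis .
  qed
  have "(\<lambda>n. \<i> * I n + of_real pi * \<i> * f (of_real x) / of_real x) \<longlonglongrightarrow> 0"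
    by (rule tendsto_zero_sandwich_inverse[OF main])
  then have "(\<lambda>n. (\<i> * I n + of_real pi * \<i> * f (of_real x) / of_real x) * (- \<i>) - of_real pi * f (of_real x) / of_real x) \<longlonglongrightarrow>
     0 * (- \<i>) - of_real pi * f (of_real x) / of_real x"
    by (intro tendsto_intros)
  then have I1: "I \<longlonglongrightarrow> - (of_real pi * f (of_real x) / of_real x)"
    by (simp add: algebra_simps)
  have I2: "(\<lambda>n. I (n + n0)) \<longlonglongrightarrow> (LINT y|lborel. - (\<psi> y / of_real (x\<^sup>2 + y\<^sup>2)))"
    unfolding I_def
  proof (rule integral_dominated_convergence[where w = "\<lambda>y. 2 * (1 / ((x / 2)\<^sup>2 + y\<^sup>2))"])
    show "integrable lborel (\<lambda>y. 2 * (1 / ((x / 2)\<^sup>2 + y\<^sup>2)))"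
      by (intro integrable_mult_right integrable_poisson_kernel) (use x in auto)
    show "AE y in lborel. (\<lambda>n. indicator {- real (n + n0)..real (n + n0)} y *\<^sub>R g (Complex (\<delta> (n + n0)) y)) \<longlonglongrightarrow> - (\<psi> y / of_real (x\<^sup>2 + y\<^sup>2))"
      using lim
    proof eventually_elim
      case (elim y)
      have "(\<lambda>n. Complex (\<delta> n) y) \<longlonglongrightarrow> Complex 0 y"
        unfolding \<delta>_def using lim_inverse_n' LIMSEQ_Suc[OF lim_inverse_n']
        by (intro tendsto_Complex tendsto_const) (simp add: inverse_eq_divide)
      moreover have "Complex 0 y + of_real x \<noteq> 0" "Complex 0 y - of_real x \<noteq> 0" using x by (auto simp: complex_eq_iff)
      ultimately have "(\<lambda>n. g (Complex (\<delta> n) y)) \<longlonglongrightarrow> \<psi> y / (Complex 0 y + of_real x) / (Complex 0 y - of_real x)"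
        unfolding g_def using elim unfolding \<delta>_def[symmetric]
        by (intro tendsto_divide tendsto_add tendsto_diff tendsto_const) auto
      also have "\<psi> y / (Complex 0 y + of_real x) / (Complex 0 y - of_real x) = - (\<psi> y / of_real (x\<^sup>2 + y\<^sup>2))"
      proof -
        have "(Complex 0 y + of_real x) * (Complex 0 y - of_real x) = - of_real (x\<^sup>2 + y\<^sup>2)"
          by (auto simp: complex_eq_iff power2_eq_square algebra_simps)
        then show ?thesis unfolding divide_divide_eq_left by (simp only: divide_minus_right)
      qed
      finally have l: "(\<lambda>n. g (Complex (\<delta> n) y)) \<longlonglongrightarrow> - (\<psi> y / of_real (x\<^sup>2 + y\<^sup>2))" .
      have "\<forall>\<^sub>F n in sequentially. real n \<ge> \<bar>y\<bar>" 
        using filterlim_real_sequentially by (auto simp: filterlim_at_top)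
      then have "\<forall>\<^sub>F n in sequentially. g (Complex (\<delta> n) y) = indicator {- real n..real n} y *\<^sub>R g (Complex (\<delta> n) y)"
        by eventually_elim (auto simp: indicator_def abs_le_iff)
      then have "(\<lambda>n. indicator {- real n..real n} y *\<^sub>R g (Complex (\<delta> n) y)) \<longlonglongrightarrow> - (\<psi> y / of_real (x\<^sup>2 + y\<^sup>2))"
        using l by (rule Lim_transform_eventually[rotated])
      then show ?case by (rule LIMSEQ_ignore_initial_segment)
    qed
    show "AE y in lborel. norm (indicator {- real (n + n0)..real (n + n0)} y *\<^sub>R g (Complex (\<delta> (n + n0)) y)) \<le> 2 * (1 / ((x / 2)\<^sup>2 + y\<^sup>2))" for n
    proof (rule AE_I2)
      fix y
      let ?z = "Complex (\<delta> (n + n0)) y"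
      have d: "\<delta> (n + n0) > 0" "\<delta> (n + n0) < x / 2" using n0'[of "n + n0"] by (auto simp: \<delta>_def)
      have q: "(x / 2)\<^sup>2 + y\<^sup>2 > 0" using x by (intro add_pos_nonneg) auto
      have "norm (?z + of_real x) * norm (?z - of_real x) = norm (?z\<^sup>2 - (of_real x)\<^sup>2)"
        by (simp add: norm_mult[symmetric] power2_eq_square algebra_simps)
      also have "\<dots> \<ge> \<bar>Re (?z\<^sup>2 - (of_real x)\<^sup>2)\<bar>" by (rule abs_Re_le_cmod)
      also have "\<bar>Re (?z\<^sup>2 - (of_real x)\<^sup>2)\<bar> = \<bar>(\<delta> (n + n0))\<^sup>2 - y\<^sup>2 - x\<^sup>2\<bar>" by (simp add: power2_eq_square)
      finally have 1: "\<bar>(\<delta> (n + n0))\<^sup>2 - y\<^sup>2 - x\<^sup>2\<bar> \<le> norm (?z + of_real x) * norm (?z - of_real x)" .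
      have "(\<delta> (n + n0))\<^sup>2 \<le> (x / 2)\<^sup>2" using d by (intro power_mono) auto
      moreover have "(x / 2)\<^sup>2 = x\<^sup>2 / 4" by (simp add: power_divide)
      ultimately have "(x / 2)\<^sup>2 + y\<^sup>2 \<le> \<bar>(\<delta> (n + n0))\<^sup>2 - y\<^sup>2 - x\<^sup>2\<bar>"
        using abs_ge_minus_self[of "(\<delta> (n + n0))\<^sup>2 - y\<^sup>2 - x\<^sup>2"] zero_le_power2[of x]
        by linarith
      with 1 have 2: "(x / 2)\<^sup>2 + y\<^sup>2 \<le> norm (?z + of_real x) * norm (?z - of_real x)" by linarith
      have "norm (g ?z) = norm (f ?z) / (norm (?z + of_real x) * norm (?z - of_real x))"
        by (simp add: g_def norm_divide norm_mult)
      also have "\<dots> \<le> 1 / ((x / 2)\<^sup>2 + y\<^sup>2)"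
        using bound[of ?z] d 2 q by (intro frac_le) auto
      finally have "norm (g ?z) \<le> 1 / ((x / 2)\<^sup>2 + y\<^sup>2)" .
      moreover have "norm (indicator {- real (n + n0)..real (n + n0)} y *\<^sub>R g ?z) \<le> norm (g ?z)"
        by (auto simp: indicator_def)
      moreover have "0 \<le> 1 / ((x / 2)\<^sup>2 + y\<^sup>2)" using q by simp
      ultimately show "norm (indicator {- real (n + n0)..real (n + n0)} y *\<^sub>R g ?z) \<le> 2 * (1 / ((x / 2)\<^sup>2 + y\<^sup>2))" by linarith
    qed
    show "(\<lambda>y. indicator {- real (n + n0)..real (n + n0)} y *\<^sub>R g (Complex (\<delta> (n + n0)) y)) \<in> borel_measurable lborel" for n
    proof -
      have "\<delta> (n + n0) > 0" "\<delta> (n + n0) < x / 2" using n0'[of "n + n0"] by (auto simp: \<delta>_def)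
      then have "continuous_on UNIV (\<lambda>y. g (Complex (\<delta> (n + n0)) y))"
        by (intro continuous_on_compose2[OF gcont]) (auto intro!: continuous_intros simp: Complex_eq complex_eq_iff)
      then have [measurable]: "(\<lambda>y. g (Complex (\<delta> (n + n0)) y)) \<in> borel_measurable borel"
        by (rule borel_measurable_continuous_onI)
      show ?thesis by simp
    qed
  qed simp
  have "- (of_real pi * f (of_real x) / of_real x) = (LINT y|lborel. - (\<psi> y / of_real (x\<^sup>2 + y\<^sup>2)))"
    by (rule LIMSEQ_unique[OF LIMSEQ_ignore_initial_segment[OF I1] I2])
  then show ?thesis using x by (simp add: field_simps)
qed

section \<open>The quotient of Macdonald functions as a Stieltjes transform\<close>

text \<open>
  By \<open>macdonald_representation\<close> the function \<open>z K\<^sub>1\<close> is proportional to \<open>\<kappa> I\<^sub>0' + N\<^sub>0'\<close>, where primes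
  mean \<open>z d/dz\<close> and \<open>\<kappa> = \<alpha> / \<beta>\<close> (in fact Euler's constant minus \<open>ln 2\<close>). At \<open>z = i \<surd>u\<close> its real and
  imaginary parts are \<open>cut_re\<close> and \<open>- cut_im\<close>.
\<close>

definition cut_re :: "real \<Rightarrow> real \<Rightarrow> real" where
  "cut_re \<kappa> u = pseries I0_coeff (- u / 4) - u / 2 * pseries I0_coeff' (- u / 4) * (\<kappa> + ln u / 2) + u / 2 * pseries N0_coeff' (- u / 4)"

definition cut_im :: "real \<Rightarrow> real" where
  "cut_im u = pi / 2 * (u / 2 * pseries I0_coeff' (- u / 4))"

text \<open>
  In terms of the oscillating Bessel functions at \<open>y = \<surd>u\<close> this is \<open>4 / (\<pi>\<^sup>2 u (J\<^sub>1\<^sup>2 + Y\<^sub>1\<^sup>2))\<close>.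
\<close>

definition cut_density :: "real \<Rightarrow> real \<Rightarrow> real" where
  "cut_density \<kappa> u = 1 / ((cut_re \<kappa> u)\<^sup>2 + (cut_im u)\<^sup>2)"

definition macdonald_ratio :: "real \<Rightarrow> real" where
  "macdonald_ratio x = (LINT u|lborel. exp (- (x * cosh u))) / (LINT u|lborel. cosh u * exp (- (x * cosh u)))"

lemma continuous_on_pseries:
  "(\<And>n. \<bar>c n\<bar> \<le> C / fact n) \<Longrightarrow> continuous_on S (pseries c :: real \<Rightarrow> real)"
  by (rule DERIV_continuous_on[OF has_field_derivative_at_within[OF has_field_derivative_pseries]])

lemma continuous_on_cut:
  "continuous_on {0<..} (cut_re \<kappa>)" "continuous_on {0<..} cut_im"
  unfolding cut_re_def[abs_def] cut_im_def[abs_def]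
  by (intro continuous_intros continuous_on_compose2[OF continuous_on_pseries[OF coeff_bounds(1), of UNIV]]
    continuous_on_compose2[OF continuous_on_pseries[OF coeff_bounds(3), of UNIV]]
    continuous_on_compose2[OF continuous_on_pseries[OF coeff_bounds(4), of UNIV]]; simp)+

lemma continuous_on_cut_density:
  assumes "\<And>u. u > 0 \<Longrightarrow> cut_re \<kappa> u \<noteq> 0 \<or> cut_im u \<noteq> 0"
  shows "continuous_on {0<..} (cut_density \<kappa>)"
  unfolding cut_density_def[abs_def] using assms
  by (intro continuous_intros continuous_on_cut) (auto simp: sum_power2_eq_zero_iff)

text \<open>
  On the imaginary axis the series are real, and the only imaginary contributions come from
  \<open>Ln (i y) = ln y + i \<pi> / 2\<close>. The real part of the quotient has a Wronskian as its numerator, hence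
  the constant numerator of \<open>cut_density\<close>; the same identity shows that the denominator does
  not vanish.
\<close>

lemma bessel_on_cut:
  fixes y :: real
  assumes "y > 0"
  defines "z \<equiv> Complex 0 y"
  shows "\<kappa> * bessel_I0' z + bessel_N0' z = Complex (cut_re \<kappa> (y\<^sup>2)) (- cut_im (y\<^sup>2))"
    "cut_re \<kappa> (y\<^sup>2) \<noteq> 0 \<or> cut_im (y\<^sup>2) \<noteq> 0"
    "Re (- z * (\<kappa> * bessel_I0 z + bessel_N0 z) / (\<kappa> * bessel_I0' z + bessel_N0' z)) = pi / 2 * y * cut_density \<kappa> (y\<^sup>2)"
proof -
  define u where "u = y\<^sup>2"
  define U where "U = pseries I0_coeff (- u / 4)"
  define V where "V = pseries N0_coeff (- u / 4)"
  define U' where "U' = pseries I0_coeff' (- u / 4)"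
  define V' where "V' = pseries N0_coeff' (- u / 4)"
  define l where "l = ln u / 2"
  have zz: "z\<^sup>2 / 4 = of_real (- u / 4)"
    by (simp add: z_def u_def complex_eq_iff power2_eq_square)
  have ps: "pseries I0_coeff (z\<^sup>2 / 4) = of_real U" "pseries N0_coeff (z\<^sup>2 / 4) = of_real V"
    "pseries I0_coeff' (z\<^sup>2 / 4) = of_real U'" "pseries N0_coeff' (z\<^sup>2 / 4) = of_real V'"
    unfolding zz U_def V_def U'_def V'_def by (rule pseries_of_real[where C = 1], rule coeff_bounds)+
  have L: "Ln z = Complex l (pi / 2)"
  proof -
    have "z = of_real y * \<i>" by (simp add: z_def complex_eq_iff)
    then have "Ln z = of_real (ln y) + Ln \<i>"
      using assms(1) Ln_times_of_real[of y \<i>] Ln_of_real[of y] by simp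
    also have "ln y = l" using assms(1) by (simp add: l_def u_def ln_realpow)
    finally show ?thesis by (simp add: complex_eq_iff)
  qed
  have A: "bessel_I0 z = of_real U" and B: "bessel_I0' z = of_real (- u / 2 * U')"
    unfolding bessel_I0_def bessel_I0'_def ps unfolding zz by (simp_all add: complex_eq_iff)
  have N: "bessel_N0 z = Complex (l * U - V) (pi / 2 * U)"
    unfolding bessel_N0_def ps L A by (simp add: complex_eq_iff)
  have N1: "bessel_N0' z = Complex (U + l * (- u / 2 * U') + u / 2 * V') (pi / 2 * (- u / 2 * U'))"
    unfolding bessel_N0'_def ps L A B unfolding zz by (simp add: complex_eq_iff)
  have re: "cut_re \<kappa> u = U - u / 2 * U' * (\<kappa> + l) + u / 2 * V'"
    by (simp add: cut_re_def U_def U'_def V'_def l_def)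
  have im: "cut_im u = pi / 2 * (u / 2 * U')" by (simp add: cut_im_def U'_def)
  have D: "\<kappa> * bessel_I0' z + bessel_N0' z = Complex (cut_re \<kappa> u) (- cut_im u)"
    unfolding B N1 re im by (simp add: complex_eq_iff algebra_simps)
  then show "\<kappa> * bessel_I0' z + bessel_N0' z = Complex (cut_re \<kappa> (y\<^sup>2)) (- cut_im (y\<^sup>2))" by (simp add: u_def)
  have W: "U\<^sup>2 + u / 2 * (U * V' - U' * V) = 1"
    using pseries_wronskian[of "- u / 4"] unfolding U_def V_def U'_def V'_def by (simp add: algebra_simps)
  \<comment> \<open>The real part of the quotient of the numerator by the denominator, up to the factor \<open>y\<close>.\<close>
  have key: "pi / 2 * U * cut_re \<kappa> u + (\<kappa> * U + l * U - V) * cut_im u = pi / 2"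
  proof -
    have "pi / 2 * U * cut_re \<kappa> u + (\<kappa> * U + l * U - V) * cut_im u = pi / 2 * (U\<^sup>2 + u / 2 * (U * V' - U' * V))"
      unfolding re im by (simp add: power2_eq_square field_simps)
    then show ?thesis unfolding W by simp
  qed
  then show nz: "cut_re \<kappa> (y\<^sup>2) \<noteq> 0 \<or> cut_im (y\<^sup>2) \<noteq> 0" using pi_gt_zero by (auto simp: u_def)
  have num: "- z * (\<kappa> * bessel_I0 z + bessel_N0 z) = Complex (y * (pi / 2 * U)) (- y * (\<kappa> * U + l * U - V))"
    unfolding A N by (simp add: z_def complex_eq_iff algebra_simps)
  show "Re (- z * (\<kappa> * bessel_I0 z + bessel_N0 z) / (\<kappa> * bessel_I0' z + bessel_N0' z)) = pi / 2 * y * cut_density \<kappa> (y\<^sup>2)"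
  proof -
    have "Re (- z * (\<kappa> * bessel_I0 z + bessel_N0 z) / (\<kappa> * bessel_I0' z + bessel_N0' z)) =
      y * (pi / 2 * U * cut_re \<kappa> u + (\<kappa> * U + l * U - V) * cut_im u) / ((cut_re \<kappa> u)\<^sup>2 + (cut_im u)\<^sup>2)"
      unfolding D num by (simp add: Re_divide algebra_simps)
    then show ?thesis unfolding key by (simp add: cut_density_def u_def)
  qed
qed

lemma isCont_bessel:
  assumes "z \<notin> \<real>\<^sub>\<le>\<^sub>0"
  shows "isCont bessel_I0 z" "isCont bessel_I0' z" "isCont bessel_N0 z" "isCont bessel_N0' z"
  using bessel_derivs[OF assms] by (blast intro: DERIV_isCont)+

lemma set_integral_substitution:
  fixes f g :: "real \<Rightarrow> real"
  assumes S: "S \<in> sets borel" "g ` S \<in> sets borel"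
    and der: "\<And>x. x \<in> S \<Longrightarrow> (g has_field_derivative g' x) (at x within S)"
    and inj: "inj_on g S"
    and meas: "set_borel_measurable borel S (\<lambda>x. \<bar>g' x\<bar> * f (g x))" "set_borel_measurable borel (g ` S) f"
  shows "set_integrable lborel S (\<lambda>x. \<bar>g' x\<bar> * f (g x)) \<longleftrightarrow> set_integrable lborel (g ` S) f"
    "set_integrable lborel (g ` S) f \<Longrightarrow> (LINT x:S|lborel. \<bar>g' x\<bar> * f (g x)) = (LINT x:g ` S|lborel. f x)"
proof -
  have c: "set_integrable lebesgue T h \<longleftrightarrow> set_integrable lborel T h"
    if "set_borel_measurable borel T h" for T and h :: "real \<Rightarrow> real"
    using that unfolding set_integrable_def set_borel_measurable_def by (intro integrable_completion) simp
  note cov = has_absolute_integral_change_of_variables_1'[OF _ der inj, of f]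
  have SL: "S \<in> sets lebesgue" using S(1) by simp
  show iff: "set_integrable lborel S (\<lambda>x. \<bar>g' x\<bar> * f (g x)) \<longleftrightarrow> set_integrable lborel (g ` S) f"
    using cov[OF SL] c[OF meas(1)] c[OF meas(2)] by blast
  assume i: "set_integrable lborel (g ` S) f"
  have "integral S (\<lambda>x. \<bar>g' x\<bar> * f (g x)) = integral (g ` S) f"
    using cov[OF SL, of "integral (g ` S) f"] i c[OF meas(2)] by blast
  then show "(LINT x:S|lborel. \<bar>g' x\<bar> * f (g x)) = (LINT x:g ` S|lborel. f x)"
    using i iff by (simp add: set_borel_integral_eq_integral(2))
qed

text \<open>
  The Poisson formula is applied to \<open>H = K\<^sub>0 / K\<^sub>1\<close>, which is bounded by \<open>1\<close>. The boundary function
  on the negative imaginary axis is the conjugate of that on the positive one, so after taking real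
  parts the integrand is even in \<open>y\<close>, and \<open>u = y\<^sup>2\<close> gives the Stieltjes form. The bound
  \<open>|H| \<le> 1\<close> survives in the limit on the axis and bounds the density.
\<close>

lemma macdonald_ratio_stieltjes:
  obtains \<kappa> where
    "\<And>u. u > 0 \<Longrightarrow> cut_re \<kappa> u \<noteq> 0 \<or> cut_im u \<noteq> 0"
    "\<And>u. u > 0 \<Longrightarrow> cut_density \<kappa> u \<le> 2 / (pi * sqrt u)"
    "\<And>x. x > 0 \<Longrightarrow> set_integrable lborel {0<..} (\<lambda>u. cut_density \<kappa> u / (x\<^sup>2 + u))"
    "\<And>x. x > 0 \<Longrightarrow> macdonald_ratio x = x / 2 * (LINT u:{0<..}|lborel. cut_density \<kappa> u / (x\<^sup>2 + u))"
proof -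
  obtain \<alpha> \<beta> :: real where b: "\<beta> \<noteq> 0"
    and r0: "\<And>z. Re z > 0 \<Longrightarrow> cosh_moment 0 z = \<alpha> * bessel_I0 z + \<beta> * bessel_N0 z"
    and r1: "\<And>z. Re z > 0 \<Longrightarrow> - z * cosh_moment 1 z = \<alpha> * bessel_I0' z + \<beta> * bessel_N0' z"
  proof (rule macdonald_representation)
    fix \<alpha> \<beta> :: real
    assume "\<beta> \<noteq> 0"
      "\<And>z. Re z > 0 \<Longrightarrow> cosh_moment 0 z = \<alpha> * bessel_I0 z + \<beta> * bessel_N0 z"
      "\<And>z. Re z > 0 \<Longrightarrow> - z * cosh_moment 1 z = \<alpha> * bessel_I0' z + \<beta> * bessel_N0' z"
    then show thesis by (rule that)
  qed
  define \<kappa> where "\<kappa> = \<alpha> / \<beta>"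
  define H where "H z = cosh_moment 0 z / cosh_moment 1 z" for z
  define E where "E z = - z * (\<kappa> * bessel_I0 z + bessel_N0 z) / (\<kappa> * bessel_I0' z + bessel_N0' z)" for z
  have HE: "H z = E z" if "Re z > 0" for z
  proof -
    have z: "z \<noteq> 0" using that by auto
    have "H z = - z * cosh_moment 0 z / (- z * cosh_moment 1 z)" using z by (simp add: H_def)
    also have "\<dots> = - z * (of_real \<beta> * (\<kappa> * bessel_I0 z + bessel_N0 z)) / (of_real \<beta> * (\<kappa> * bessel_I0' z + bessel_N0' z))"
      unfolding r1[OF that] r0[OF that] using b by (simp add: \<kappa>_def distrib_left)
    also have "\<dots> = E z" using b by (simp add: E_def)
    finally show ?thesis .
  qed
  note nz = bessel_on_cut(2)[where \<kappa> = \<kappa>]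
  have contE: "isCont E (Complex 0 y)" if "y > 0" for y
  proof -
    have y: "Complex 0 y \<notin> \<real>\<^sub>\<le>\<^sub>0" using that by (simp add: complex_nonpos_Reals_iff)
    have "\<kappa> * bessel_I0' (Complex 0 y) + bessel_N0' (Complex 0 y) \<noteq> 0"
      using nz[OF that] unfolding bessel_on_cut(1)[OF that] by (auto simp: complex_eq_iff)
    then show ?thesis unfolding E_def[abs_def]
      by (intro continuous_intros isCont_bessel[OF y])
  qed
  have ReE: "Re (E (Complex 0 y)) = pi / 2 * y * cut_density \<kappa> (y\<^sup>2)" if "y > 0" for y
    unfolding E_def by (rule bessel_on_cut(3)[OF that])
  have Hcnj: "H (cnj z) = cnj (H z)" for z by (simp add: H_def cosh_moment_cnj)
  have seq: "(\<lambda>n. Complex (1 / real (Suc n)) y) \<longlonglongrightarrow> Complex 0 y" for y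
    using LIMSEQ_Suc[OF lim_inverse_n'] by (intro tendsto_Complex tendsto_const) (simp add: inverse_eq_divide)
  have limpos: "(\<lambda>n. H (Complex (1 / real (Suc n)) y)) \<longlonglongrightarrow> E (Complex 0 y)" if "y > 0" for y
    using isCont_tendsto_compose[OF contE[OF that] seq[of y]] by (subst HE) auto
  \<comment> \<open>The value at \<open>0\<close>, where \<open>E\<close> has a logarithmic singularity, is arbitrary: a single point is a null
    set.\<close>
  define \<psi> where "\<psi> y = (if y > 0 then E (Complex 0 y) else if y < 0 then cnj (E (Complex 0 (- y))) else 0)" for y
  have lim: "(\<lambda>n. H (Complex (1 / real (Suc n)) y)) \<longlonglongrightarrow> \<psi> y" if "y \<noteq> 0" for y
  proof (cases "y > 0")
    case True then show ?thesis using limpos by (simp add: \<psi>_def)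
  next
    case False
    then have y: "- y > 0" using that by simp
    have "(\<lambda>n. cnj (H (Complex (1 / real (Suc n)) (- y)))) \<longlonglongrightarrow> cnj (E (Complex 0 (- y)))"
      by (intro tendsto_cnj limpos y)
    moreover have "cnj (Complex a (- y)) = Complex a y" for a by (simp add: complex_eq_iff)
    ultimately show ?thesis using y by (simp add: \<psi>_def Hcnj[symmetric])
  qed
  have Hle: "norm (H z) \<le> 1" if "Re z > 0" for z
    using norm_cosh_moment_0_le_1[OF that] by (simp add: H_def norm_divide divide_simps)
  have Hhol: "H holomorphic_on {z. Re z > 0}"
    unfolding H_def[abs_def] using has_field_derivative_cosh_moment norm_cosh_moment_0_le_1(2)
    by (intro holomorphic_on_divide) (auto simp: holomorphic_on_open open_halfspace_Re_gt)
  have psiRe: "Re (\<psi> y) = pi / 2 * \<bar>y\<bar> * cut_density \<kappa> (y\<^sup>2)" for y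
    using ReE[of y] ReE[of "- y"] by (auto simp: \<psi>_def)
  have bound: "cut_density \<kappa> u \<le> 2 / (pi * sqrt u)" if u: "u > 0" for u
  proof -
    have "norm (E (Complex 0 (sqrt u))) \<le> 1"
      using limpos[of "sqrt u"] u Hle by (intro tendsto_upperbound[OF tendsto_norm[OF limpos[of "sqrt u"]]]) auto
    then have "pi / 2 * sqrt u * cut_density \<kappa> u \<le> 1"
      using ReE[of "sqrt u"] u complex_Re_le_cmod[of "E (Complex 0 (sqrt u))"] by simp
    then show ?thesis using u by (simp add: field_simps)
  qed
  have meas_psi: "\<psi> \<in> borel_measurable borel"
  proof -
    have mE: "continuous_on {0<..} (\<lambda>y. E (Complex 0 y))"
    proof (intro continuous_at_imp_continuous_on ballI)
      fix y :: real assume "y \<in> {0<..}"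
      then have "isCont E (Complex 0 y)" by (intro contE) simp
      moreover have "isCont (Complex 0) y" unfolding Complex_eq by (intro continuous_intros)
      ultimately show "isCont (\<lambda>y. E (Complex 0 y)) y" by (rule isCont_o2[rotated])
    qed
    define F where "F y = indicator {0<..} y *\<^sub>R E (Complex 0 y)" for y
    have F [measurable]: "F \<in> borel_measurable borel"
      unfolding F_def[abs_def] by (rule borel_measurable_continuous_on_indicator[OF _ mE]) simp
    have cnj [measurable]: "cnj \<in> borel_measurable borel"
      by (intro borel_measurable_continuous_onI continuous_intros)
    have "\<psi> = (\<lambda>y. F y + cnj (F (- y)))"
      by (auto simp: \<psi>_def F_def fun_eq_iff)
    also have "\<dots> \<in> borel_measurable borel" by measurable
    finally show ?thesis .
  qed
  have contG: "continuous_on {0<..} (cut_density \<kappa>)"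
  proof -
    have "cut_re \<kappa> u \<noteq> 0 \<or> cut_im u \<noteq> 0" if "u > 0" for u
      using nz[of "sqrt u"] that by simp
    then show ?thesis by (rule continuous_on_cut_density)
  qed
  have G0: "cut_density \<kappa> u \<ge> 0" for u by (simp add: cut_density_def)
  have main: "set_integrable lborel {0<..} (\<lambda>u. cut_density \<kappa> u / (x\<^sup>2 + u)) \<and>
      macdonald_ratio x = x / 2 * (LINT u:{0<..}|lborel. cut_density \<kappa> u / (x\<^sup>2 + u))" if x: "x > 0" for x
  proof -
    let ?f = "\<lambda>u. cut_density \<kappa> u / (x\<^sup>2 + u)"
    let ?h = "\<lambda>y. \<bar>2 * y\<bar> * ?f (y\<^sup>2)"
    have img: "(\<lambda>y::real. y\<^sup>2) ` {0<..} = {0<..}"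
    proof (intro equalityI subsetI)
      fix u :: real assume "u \<in> {0<..}"
      then show "u \<in> (\<lambda>y. y\<^sup>2) ` {0<..}" by (intro image_eqI[of _ _ "sqrt u"]) auto
    qed auto
    have cf: "continuous_on {0<..} ?f" using x
      by (intro continuous_intros contG) (auto simp: add_nonneg_eq_0_iff)
    have ch: "continuous_on {0<..} ?h"
      by (intro continuous_intros continuous_on_compose2[OF cf]) auto
    have mf: "set_borel_measurable borel {0<..} ?f" "set_borel_measurable borel {0<..} ?h"
      unfolding set_borel_measurable_def
      using borel_measurable_continuous_on_indicator[OF _ cf] borel_measurable_continuous_on_indicator[OF _ ch] by simp_all
    note sub = set_integral_substitution[of "{0<..}" "\<lambda>y. y\<^sup>2" "\<lambda>y. 2 * y" ?f, unfolded img]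
    have prem: "(g has_real_derivative 2 * y) (at y within {0<..})" if "g = (\<lambda>y. y\<^sup>2)" for g :: "real \<Rightarrow> real" and y
      unfolding that by (auto intro!: derivative_eq_intros)
    have inj: "inj_on (\<lambda>y::real. y\<^sup>2) {0<..}" by (auto simp: inj_on_def power2_eq_iff)
    note sub' = sub[OF _ _ prem[OF refl] inj mf(2) mf(1)]
    have hbound: "?h y \<le> 4 / pi * (1 / (x\<^sup>2 + y\<^sup>2))" if "y > 0" for y
    proof -
      have "\<bar>2 * y\<bar> * cut_density \<kappa> (y\<^sup>2) \<le> 4 / pi"
        using bound[of "y\<^sup>2"] that by (simp add: field_simps)
      from divide_right_mono[OF this, of "x\<^sup>2 + y\<^sup>2"] show ?thesis by simp
    qed
    have ih: "set_integrable lborel {0<..} ?h"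
      unfolding set_integrable_def
    proof (rule Bochner_Integration.integrable_bound)
      show "integrable lborel (\<lambda>y. 4 / pi * (1 / (x\<^sup>2 + y\<^sup>2)))"
        by (intro integrable_mult_right integrable_poisson_kernel x)
      show "AE y in lborel. norm (indicator {0<..} y *\<^sub>R ?h y) \<le> norm (4 / pi * (1 / (x\<^sup>2 + y\<^sup>2)))"
      proof (rule AE_I2)
        fix y :: real
        have "?h y \<ge> 0" using G0 by (intro mult_nonneg_nonneg divide_nonneg_nonneg) auto
        then show "norm (indicator {0<..} y *\<^sub>R ?h y) \<le> norm (4 / pi * (1 / (x\<^sup>2 + y\<^sup>2)))"
          using hbound[of y] by (auto simp: indicator_def)
      qed
    qed (use mf(2) in \<open>simp add: set_borel_measurable_def\<close>)
    have if': "set_integrable lborel {0<..} ?f" using sub'(1) ih by simp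
    have eq: "(LINT y:{0<..}|lborel. ?h y) = (LINT u:{0<..}|lborel. ?f u)" using sub'(2) if' by simp
    have even: "has_bochner_integral lborel ?h (2 *\<^sub>R (LINT y:{0<..}|lborel. ?h y))"
    proof (rule has_bochner_integral_even_function)
      have "(\<lambda>y. indicator {0..} y *\<^sub>R ?h y) = (\<lambda>y. indicator {0<..} y *\<^sub>R ?h y)"
        by (auto simp: fun_eq_iff indicator_def)
      then show "has_bochner_integral lborel (\<lambda>y. indicator {0..} y *\<^sub>R ?h y) (LINT y:{0<..}|lborel. ?h y)"
        using ih unfolding set_integrable_def set_lebesgue_integral_def by (simp only: has_bochner_integral_integrable)
    qed simp
    have Hx: "H (of_real x) = of_real (x / pi) * (LINT y|lborel. \<psi> y / of_real (x\<^sup>2 + y\<^sup>2))"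
    proof (rule half_plane_poisson[OF Hhol Hle x _ meas_psi])
      show "AE y in lborel. (\<lambda>n. H (Complex (1 / real (Suc n)) y)) \<longlonglongrightarrow> \<psi> y"
        using AE_lborel_singleton[of 0] lim by (auto elim: eventually_mono)
    qed
    have ipsi: "integrable lborel (\<lambda>y. \<psi> y / of_real (x\<^sup>2 + y\<^sup>2))"
    proof (rule Bochner_Integration.integrable_bound)
      show "integrable lborel (\<lambda>y. 1 / (x\<^sup>2 + y\<^sup>2))" by (rule integrable_poisson_kernel[OF x])
      have "norm (\<psi> y) \<le> 1" for y
      proof (cases "y = 0")
        case False
        show ?thesis
          by (rule tendsto_upperbound[OF tendsto_norm[OF lim[OF False]]]) (auto intro!: always_eventually Hle)
      qed (simp add: \<psi>_def)
      then show "AE y in lborel. norm (\<psi> y / of_real (x\<^sup>2 + y\<^sup>2)) \<le> norm (1 / (x\<^sup>2 + y\<^sup>2))"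
        by (intro AE_I2) (auto simp: norm_divide divide_right_mono simp del: of_real_add of_real_power)
    qed (use meas_psi in measurable)
    have ratio: "H (of_real x) = of_real (macdonald_ratio x)"
      by (simp add: H_def cosh_moment_of_real macdonald_ratio_def)
    have "macdonald_ratio x = Re (H (of_real x))" by (simp add: ratio)
    also have "\<dots> = x / pi * Re (LINT y|lborel. \<psi> y / of_real (x\<^sup>2 + y\<^sup>2))"
      unfolding Hx by (simp only: times_complex.sel Re_complex_of_real Im_complex_of_real mult_zero_left diff_zero)
    also have "Re (LINT y|lborel. \<psi> y / of_real (x\<^sup>2 + y\<^sup>2)) = (LINT y|lborel. Re (\<psi> y / of_real (x\<^sup>2 + y\<^sup>2)))"
      using integral_Re[OF ipsi] by simp
    also have "(\<lambda>y. Re (\<psi> y / of_real (x\<^sup>2 + y\<^sup>2))) = (\<lambda>y. pi / 4 * ?h y)"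
    proof
      fix y
      have "Re (\<psi> y / of_real (x\<^sup>2 + y\<^sup>2)) = Re (\<psi> y) / (x\<^sup>2 + y\<^sup>2)" by (rule Re_divide_of_real)
      then show "Re (\<psi> y / of_real (x\<^sup>2 + y\<^sup>2)) = pi / 4 * ?h y" by (simp add: psiRe abs_mult)
    qed
    also have "(LINT y|lborel. pi / 4 * ?h y) = pi / 4 * (2 * (LINT y:{0<..}|lborel. ?h y))"
      by (simp only: integral_mult_right_zero has_bochner_integral_integral_eq[OF even] real_scaleR_def)
    finally show ?thesis using if' eq by simp
  qed
  show ?thesis
  proof (rule that[of \<kappa>])
    show "cut_re \<kappa> u \<noteq> 0 \<or> cut_im u \<noteq> 0" if "u > 0" for u using nz[of "sqrt u"] that by simp
  qed (use bound main in auto)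
qed

section \<open>Asymptotic expansions with logarithms\<close>

text \<open>
  The power of \<open>ln t\<close> in front of \<open>t\<^sup>-\<^sup>n\<close> is at most \<open>n\<close>, so that all terms beyond the order \<open>N\<close>
  are absorbed in \<open>(ln t / t)\<^sup>N\<^sup>+\<^sup>1\<close>.
\<close>

definition tail_expansion :: "nat \<Rightarrow> (real \<Rightarrow> real) \<Rightarrow> bool" where
  "tail_expansion N F \<longleftrightarrow> (\<exists>C s. (\<lambda>t. F t - (C + (\<Sum>n=1..N. (\<Sum>k=0..n. s n k * ln t ^ k) / t ^ n)))
     \<in> O[at_top](\<lambda>t. (ln t / t) ^ Suc N))"

lemma tail_expansion_add:
  assumes "tail_expansion N F" "tail_expansion N G"
  shows "tail_expansion N (\<lambda>t. F t + G t)"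
proof -
  from assms obtain C s D r where
    1: "(\<lambda>t. F t - (C + (\<Sum>n=1..N. (\<Sum>k=0..n. s n k * ln t ^ k) / t ^ n))) \<in> O[at_top](\<lambda>t. (ln t / t) ^ Suc N)" and
    2: "(\<lambda>t. G t - (D + (\<Sum>n=1..N. (\<Sum>k=0..n. r n k * ln t ^ k) / t ^ n))) \<in> O[at_top](\<lambda>t. (ln t / t) ^ Suc N)"
    unfolding tail_expansion_def by blast
  have "(\<lambda>t. F t + G t - ((C + D) + (\<Sum>n=1..N. (\<Sum>k=0..n. (s n k + r n k) * ln t ^ k) / t ^ n))) =
     (\<lambda>t. (F t - (C + (\<Sum>n=1..N. (\<Sum>k=0..n. s n k * ln t ^ k) / t ^ n))) + (G t - (D + (\<Sum>n=1..N. (\<Sum>k=0..n. r n k * ln t ^ k) / t ^ n))))"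
    by (simp add: fun_eq_iff algebra_simps sum.distrib add_divide_distrib)
  then show ?thesis unfolding tail_expansion_def using sum_in_bigo(1)[OF 1 2]
    by (intro exI[of _ "C + D"] exI[of _ "\<lambda>n k. s n k + r n k"]) simp
qed

lemma tail_expansion_cmult:
  assumes "tail_expansion N F"
  shows "tail_expansion N (\<lambda>t. c * F t)"
proof -
  from assms obtain C s where
    1: "(\<lambda>t. F t - (C + (\<Sum>n=1..N. (\<Sum>k=0..n. s n k * ln t ^ k) / t ^ n))) \<in> O[at_top](\<lambda>t. (ln t / t) ^ Suc N)"
    unfolding tail_expansion_def by blast
  have "(\<lambda>t. c * F t - (c * C + (\<Sum>n=1..N. (\<Sum>k=0..n. (c * s n k) * ln t ^ k) / t ^ n))) =
     (\<lambda>t. c * (F t - (C + (\<Sum>n=1..N. (\<Sum>k=0..n. s n k * ln t ^ k) / t ^ n))))"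
    by (simp add: fun_eq_iff algebra_simps sum_distrib_left)
  moreover have "(\<lambda>t. c * (F t - (C + (\<Sum>n=1..N. (\<Sum>k=0..n. s n k * ln t ^ k) / t ^ n)))) \<in> O[at_top](\<lambda>t. (ln t / t) ^ Suc N)"
    using 1 by (cases "c = 0") auto
  ultimately show ?thesis unfolding tail_expansion_def
    by (intro exI[of _ "c * C"] exI[of _ "\<lambda>n k. c * s n k"]) simp
qed

lemma tail_expansion_const: "tail_expansion N (\<lambda>_. C)"
  unfolding tail_expansion_def by (intro exI[of _ C] exI[of _ "\<lambda>_ _. 0"]) simp

lemma tail_expansion_bigo:
  "F \<in> O[at_top](\<lambda>t. (ln t / t) ^ Suc N) \<Longrightarrow> tail_expansion N F"
  unfolding tail_expansion_def by (intro exI[of _ 0] exI[of _ "\<lambda>_ _. 0"]) simp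

lemma tail_expansion_sum:
  "finite A \<Longrightarrow> (\<And>i. i \<in> A \<Longrightarrow> tail_expansion N (F i)) \<Longrightarrow> tail_expansion N (\<lambda>t. \<Sum>i\<in>A. F i t)"
  by (induction A rule: finite_induct) (auto intro: tail_expansion_add tail_expansion_const)

lemma tail_expansion_eventually:
  assumes "tail_expansion N F" "\<forall>\<^sub>F t in at_top. F t = G t"
  shows "tail_expansion N G"
proof -
  from assms(1) obtain C s where
    1: "(\<lambda>t. F t - (C + (\<Sum>n=1..N. (\<Sum>k=0..n. s n k * ln t ^ k) / t ^ n))) \<in> O[at_top](\<lambda>t. (ln t / t) ^ Suc N)"
    unfolding tail_expansion_def by blast
  have "(\<lambda>t. G t - (C + (\<Sum>n=1..N. (\<Sum>k=0..n. s n k * ln t ^ k) / t ^ n))) \<in> O[at_top](\<lambda>t. (ln t / t) ^ Suc N)"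
    by (rule landau_o.big.in_cong[THEN iffD1, OF _ 1]) (use assms(2) in \<open>auto elim: eventually_mono\<close>)
  then show ?thesis unfolding tail_expansion_def by blast
qed

lemma ln_over_t_bigo_1: "(\<lambda>t::real. ln t / t) \<in> O[at_top](\<lambda>_. 1)"
  by real_asymp

lemma log_monomial_bigo:
  assumes "k \<le> n"
  shows "(\<lambda>t. c * ln t ^ k / t ^ n) \<in> O[at_top](\<lambda>t::real. (ln t / t) ^ n)"
proof -
  have "(\<lambda>t. ln t ^ k) \<in> O[at_top](\<lambda>t::real. ln t ^ n)"
  proof (rule landau_o.big_mono)
    show "\<forall>\<^sub>F t::real in at_top. norm (ln t ^ k) \<le> norm (ln t ^ n)"
      using eventually_ge_at_top[of "exp 1"]
    proof eventually_elim
      case (elim t)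
      then have "1 \<le> ln t" by (metis exp_gt_zero less_le_trans ln_exp ln_le_cancel_iff)
      then show ?case using assms by (simp add: power_increasing)
    qed
  qed
  then have "(\<lambda>t. c * (ln t ^ k * inverse (t ^ n))) \<in> O[at_top](\<lambda>t::real. 1 * (ln t ^ n * inverse (t ^ n)))"
    by (intro landau_o.big.mult) (auto intro: landau_o.big_refl)
  then show ?thesis
    by (simp add: divide_inverse mult.assoc power_mult_distrib power_inverse)
qed

lemma tail_expansion_monomial:
  assumes "1 \<le> n" "k \<le> n"
  shows "tail_expansion N (\<lambda>t. c * ln t ^ k / t ^ n)"
proof (cases "n \<le> N")
  case True
  have "(\<Sum>m=1..N. (\<Sum>j=0..m. (if m = n \<and> j = k then c else 0) * ln t ^ j) / t ^ m) = c * ln t ^ k / t ^ n" for t :: real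
  proof -
    have "(\<Sum>j=0..m. (if m = n \<and> j = k then c else 0) * ln t ^ j) / t ^ m = (if m = n then c * ln t ^ k / t ^ n else 0)" for m
    proof (cases "m = n")
      case True
      then have "(\<Sum>j=0..m. (if m = n \<and> j = k then c else 0) * ln t ^ j) = (\<Sum>j=0..n. if j = k then c * ln t ^ k else 0)"
        by (intro sum.cong) auto
      then show ?thesis using True assms by (simp add: sum.delta)
    qed simp
    then show ?thesis using True assms by (simp add: sum.delta)
  qed
  then show ?thesis unfolding tail_expansion_def
    by (intro exI[of _ 0] exI[of _ "\<lambda>m j. if m = n \<and> j = k then c else 0"]) simp
next
  case False
  have "(\<lambda>t. c * ln t ^ k / t ^ n) \<in> O[at_top](\<lambda>t::real. (ln t / t) ^ n)"
    by (rule log_monomial_bigo[OF assms(2)])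
  also have "(\<lambda>t::real. (ln t / t) ^ n) = (\<lambda>t. (ln t / t) ^ Suc N * (ln t / t) ^ (n - Suc N))"
    using False by (simp add: power_add[symmetric] del: power_Suc)
  also have "(\<lambda>t::real. (ln t / t) ^ Suc N * (ln t / t) ^ (n - Suc N)) \<in> O[at_top](\<lambda>t. (ln t / t) ^ Suc N * 1 ^ (n - Suc N))"
    by (intro landau_o.big.mult landau_o.big_refl landau_o.big_power ln_over_t_bigo_1)
  finally show ?thesis by (intro tail_expansion_bigo) simp
qed

text \<open>
  Every logarithm is accompanied by a factor \<open>v\<close>. This grading by \<open>i + j\<close> is preserved by products,
  and under a Laplace transform it becomes the bound of the power of \<open>ln t\<close> by the power of \<open>1 / t\<close>.
\<close>

inductive logpoly :: "(real \<Rightarrow> real) \<Rightarrow> bool" where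
  monomial: "i + j \<ge> 1 \<Longrightarrow> logpoly (\<lambda>v. c * (v ^ i * (v * ln v) ^ j))"
| add: "logpoly f \<Longrightarrow> logpoly g \<Longrightarrow> logpoly (\<lambda>v. f v + g v)"

text \<open>
  Functions that vanish at \<open>0+\<close> and agree with such a polynomial up to the order \<open>N\<close> in \<open>v ln v\<close>. They
  form an algebra without unit, to which \<open>x \<mapsto> 1 / (1 + x) - 1\<close> can be applied
  (\<open>log_expandable_reciprocal\<close>).
\<close>

definition log_expandable :: "nat \<Rightarrow> (real \<Rightarrow> real) \<Rightarrow> bool" where
  "log_expandable N f \<longleftrightarrow> (\<exists>P. logpoly P \<and> (\<lambda>v. f v - P v) \<in> O[at_right 0](\<lambda>v. (v * ln v) ^ Suc N))"

lemma vlnv_bigo: "(\<lambda>v. v * ln v) \<in> O[at_right 0](\<lambda>_. 1::real)" "(\<lambda>v. v) \<in> O[at_right 0](\<lambda>v::real. v * ln v)"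
  "(\<lambda>v. v) \<in> O[at_right 0](\<lambda>_. 1::real)"
  by real_asymp+

lemma logpoly_mult:
  assumes "logpoly f" "logpoly g"
  shows "logpoly (\<lambda>v. f v * g v)"
  using assms
proof (induction rule: logpoly.induct)
  case (monomial i j c)
  from \<open>logpoly g\<close> show ?case
  proof (induction rule: logpoly.induct)
    case (monomial i' j' c')
    have "logpoly (\<lambda>v. c * c' * (v ^ (i + i') * (v * ln v) ^ (j + j')))"
      by (rule logpoly.monomial) (use monomial in auto)
    then show ?case by (simp add: power_add mult_ac)
  next
    case (add f g)
    then show ?case using logpoly.add[OF add(3,4)] by (simp add: distrib_left)
  qed
next
  case (add f g)
  then show ?case using logpoly.add[OF add(3,4)] by (simp add: distrib_right)
qed

lemma logpoly_bigo: "logpoly f \<Longrightarrow> f \<in> O[at_right 0](\<lambda>v. v * ln v)"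
proof (induction rule: logpoly.induct)
  case (monomial i j c)
  then obtain m where m: "i + j = Suc m" by (cases "i + j") auto
  have "(\<lambda>v. c * (v ^ i * (v * ln v) ^ j)) \<in> O[at_right 0](\<lambda>v::real. 1 * ((v * ln v) ^ i * (v * ln v) ^ j))"
    by (intro landau_o.big.mult landau_o.big_power landau_o.big_refl vlnv_bigo) auto
  also have "(\<lambda>v::real. 1 * ((v * ln v) ^ i * (v * ln v) ^ j)) = (\<lambda>v. (v * ln v) * (v * ln v) ^ m)"
    by (simp only: mult_1 power_add[symmetric] m power_Suc)
  also have "(\<lambda>v::real. (v * ln v) * (v * ln v) ^ m) \<in> O[at_right 0](\<lambda>v. (v * ln v) * 1 ^ m)"
    by (intro landau_o.big.mult landau_o.big_power landau_o.big_refl vlnv_bigo)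
  finally show ?case by simp
qed (rule sum_in_bigo)

lemma log_expandable_logpoly: "logpoly f \<Longrightarrow> log_expandable N f"
  unfolding log_expandable_def by (intro exI[of _ f]) simp

lemma log_expandable_bigo: "log_expandable N f \<Longrightarrow> f \<in> O[at_right 0](\<lambda>v. v * ln v)"
proof -
  assume "log_expandable N f"
  then obtain P where P: "logpoly P" "(\<lambda>v. f v - P v) \<in> O[at_right 0](\<lambda>v. (v * ln v) ^ Suc N)"
    unfolding log_expandable_def by blast
  have "(\<lambda>v. (v * ln v) * (v * ln v) ^ N) \<in> O[at_right 0](\<lambda>v::real. (v * ln v) * 1 ^ N)"
    by (intro landau_o.big.mult landau_o.big_power landau_o.big_refl vlnv_bigo)
  then have "(\<lambda>v. f v - P v) \<in> O[at_right 0](\<lambda>v. v * ln v)"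
    using landau_o.big_trans[OF P(2)] by simp
  from sum_in_bigo(1)[OF this logpoly_bigo[OF P(1)]] show ?thesis by simp
qed

lemma bigo_vlnv_imp_bigo_1: "f \<in> O[at_right 0](\<lambda>v. v * ln v) \<Longrightarrow> f \<in> O[at_right 0](\<lambda>_. 1::real)"
  using landau_o.big_trans vlnv_bigo(1) by blast

lemma log_expandable_add: "log_expandable N f \<Longrightarrow> log_expandable N g \<Longrightarrow> log_expandable N (\<lambda>v. f v + g v)"
proof -
  assume "log_expandable N f" "log_expandable N g"
  then obtain P Q where P: "logpoly P" "(\<lambda>v. f v - P v) \<in> O[at_right 0](\<lambda>v. (v * ln v) ^ Suc N)"
     and Q: "logpoly Q" "(\<lambda>v. g v - Q v) \<in> O[at_right 0](\<lambda>v. (v * ln v) ^ Suc N)"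
    unfolding log_expandable_def by blast
  from sum_in_bigo(1)[OF P(2) Q(2)] show ?thesis
    unfolding log_expandable_def using logpoly.add[OF P(1) Q(1)] by (intro exI[of _ "\<lambda>v. P v + Q v"]) (simp add: algebra_simps)
qed

lemma log_expandable_mult: "log_expandable N f \<Longrightarrow> log_expandable N g \<Longrightarrow> log_expandable N (\<lambda>v. f v * g v)"
proof -
  assume f: "log_expandable N f" and g: "log_expandable N g"
  then obtain P Q where P: "logpoly P" "(\<lambda>v. f v - P v) \<in> O[at_right 0](\<lambda>v. (v * ln v) ^ Suc N)"
     and Q: "logpoly Q" "(\<lambda>v. g v - Q v) \<in> O[at_right 0](\<lambda>v. (v * ln v) ^ Suc N)"
    unfolding log_expandable_def by blast
  have "(\<lambda>v. (f v - P v) * g v + P v * (g v - Q v)) \<in> O[at_right 0](\<lambda>v. (v * ln v) ^ Suc N)"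
    using landau_o.big.mult[OF P(2) bigo_vlnv_imp_bigo_1[OF log_expandable_bigo[OF g]]]
      landau_o.big.mult[OF bigo_vlnv_imp_bigo_1[OF logpoly_bigo[OF P(1)]] Q(2)]
    by (intro sum_in_bigo) simp_all
  then show ?thesis
    unfolding log_expandable_def using logpoly_mult[OF P(1) Q(1)] by (intro exI[of _ "\<lambda>v. P v * Q v"]) (simp add: algebra_simps)
qed

lemma log_expandable_cmult: "log_expandable N f \<Longrightarrow> log_expandable N (\<lambda>v. c * f v)"
proof -
  have lp: "logpoly P \<Longrightarrow> logpoly (\<lambda>v. c * P v)" for P
  proof (induction rule: logpoly.induct)
    case (monomial i j c')
    then show ?case using logpoly.monomial[of i j "c * c'"] by (simp add: mult.assoc)
  qed (use logpoly.add in \<open>simp add: distrib_left\<close>)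
  assume "log_expandable N f"
  then obtain P where P: "logpoly P" "(\<lambda>v. f v - P v) \<in> O[at_right 0](\<lambda>v. (v * ln v) ^ Suc N)"
    unfolding log_expandable_def by blast
  have "(\<lambda>v. c * (f v - P v)) \<in> O[at_right 0](\<lambda>v. (v * ln v) ^ Suc N)"
    using P(2) by (cases "c = 0") auto
  then show ?thesis unfolding log_expandable_def using lp[OF P(1)]
    by (intro exI[of _ "\<lambda>v. c * P v"]) (simp add: algebra_simps)
qed

lemma log_expandable_id: "log_expandable N (\<lambda>v. v)" and log_expandable_vlnv: "log_expandable N (\<lambda>v. v * ln v)"
  using logpoly.monomial[of 1 0 1] logpoly.monomial[of 0 1 1] by (auto intro: log_expandable_logpoly)

lemma log_expandable_power: "log_expandable N f \<Longrightarrow> k \<ge> 1 \<Longrightarrow> log_expandable N (\<lambda>v. f v ^ k)"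
proof (induction k)
  case (Suc k)
  then show ?case by (cases "k = 0") (auto intro: log_expandable_mult)
qed simp

lemma log_expandable_zero_bigo: "f \<in> O[at_right 0](\<lambda>v. (v * ln v) ^ Suc N) \<Longrightarrow> log_expandable N f"
  unfolding log_expandable_def using logpoly.monomial[of 1 0 0] by (intro exI[of _ "\<lambda>_. 0"]) simp

lemma log_expandable_sum:
  "finite A \<Longrightarrow> (\<And>i. i \<in> A \<Longrightarrow> log_expandable N (f i)) \<Longrightarrow> log_expandable N (\<lambda>v. \<Sum>i\<in>A. f i v)"
  by (induction A rule: finite_induct) (auto intro: log_expandable_add log_expandable_zero_bigo)

lemma log_expandable_bigo_add: "log_expandable N f \<Longrightarrow> g \<in> O[at_right 0](\<lambda>v. (v * ln v) ^ Suc N) \<Longrightarrow> log_expandable N (\<lambda>v. f v + g v)"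
  by (rule log_expandable_add[OF _ log_expandable_zero_bigo])

lemma log_expandable_eventually:
  assumes "log_expandable N f" "\<forall>\<^sub>F v in at_right 0. f v = g v"
  shows "log_expandable N g"
proof -
  from assms obtain P where P: "logpoly P" "(\<lambda>v. f v - P v) \<in> O[at_right 0](\<lambda>v. (v * ln v) ^ Suc N)"
    unfolding log_expandable_def by blast
  have "(\<lambda>v. g v - P v) \<in> O[at_right 0](\<lambda>v. (v * ln v) ^ Suc N)"
    by (rule landau_o.big.in_cong[THEN iffD1, OF _ P(2)]) (use assms(2) in \<open>auto elim: eventually_mono\<close>)
  with P(1) show ?thesis unfolding log_expandable_def by blast
qed

text \<open>
  The geometric series, cut off after the power \<open>N\<close>; its remainder carries the factor \<open>X\<^sup>N\<^sup>+\<^sup>1\<close> and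
  \<open>X = O(v ln v)\<close>.
\<close>

lemma log_expandable_reciprocal:
  assumes "log_expandable N X"
  shows "log_expandable N (\<lambda>v. 1 / (1 + X v) - 1)"
proof -
  have X: "X \<in> O[at_right 0](\<lambda>v. v * ln v)" by (rule log_expandable_bigo[OF assms])
  have "(\<lambda>v::real. v * ln v) \<in> o[at_right 0](\<lambda>_. 1)" by real_asymp
  from landau_o.big_small_trans[OF X this]
  have X0: "(X \<longlongrightarrow> 0) (at_right 0)" by (rule smalloD_tendsto[of X _ "\<lambda>_. 1", simplified])
  have ev: "\<forall>\<^sub>F v in at_right 0. \<bar>X v\<bar> < 1 / 2"
    using order_tendstoD(2)[OF tendsto_rabs_zero[OF X0], of "1/2"] by simp
  have b1: "(\<lambda>v. 1 / (1 + X v)) \<in> O[at_right 0](\<lambda>_. 1)"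
  proof (rule bigoI[of _ 2])
    show "\<forall>\<^sub>F v in at_right 0. norm (1 / (1 + X v)) \<le> 2 * norm (1::real)"
      using ev by eventually_elim (auto simp: divide_simps abs_if split: if_splits)
  qed
  have b: "(\<lambda>v. (- X v) ^ Suc N * (1 / (1 + X v))) \<in> O[at_right 0](\<lambda>v. (v * ln v) ^ Suc N * 1)"
    using X by (intro landau_o.big.mult landau_o.big_power b1) simp
  have "log_expandable N (\<lambda>v. (\<Sum>k\<in>{1..N}. (- 1) ^ k * X v ^ k) + (- X v) ^ Suc N * (1 / (1 + X v)))"
    by (rule log_expandable_bigo_add[OF log_expandable_sum]) (use b in \<open>auto intro!: log_expandable_cmult log_expandable_power assms simp del: power_Suc\<close>)
  then show ?thesis
  proof (rule log_expandable_eventually)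
    show "\<forall>\<^sub>F v in at_right 0. (\<Sum>k\<in>{1..N}. (- 1) ^ k * X v ^ k) + (- X v) ^ Suc N * (1 / (1 + X v)) = 1 / (1 + X v) - 1"
      using ev
    proof eventually_elim
      case (elim v)
      let ?x = "- X v"
      have "(\<Sum>k\<in>{1..N}. (- 1) ^ k * X v ^ k) = (\<Sum>k\<in>{1..N}. ?x ^ k)"
        by (intro sum.cong) (auto simp: power_mult_distrib[symmetric])
      also have "\<dots> = (\<Sum>k<Suc N. ?x ^ k) - 1"
        by (simp add: lessThan_Suc_atMost atMost_atLeast0 sum.atLeast_Suc_atMost[of 0 N])
      also have "(\<Sum>k<Suc N. ?x ^ k) = (1 - ?x ^ Suc N) / (1 - ?x)"
        using elim by (subst geometric_sum) (auto simp: field_simps)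
      finally show ?case using elim by (auto simp: field_simps abs_if split: if_splits)
    qed
  qed
qed

section \<open>Watson's lemma with logarithms\<close>

text \<open>
  The two half powers reduce the integrability of \<open>exp (- s) s\<^sup>n\<^sup>-\<^sup>1 (ln s)\<^sup>k\<close> to that of Gamma
  integrals, at \<open>0\<close> as well as at infinity.
\<close>

lemma abs_ln_power_bound:
  assumes "s > (0::real)"
  shows "\<bar>ln s\<bar> ^ k \<le> 2 ^ k * fact k * (s powr (1/2) + s powr (- 1/2))"
proof -
  have "(\<bar>ln s\<bar> / 2) ^ k / fact k \<le> exp (\<bar>ln s\<bar> / 2)"
    by (rule power_div_fact_le_exp) simp
  then have "\<bar>ln s\<bar> ^ k \<le> 2 ^ k * fact k * exp (\<bar>ln s\<bar> / 2)"
    by (simp add: power_divide field_simps)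
  also have "exp (\<bar>ln s\<bar> / 2) \<le> exp (ln s / 2) + exp (- ln s / 2)"
    by (cases "ln s \<ge> 0") auto
  also have "exp (ln s / 2) + exp (- ln s / 2) = s powr (1/2) + s powr (- 1/2)"
    using assms by (simp add: powr_def)
  finally show ?thesis by simp
qed

lemma set_integrable_gamma:
  assumes "a > (0::real)"
  shows "set_integrable lborel {0<..} (\<lambda>s. exp (- s) * s powr (a - 1))"
proof -
  have "(\<lambda>t. complex_of_real t powr (of_real a - 1) / of_real (exp t)) absolutely_integrable_on {0<..}"
    using absolutely_integrable_Gamma_integral'[of "of_real a"] assms by simp
  then have "set_integrable lebesgue {0<..} (\<lambda>t. norm (complex_of_real t powr (of_real a - 1) / of_real (exp t)))"
    by (rule set_integrable_norm)
  also have "?this \<longleftrightarrow> set_integrable lebesgue {0<..} (\<lambda>s. exp (- s) * s powr (a - 1))"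
    by (intro set_integrable_cong) (auto simp: norm_divide norm_powr_real_powr exp_minus field_simps)
  finally show ?thesis
    unfolding set_integrable_def by (subst (asm) integrable_completion) auto
qed

lemma set_integrable_log_gamma:
  assumes "n \<ge> 1"
  shows "set_integrable lborel {0<..} (\<lambda>s::real. exp (- s) * s ^ (n - 1) * ln s ^ k)"
  unfolding set_integrable_def
proof (rule Bochner_Integration.integrable_bound)
  let ?g = "\<lambda>s::real. 2 ^ k * fact k * (exp (- s) * s powr (real n + 1/2 - 1) + exp (- s) * s powr (real n - 1/2 - 1))"
  have "set_integrable lborel {0<..} ?g"
    using assms by (intro set_integrable_mult_right set_integral_add(1) set_integrable_gamma) auto
  then show "integrable lborel (\<lambda>s. indicator {0<..} s *\<^sub>R ?g s)" by (simp add: set_integrable_def)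
  show "AE s in lborel. norm (indicator {0<..} s *\<^sub>R (exp (- s) * s ^ (n - 1) * ln s ^ k)) \<le> norm (indicator {0<..} s *\<^sub>R ?g s)"
  proof (rule AE_I2)
    fix s :: real
    show "norm (indicator {0<..} s *\<^sub>R (exp (- s) * s ^ (n - 1) * ln s ^ k)) \<le> norm (indicator {0<..} s *\<^sub>R ?g s)"
    proof (cases "s > 0")
      case True
      have p: "s ^ (n - 1) = s powr (real n - 1)" using True assms by (simp add: powr_realpow[symmetric] of_nat_diff)
      have "norm (exp (- s) * s ^ (n - 1) * ln s ^ k) = exp (- s) * s ^ (n - 1) * \<bar>ln s\<bar> ^ k"
        using True by (simp add: abs_mult power_abs)
      also have "\<dots> = exp (- s) * s powr (real n - 1) * \<bar>ln s\<bar> ^ k" unfolding p ..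
      also have "\<dots> \<le> exp (- s) * s powr (real n - 1) * (2 ^ k * fact k * (s powr (1/2) + s powr (- 1/2)))"
        by (rule mult_left_mono[OF abs_ln_power_bound[OF True]]) simp
      also have "\<dots> = ?g s" by (simp add: algebra_simps powr_add[symmetric])
      finally show ?thesis using True by simp
    qed simp
  qed
qed simp

text \<open>
  The substitution \<open>v = s / t\<close> turns \<open>ln v\<close> into \<open>ln s - ln t\<close>; the binomial theorem gives a polynomial
  of degree \<open>k\<close> in \<open>ln t\<close>, divided by \<open>t\<^sup>n\<close>.
\<close>

lemma laplace_log_monomial:
  fixes t :: real
  assumes n: "n \<ge> 1" and t: "t > 0"
  shows "set_integrable lborel {0<..} (\<lambda>v. exp (- (v * t)) * v ^ (n - 1) * ln v ^ k)"
    "(LINT v:{0<..}|lborel. exp (- (v * t)) * v ^ (n - 1) * ln v ^ k) =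
      (\<Sum>j=0..k. real (k choose j) * (LINT s:{0<..}|lborel. exp (- s) * s ^ (n - 1) * ln s ^ (k - j)) * (- 1) ^ j * ln t ^ j / t ^ n)"
proof -
  let ?h = "\<lambda>v::real. indicator {0<..} v *\<^sub>R (exp (- (v * t)) * v ^ (n - 1) * ln v ^ k)"
  define c where "c j = real (k choose j) * (- ln t) ^ j / t ^ (n - 1)" for j
  have eq: "?h (0 + (1 / t) * s) = (\<Sum>j\<le>k. c j * (indicator {0<..} s *\<^sub>R (exp (- s) * s ^ (n - 1) * ln s ^ (k - j))))" for s
  proof (cases "s > 0")
    case True
    have l: "ln ((1 / t) * s) = - ln t + ln s" using True t by (simp add: ln_div)
    have "ln ((1 / t) * s) ^ k = (\<Sum>j\<le>k. real (k choose j) * (- ln t) ^ j * ln s ^ (k - j))"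
      unfolding l by (rule binomial_ring)
    then show ?thesis using True t
      by (simp add: c_def sum_distrib_left power_divide mult_ac divide_simps)
  next
    case False
    then have "\<not> (1 / t) * s > 0" using t by (simp add: zero_less_divide_iff)
    then show ?thesis using False by simp
  qed
  have int: "integrable lborel (\<lambda>s::real. indicator {0<..} s *\<^sub>R (exp (- s) * s ^ (n - 1) * ln s ^ (k - j)))" for j
    using set_integrable_log_gamma[OF n, of "k - j"] unfolding set_integrable_def .
  have "integrable lborel (\<lambda>s. ?h (0 + (1 / t) * s))"
    unfolding eq by (intro Bochner_Integration.integrable_sum integrable_mult_right int)
  then show "set_integrable lborel {0<..} (\<lambda>v. exp (- (v * t)) * v ^ (n - 1) * ln v ^ k)"
    using t unfolding set_integrable_def by (subst (asm) lborel_integrable_real_affine_iff) auto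
  have "(LINT v:{0<..}|lborel. exp (- (v * t)) * v ^ (n - 1) * ln v ^ k) = \<bar>1 / t\<bar> *\<^sub>R (LINT s|lborel. ?h (0 + (1 / t) * s))"
    unfolding set_lebesgue_integral_def using t by (intro lborel_integral_real_affine) simp
  also have "(LINT s|lborel. ?h (0 + (1 / t) * s)) = (\<Sum>j\<le>k. c j * (LINT s:{0<..}|lborel. exp (- s) * s ^ (n - 1) * ln s ^ (k - j)))"
    unfolding eq set_lebesgue_integral_def using int by (subst Bochner_Integration.integral_sum) auto
  also have "\<bar>1 / t\<bar> *\<^sub>R \<dots> = (\<Sum>j=0..k. real (k choose j) * (LINT s:{0<..}|lborel. exp (- s) * s ^ (n - 1) * ln s ^ (k - j)) * (- 1) ^ j * ln t ^ j / t ^ n)"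
  proof -
    have e: "1 / t * (c j * x) = real (k choose j) * x * (- 1) ^ j * ln t ^ j / t ^ n" for j x
    proof -
      have "t ^ n = t * t ^ (n - 1)" using n by (cases n) auto
      then show ?thesis using t by (simp add: c_def power_minus[of "ln t"] mult_ac)
    qed
    show ?thesis using t by (simp add: sum_distrib_left atMost_atLeast0 e[simplified] del: atLeastAtMost_iff)
  qed
  finally show "(LINT v:{0<..}|lborel. exp (- (v * t)) * v ^ (n - 1) * ln v ^ k) =
      (\<Sum>j=0..k. real (k choose j) * (LINT s:{0<..}|lborel. exp (- s) * s ^ (n - 1) * ln s ^ (k - j)) * (- 1) ^ j * ln t ^ j / t ^ n)" .
qed

lemma exp_bigo_log_power: "\<delta> > 0 \<Longrightarrow> (\<lambda>t::real. exp (- (\<delta> * t))) \<in> O[at_top](\<lambda>t. (ln t / t) ^ Suc N)"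
  by real_asymp

text \<open>
  On \<open>v \<ge> \<delta>\<close> the factor \<open>exp (- v t)\<close> is at most \<open>exp (- \<delta> (t - 1)) exp (- v)\<close>, so this part decays
  exponentially.
\<close>

lemma laplace_tail_bigo:
  fixes f :: "real \<Rightarrow> real"
  assumes f: "set_integrable lborel A (\<lambda>v. exp (- v) * f v)" and A: "A \<subseteq> {\<delta>..}" "A \<in> sets borel" "\<delta> > 0"
  shows "(\<lambda>t. LINT v:A|lborel. exp (- (v * t)) * f v) \<in> O[at_top](\<lambda>t. (ln t / t) ^ Suc N)"
proof -
  define K where "K = (LINT v:A|lborel. \<bar>exp (- v) * f v\<bar>)"
  have fa: "set_integrable lborel A (\<lambda>v. \<bar>exp (- v) * f v\<bar>)" using f by (rule set_integrable_abs)
  have bound: "\<bar>LINT v:A|lborel. exp (- (v * t)) * f v\<bar> \<le> exp \<delta> * K * exp (- (\<delta> * t))" if t: "t \<ge> 1" for t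
  proof -
    have pt: "\<bar>exp (- (v * t)) * f v\<bar> \<le> exp \<delta> * exp (- (\<delta> * t)) * \<bar>exp (- v) * f v\<bar>" if "v \<in> A" for v
    proof -
      have "\<delta> * (t - 1) \<le> v * (t - 1)" using that A t by (intro mult_right_mono) auto
      then have "exp (- (v * t)) \<le> exp (\<delta> + - (\<delta> * t) + - v)" by (simp add: algebra_simps)
      also have "\<dots> = exp \<delta> * exp (- (\<delta> * t)) * exp (- v)" by (simp only: exp_add)
      finally have "exp (- (v * t)) * \<bar>f v\<bar> \<le> exp \<delta> * exp (- (\<delta> * t)) * exp (- v) * \<bar>f v\<bar>"
        by (rule mult_right_mono) simp
      then show ?thesis by (simp add: abs_mult mult.assoc)
    qed
    have "\<bar>LINT v:A|lborel. exp (- (v * t)) * f v\<bar> \<le> (LINT v:A|lborel. exp \<delta> * exp (- (\<delta> * t)) * \<bar>exp (- v) * f v\<bar>)"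
      unfolding set_lebesgue_integral_def real_norm_def[symmetric]
    proof (rule Bochner_Integration.integral_norm_bound_integral)
      show "integrable lborel (\<lambda>x. indicator A x *\<^sub>R (exp \<delta> * exp (- (\<delta> * t)) * norm (exp (- x) * f x)))"
        using set_integrable_mult_right[OF fa, of "exp \<delta> * exp (- (\<delta> * t))"] by (simp add: set_integrable_def)
      show "integrable lborel (\<lambda>x. indicator A x *\<^sub>R (exp (- (x * t)) * f x))"
      proof (rule Bochner_Integration.integrable_bound)
        show "integrable lborel (\<lambda>x. indicator A x *\<^sub>R (exp \<delta> * exp (- (\<delta> * t)) * norm (exp (- x) * f x)))" by fact
        have "(\<lambda>x. exp x * exp (- (x * t)) * (indicator A x *\<^sub>R (exp (- x) * f x))) \<in> borel_measurable lborel"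
          using borel_measurable_integrable[OF f[unfolded set_integrable_def]] by measurable
        then show "(\<lambda>x. indicator A x *\<^sub>R (exp (- (x * t)) * f x)) \<in> borel_measurable lborel"
          by (rule measurable_cong[THEN iffD1, rotated]) (simp add: exp_minus mult_ac)
        show "AE x in lborel. norm (indicator A x *\<^sub>R (exp (- (x * t)) * f x)) \<le> norm (indicator A x *\<^sub>R (exp \<delta> * exp (- (\<delta> * t)) * norm (exp (- x) * f x)))"
          using pt by (intro AE_I2) (auto simp: indicator_def abs_mult)
      qed
      show "norm (indicator A x *\<^sub>R (exp (- (x * t)) * f x)) \<le> indicator A x *\<^sub>R (exp \<delta> * exp (- (\<delta> * t)) * norm (exp (- x) * f x))" for x
        using pt[of x] by (auto simp: indicator_def)
    qed
    also have "\<dots> = exp \<delta> * K * exp (- (\<delta> * t))" unfolding K_def by simp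
    finally show ?thesis .
  qed
  have "(\<lambda>t. LINT v:A|lborel. exp (- (v * t)) * f v) \<in> O[at_top](\<lambda>t. exp \<delta> * K * exp (- (\<delta> * t)))"
  proof (rule landau_o.big_mono)
    show "\<forall>\<^sub>F t in at_top. norm (LINT v:A|lborel. exp (- (v * t)) * f v) \<le> norm (exp \<delta> * K * exp (- (\<delta> * t)))"
      using eventually_ge_at_top[of 1] by eventually_elim (use bound in \<open>fastforce intro: order_trans[OF _ abs_ge_self]\<close>)
  qed
  also have "(\<lambda>t. exp \<delta> * K * exp (- (\<delta> * t))) \<in> O[at_top](\<lambda>t. (ln t / t) ^ Suc N)"
    using landau_o.big.cmult_in_iff[of "exp \<delta> * K"] exp_bigo_log_power[OF A(3), of N] by (cases "K = 0") auto
  finally show ?thesis .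
qed

lemma set_integrable_unit_log_monomial:
  assumes "n \<ge> 1"
  shows "set_integrable lborel {0<..1} (\<lambda>v::real. v ^ (n - 1) * ln v ^ k)"
  unfolding set_integrable_def
proof (rule Bochner_Integration.integrable_bound)
  show "integrable lborel (\<lambda>s::real. exp 1 * (indicator {0<..} s *\<^sub>R (exp (- s) * s ^ (n - 1) * ln s ^ k)))"
    using set_integrable_log_gamma[OF assms, of k] unfolding set_integrable_def by (rule integrable_mult_right)
  have "norm (indicator {0<..1} v *\<^sub>R (v ^ (n - 1) * ln v ^ k)) \<le> norm (exp 1 * (indicator {0<..} v *\<^sub>R (exp (- v) * v ^ (n - 1) * ln v ^ k)))" for v :: real
  proof (cases "v \<in> {0<..1}")
    case True
    then have "1 \<le> exp 1 * exp (- v)" by (simp add: exp_add[symmetric])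
    then have "1 * \<bar>v ^ (n - 1) * ln v ^ k\<bar> \<le> exp 1 * exp (- v) * \<bar>v ^ (n - 1) * ln v ^ k\<bar>"
      by (rule mult_right_mono) simp
    then show ?thesis using True by (simp add: abs_mult mult.assoc)
  qed simp
  then show "AE v in (lborel :: real measure). norm (indicator {0<..1} v *\<^sub>R (v ^ (n - 1) * ln v ^ k)) \<le> norm (exp 1 * (indicator {0<..} v *\<^sub>R (exp (- v) * v ^ (n - 1) * ln v ^ k)))"
    by (rule AE_I2)
qed simp

lemma set_integrable_exp_mult:
  fixes f :: "real \<Rightarrow> real"
  assumes f: "set_integrable lborel A f" and t: "t \<ge> 0" and A: "A \<subseteq> {0<..}" "A \<in> sets borel"
  shows "set_integrable lborel A (\<lambda>v. exp (- (v * t)) * f v)"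
    "set_integrable lborel A (\<lambda>v. (1 - exp (- (v * t))) * f v)"
proof -
  show 1: "set_integrable lborel A (\<lambda>v. exp (- (v * t)) * f v)"
    unfolding set_integrable_def
  proof (rule Bochner_Integration.integrable_bound[OF f[unfolded set_integrable_def]])
    have "(\<lambda>x. exp (- (x * t)) * (indicator A x *\<^sub>R f x)) \<in> borel_measurable lborel"
      using borel_measurable_integrable[OF f[unfolded set_integrable_def]] by measurable
    then show "(\<lambda>x. indicator A x *\<^sub>R (exp (- (x * t)) * f x)) \<in> borel_measurable lborel"
      by (simp add: mult.left_commute)
    have "norm (indicator A v *\<^sub>R (exp (- (v * t)) * f v)) \<le> norm (indicator A v *\<^sub>R f v)" for v
    proof (cases "v \<in> A")
      case True
      then have "exp (- (v * t)) \<le> 1" using A t by auto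
      then have "exp (- (v * t)) * \<bar>f v\<bar> \<le> 1 * \<bar>f v\<bar>" by (rule mult_right_mono) simp
      then show ?thesis using True by (simp add: abs_mult)
    qed simp
    then show "AE v in lborel. norm (indicator A v *\<^sub>R (exp (- (v * t)) * f v)) \<le> norm (indicator A v *\<^sub>R f v)" by (rule AE_I2)
  qed
  show "set_integrable lborel A (\<lambda>v. (1 - exp (- (v * t))) * f v)"
    using set_integral_diff(1)[OF f 1] by (simp add: algebra_simps)
qed

lemma laplace_unit_log_monomial:
  assumes n: "n \<ge> 1" and t: "t > 0"
  shows "(LINT v:{0<..1}|lborel. exp (- (v * t)) * v ^ (n - 1) * ln v ^ k) =
     (\<Sum>j=0..k. real (k choose j) * (LINT s:{0<..}|lborel. exp (- s) * s ^ (n - 1) * ln s ^ (k - j)) * (- 1) ^ j * ln t ^ j / t ^ n)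
     - (LINT v:{1<..}|lborel. exp (- (v * t)) * (v ^ (n - 1) * ln v ^ k))"
proof -
  let ?f = "\<lambda>v. exp (- (v * t)) * v ^ (n - 1) * ln v ^ k"
  have i: "set_integrable lborel {0<..1} ?f" "set_integrable lborel {1<..} ?f"
    by (rule set_integrable_subset[OF laplace_log_monomial(1)[OF n t]]; auto)+
  have u: "{0<..} = {0<..1} \<union> ({1<..} :: real set) \<and> {0<..1} \<inter> {1<..} = ({}::real set)" by auto
  have "(LINT v:{0<..}|lborel. ?f v) = (LINT v:{0<..1}|lborel. ?f v) + (LINT v:{1<..}|lborel. ?f v)"
    using set_integral_Un[OF _ i] u by simp
  then show ?thesis unfolding laplace_log_monomial(2)[OF n t] by (simp add: mult.assoc)
qed

lemma log_tail_bigo: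
  assumes n: "n \<ge> 1"
  shows "(\<lambda>t. LINT v:{1<..}|lborel. exp (- (v * t)) * (v ^ (n - 1) * ln v ^ k)) \<in> O[at_top](\<lambda>t::real. (ln t / t) ^ Suc N)"
proof (rule laplace_tail_bigo[where \<delta> = 1])
  show "set_integrable lborel {1<..} (\<lambda>v::real. exp (- v) * (v ^ (n - 1) * ln v ^ k))"
    using set_integrable_subset[OF set_integrable_log_gamma[OF n, of k], of "{1<..}"] by (simp add: mult.assoc)
qed auto

lemma laplace_unit_tail_expansion:
  assumes n: "n \<ge> 1" and k: "k \<le> n"
  shows "tail_expansion N (\<lambda>t. LINT v:{0<..1}|lborel. exp (- (v * t)) * v ^ (n - 1) * ln v ^ k)"
proof (rule tail_expansion_eventually)
  let ?T = "\<lambda>t::real. LINT v:{1<..}|lborel. exp (- (v * t)) * (v ^ (n - 1) * ln v ^ k)"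
  let ?S = "\<lambda>t::real. \<Sum>j=0..k. real (k choose j) * (LINT s:{0<..}|lborel. exp (- s) * s ^ (n - 1) * ln s ^ (k - j)) * (- 1) ^ j * ln t ^ j / t ^ n"
  have "(\<lambda>t. - ?T t) \<in> O[at_top](\<lambda>t. (ln t / t) ^ Suc N)" using log_tail_bigo[OF n] by simp
  then show "tail_expansion N (\<lambda>t. ?S t + - ?T t)"
    using n k by (intro tail_expansion_add tail_expansion_sum tail_expansion_monomial tail_expansion_bigo) auto
  show "\<forall>\<^sub>F t in at_top. ?S t + - ?T t = (LINT v:{0<..1}|lborel. exp (- (v * t)) * v ^ (n - 1) * ln v ^ k)"
    using eventually_gt_at_top[of 0] by eventually_elim (simp only: laplace_unit_log_monomial[OF n] diff_conv_add_uminus)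
qed

text \<open>
  The comparison integral for a remainder of order \<open>N + 1\<close> in \<open>v ln v\<close>, already divided by \<open>v\<close>.
\<close>

lemma laplace_unit_bigo:
  assumes k: "k \<le> Suc N"
  shows "(\<lambda>t. LINT v:{0<..1}|lborel. exp (- (v * t)) * v ^ N * ln v ^ k) \<in> O[at_top](\<lambda>t::real. (ln t / t) ^ Suc N)"
proof (rule landau_o.big.in_cong[THEN iffD1])
  let ?T = "\<lambda>t::real. LINT v:{1<..}|lborel. exp (- (v * t)) * (v ^ (Suc N - 1) * ln v ^ k)"
  let ?S = "\<lambda>t::real. \<Sum>j=0..k. real (k choose j) * (LINT s:{0<..}|lborel. exp (- s) * s ^ (Suc N - 1) * ln s ^ (k - j)) * (- 1) ^ j * ln t ^ j / t ^ Suc N"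
  show "(\<lambda>t. ?S t - ?T t) \<in> O[at_top](\<lambda>t. (ln t / t) ^ Suc N)"
    using k by (intro sum_in_bigo(2) big_sum_in_bigo log_monomial_bigo log_tail_bigo) auto
  show "\<forall>\<^sub>F t in at_top. ?S t - ?T t = (LINT v:{0<..1}|lborel. exp (- (v * t)) * v ^ N * ln v ^ k)"
    using eventually_gt_at_top[of 0]
  proof eventually_elim
    case (elim t)
    show ?case using laplace_unit_log_monomial[OF _ elim, of "Suc N" k] by simp
  qed
qed

lemma logpoly_integral:
  assumes "logpoly P"
  shows "set_integrable lborel {0<..1} (\<lambda>v. P v / v) \<and>
    tail_expansion N (\<lambda>t. LINT v:{0<..1}|lborel. (1 - exp (- (v * t))) * (P v / v))"
  using assms
proof (induction rule: logpoly.induct)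
  case (monomial i j c)
  define n where "n = i + j"
  have n: "n \<ge> 1" "j \<le> n" using monomial by (auto simp: n_def)
  have eq: "c * (v ^ i * (v * ln v) ^ j) / v = c * (v ^ (n - 1) * ln v ^ j)" if "v > 0" for v :: real
  proof -
    have "v ^ i * v ^ j = v ^ n" by (simp add: n_def power_add)
    also have "\<dots> = v * v ^ (n - 1)" using n by (cases n) auto
    finally have "v ^ i * v ^ j = v * v ^ (n - 1)" .
    then show ?thesis using that by (simp add: power_mult_distrib field_simps)
  qed
  have i0: "set_integrable lborel {0<..1} (\<lambda>v. c * (v ^ (n - 1) * ln v ^ j))"
    by (intro set_integrable_mult_right set_integrable_unit_log_monomial n)
  then have i1: "set_integrable lborel {0<..1} (\<lambda>v. c * (v ^ i * (v * ln v) ^ j) / v)"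
    by (rule set_integrable_cong[THEN iffD1, rotated -1]) (auto simp: eq)
  have "tail_expansion N (\<lambda>t. (LINT v:{0<..1}|lborel. c * (v ^ (n - 1) * ln v ^ j)) + (- c) * (LINT v:{0<..1}|lborel. exp (- (v * t)) * v ^ (n - 1) * ln v ^ j))"
    by (intro tail_expansion_add tail_expansion_const tail_expansion_cmult laplace_unit_tail_expansion n)
  then have "tail_expansion N (\<lambda>t. LINT v:{0<..1}|lborel. (1 - exp (- (v * t))) * (c * (v ^ i * (v * ln v) ^ j) / v))"
  proof (rule tail_expansion_eventually)
    show "\<forall>\<^sub>F t in at_top. (LINT v:{0<..1}|lborel. c * (v ^ (n - 1) * ln v ^ j)) + (- c) * (LINT v:{0<..1}|lborel. exp (- (v * t)) * v ^ (n - 1) * ln v ^ j)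
       = (LINT v:{0<..1}|lborel. (1 - exp (- (v * t))) * (c * (v ^ i * (v * ln v) ^ j) / v))"
      using eventually_ge_at_top[of 0]
    proof eventually_elim
      case (elim t)
      have "(LINT v:{0<..1}|lborel. (1 - exp (- (v * t))) * (c * (v ^ i * (v * ln v) ^ j) / v)) =
         (LINT v:{0<..1}|lborel. c * (v ^ (n - 1) * ln v ^ j) - exp (- (v * t)) * (c * (v ^ (n - 1) * ln v ^ j)))"
      proof (rule set_lebesgue_integral_cong)
        show "\<forall>v. v \<in> {0<..1} \<longrightarrow> (1 - exp (- (v * t))) * (c * (v ^ i * (v * ln v) ^ j) / v) =
           c * (v ^ (n - 1) * ln v ^ j) - exp (- (v * t)) * (c * (v ^ (n - 1) * ln v ^ j))"
        proof (intro allI impI)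
          fix v :: real assume "v \<in> {0<..1}"
          then have "v > 0" by simp
          show "(1 - exp (- (v * t))) * (c * (v ^ i * (v * ln v) ^ j) / v) =
             c * (v ^ (n - 1) * ln v ^ j) - exp (- (v * t)) * (c * (v ^ (n - 1) * ln v ^ j))"
            unfolding eq[OF \<open>v > 0\<close>] by (simp only: left_diff_distrib mult_1)
        qed
      qed simp
      also have "\<dots> = (LINT v:{0<..1}|lborel. c * (v ^ (n - 1) * ln v ^ j)) - (LINT v:{0<..1}|lborel. exp (- (v * t)) * (c * (v ^ (n - 1) * ln v ^ j)))"
        by (intro set_integral_diff i0 set_integrable_exp_mult elim) auto
      also have "(LINT v:{0<..1}|lborel. exp (- (v * t)) * (c * (v ^ (n - 1) * ln v ^ j))) = (LINT v:{0<..1}|lborel. c * (exp (- (v * t)) * v ^ (n - 1) * ln v ^ j))"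
        by (simp only: mult_ac)
      also have "\<dots> = c * (LINT v:{0<..1}|lborel. exp (- (v * t)) * v ^ (n - 1) * ln v ^ j)"
        by (rule set_integral_mult_right)
      finally show ?case by simp
    qed
  qed
  with i1 show ?case by blast
next
  case (add f g)
  then have i: "set_integrable lborel {0<..1} (\<lambda>v. f v / v)" "set_integrable lborel {0<..1} (\<lambda>v. g v / v)" by auto
  have "tail_expansion N (\<lambda>t. (LINT v:{0<..1}|lborel. (1 - exp (- (v * t))) * (f v / v)) + (LINT v:{0<..1}|lborel. (1 - exp (- (v * t))) * (g v / v)))"
    using add by (intro tail_expansion_add) auto
  then have "tail_expansion N (\<lambda>t. LINT v:{0<..1}|lborel. (1 - exp (- (v * t))) * ((f v + g v) / v))"
  proof (rule tail_expansion_eventually)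
    show "\<forall>\<^sub>F t in at_top. (LINT v:{0<..1}|lborel. (1 - exp (- (v * t))) * (f v / v)) + (LINT v:{0<..1}|lborel. (1 - exp (- (v * t))) * (g v / v))
      = (LINT v:{0<..1}|lborel. (1 - exp (- (v * t))) * ((f v + g v) / v))"
      using eventually_ge_at_top[of 0]
    proof eventually_elim
      case (elim t)
      show ?case
        unfolding add_divide_distrib distrib_left
        by (intro set_integral_add(2)[symmetric] set_integrable_exp_mult i elim) auto
    qed
  qed
  then show ?case using set_integral_add(1)[OF i] by (simp add: add_divide_distrib)
qed

text \<open>
  Scaling by \<open>t\<close> gives the integral of \<open>(1 - exp (- s)) / s\<close> over \<open>0 < s \<le> t\<close>. The part of \<open>1 / s\<close> beyond
  \<open>s = 1\<close> contributes \<open>ln t\<close>; what remains converges to a constant exponentially fast.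
\<close>

lemma log_integral_expansion:
  fixes t :: real
  shows
  "t \<ge> 0 \<Longrightarrow> set_integrable lborel {0<..1} (\<lambda>v. (1 - exp (- (v * t))) / v)" (is "_ \<Longrightarrow> ?A")
  "tail_expansion N (\<lambda>t. (LINT v:{0<..1}|lborel. (1 - exp (- (v * t))) / v) - ln t)" (is ?B)
proof -
  have int: "set_integrable lborel {0<..a} (\<lambda>v. (1 - exp (- (v * t))) / v)" if "t \<ge> 0" for a t :: real
    unfolding set_integrable_def
  proof (rule Bochner_Integration.integrable_bound)
    have "set_integrable lborel {0<..a} (\<lambda>_. t)"
      by (rule set_integrable_subset[OF borel_integrable_atLeastAtMost'[of 0 a]]) auto
    then show "integrable lborel (\<lambda>v. indicator {0<..a} v *\<^sub>R t)" by (simp add: set_integrable_def)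
    have "norm (indicator {0<..a} v *\<^sub>R ((1 - exp (- (v * t))) / v)) \<le> norm (indicator {0<..a} v *\<^sub>R t)" for v
    proof (cases "v \<in> {0<..a}")
      case True
      have "1 - exp (- (v * t)) \<le> v * t" using exp_ge_add_one_self[of "- (v * t)"] by linarith
      moreover have "0 \<le> 1 - exp (- (v * t))" using True that by simp
      ultimately show ?thesis using True that by (simp add: abs_mult field_simps)
    qed simp
    then show "AE v in lborel. norm (indicator {0<..a} v *\<^sub>R ((1 - exp (- (v * t))) / v)) \<le> norm (indicator {0<..a} v *\<^sub>R t)" by (rule AE_I2)
  qed simp
  have exph: "set_integrable lborel {0<..} (\<lambda>s::real. exp (- (s * (1/2))))"
    using laplace_log_monomial(1)[of 1 "1/2" 0] by simp
  define K :: real where "K = (LINT s:{0<..}|lborel. exp (- (s * (1/2))))"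
  have ei: "set_integrable lborel {a<..} (\<lambda>s. exp (- s) / s)" and eb: "\<bar>LINT s:{a<..}|lborel. exp (- s) / s\<bar> \<le> K * exp (- (1/2 * a))"
    if a: "a \<ge> 1" for a :: real
  proof -
    have pt: "norm (indicator {a<..} s *\<^sub>R (exp (- s) / s)) \<le> exp (- (1/2 * a)) * (indicator {0<..} s *\<^sub>R exp (- (s * (1/2))))" for s
    proof (cases "s > a")
      case True
      then have "exp (- s) / s \<le> exp (- s)" using a by (simp add: divide_le_eq mult_le_cancel_left1)
      also have "exp (- s) \<le> exp (- (1/2 * a) + - (s * (1/2)))" using True by simp
      also have "\<dots> = exp (- (1/2 * a)) * exp (- (s * (1/2)))" by (rule exp_add)
      finally show ?thesis using True a by simp
    qed simp
    have ib: "integrable lborel (\<lambda>s. exp (- (1/2 * a)) * (indicator {0<..} s *\<^sub>R exp (- (s * (1/2)))))"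
      using exph unfolding set_integrable_def by (rule integrable_mult_right)
    show 1: "set_integrable lborel {a<..} (\<lambda>s. exp (- s) / s)"
      unfolding set_integrable_def
      by (rule Bochner_Integration.integrable_bound[OF ib]) (use pt in \<open>auto intro!: AE_I2 order_trans[OF _ abs_ge_self]\<close>)
    have "norm (LINT s:{a<..}|lborel. exp (- s) / s) \<le> (LINT s|lborel. exp (- (1/2 * a)) * (indicator {0<..} s *\<^sub>R exp (- (s * (1/2)))))"
      unfolding set_lebesgue_integral_def
      by (rule Bochner_Integration.integral_norm_bound_integral[OF 1[unfolded set_integrable_def] ib]) (rule pt)
    then show "\<bar>LINT s:{a<..}|lborel. exp (- s) / s\<bar> \<le> K * exp (- (1/2 * a))"
      by (simp add: K_def set_lebesgue_integral_def mult.commute)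
  qed
  define C :: real where "C = (LINT s:{0<..1}|lborel. (1 - exp (- (s * 1))) / s) - (LINT s:{1<..}|lborel. exp (- s) / s)"
  have main: "(LINT v:{0<..1}|lborel. (1 - exp (- (v * t))) / v) - ln t = C + (LINT s:{t<..}|lborel. exp (- s) / s)" if t: "t \<ge> 1" for t :: real
  proof -
    have "(LINT v:{0<..1}|lborel. (1 - exp (- (v * t))) / v) = \<bar>1 / t\<bar> *\<^sub>R (LINT s|lborel. indicator {0<..1} (0 + (1 / t) * s) *\<^sub>R ((1 - exp (- ((0 + (1 / t) * s) * t))) / (0 + (1 / t) * s)))"
      unfolding set_lebesgue_integral_def using t by (intro lborel_integral_real_affine) simp
    also have "\<dots> = (LINT s:{0<..t}|lborel. (1 - exp (- (s * 1))) / s)"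
      unfolding set_lebesgue_integral_def integral_scaleR_right[symmetric] using t
      by (intro Bochner_Integration.integral_cong) (auto simp: indicator_def field_simps)
    also have "\<dots> = (LINT s:{0<..1}|lborel. (1 - exp (- (s * 1))) / s) + (LINT s:{1<..t}|lborel. (1 - exp (- (s * 1))) / s)"
    proof -
      have "{0<..t} = {0<..1} \<union> {1<..t}" "{0<..1} \<inter> {1<..t} = {}" using t by auto
      moreover have "set_integrable lborel {1<..t} (\<lambda>s. (1 - exp (- (s * 1))) / s)"
        by (rule set_integrable_subset[OF int[of 1 t]]) auto
      ultimately show ?thesis using int[of 1 1] by (simp add: set_integral_Un)
    qed
    also have "(LINT s:{1<..t}|lborel. (1 - exp (- (s * 1))) / s) = (LINT s:{1<..t}|lborel. 1 / s) - (LINT s:{1<..t}|lborel. exp (- s) / s)"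
    proof -
      have "set_integrable lborel {1..t} (\<lambda>s. 1 / s)" by (intro borel_integrable_atLeastAtMost' continuous_intros) auto
      then have 1: "set_integrable lborel {1<..t} (\<lambda>s. 1 / s)" by (rule set_integrable_subset) auto
      have 2: "set_integrable lborel {1<..t} (\<lambda>s. exp (- s) / s)" by (rule set_integrable_subset[OF ei[of 1]]) auto
      show ?thesis using set_integral_diff(2)[OF 1 2] by (simp add: diff_divide_distrib)
    qed
    also have "(LINT s:{1<..t}|lborel. 1 / s) = ln t"
    proof -
      have "((\<lambda>s. 1 / s) has_integral ln t - ln 1) {1..t}"
        using t by (intro fundamental_theorem_of_calculus) (auto intro!: derivative_eq_intros simp: has_real_derivative_iff_has_vector_derivative[symmetric] divide_inverse)
      moreover have i: "set_integrable lborel {1..t} (\<lambda>s. 1 / s)" by (intro borel_integrable_atLeastAtMost' continuous_intros) auto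
      ultimately have "(LINT s:{1..t}|lborel. 1 / s) = ln t"
        using set_borel_integral_eq_integral(2)[OF i] by (simp add: integral_unique)
      moreover have "(LINT s:{1..t}|lborel. 1 / s) = (LINT s:{1<..t}|lborel. 1 / s)"
        unfolding set_lebesgue_integral_def
        by (rule integral_cong_AE) (use AE_lborel_singleton[of 1] in \<open>auto simp: indicator_def elim!: eventually_mono\<close>)
      ultimately show ?thesis by simp
    qed
    also have "(LINT s:{1<..t}|lborel. exp (- s) / s) = (LINT s:{1<..}|lborel. exp (- s) / s) - (LINT s:{t<..}|lborel. exp (- s) / s)"
    proof -
      have "{1<..} = {1<..t} \<union> {t<..}" "{1<..t} \<inter> {t<..} = {}" using t by auto
      moreover have "set_integrable lborel {1<..t} (\<lambda>s. exp (- s) / s)" by (rule set_integrable_subset[OF ei[of 1]]) auto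
      ultimately show ?thesis using ei[OF t] by (simp add: set_integral_Un)
    qed
    finally show ?thesis by (simp add: C_def)
  qed
  have "(\<lambda>t. LINT s:{t<..}|lborel. exp (- s) / s) \<in> O[at_top](\<lambda>t. exp (- (1/2 * t)) :: real)"
    by (rule bigoI[of _ K], rule eventually_mono[OF eventually_ge_at_top[of 1]]) (use eb in simp)
  then have "(\<lambda>t::real. LINT s:{t<..}|lborel. exp (- s) / s) \<in> O[at_top](\<lambda>t. (ln t / t) ^ Suc N)"
    by (rule landau_o.big_trans) (rule exp_bigo_log_power, simp)
  then have "tail_expansion N (\<lambda>t. C + (LINT s:{t<..}|lborel. exp (- s) / s))"
    by (intro tail_expansion_add tail_expansion_const tail_expansion_bigo)
  then show ?B
    by (rule tail_expansion_eventually) (rule eventually_mono[OF eventually_ge_at_top[of 1]], simp add: main)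
  show "t \<ge> 0 \<Longrightarrow> ?A" by (rule int)
qed

lemma set_integrable_powr_tail:
  "set_integrable lborel {1<..} (\<lambda>v::real. 1 / (v * sqrt v))"
proof -
  have "((\<lambda>x::real. x powr (- 3/2)) has_integral -(1 powr (- 3/2 + 1)) / (- 3/2 + 1)) {1..}"
    by (rule has_integral_powr_to_inf) auto
  then have "(\<lambda>x::real. x powr (- 3/2)) absolutely_integrable_on {1..}"
    by (intro nonnegative_absolutely_integrable_1) (auto simp: integrable_on_def)
  then have "set_integrable lborel {1..} (\<lambda>x::real. x powr (- 3/2))"
    unfolding set_integrable_def by (subst (asm) integrable_completion) auto
  then have "set_integrable lborel {1<..} (\<lambda>x::real. x powr (- 3/2))" by (rule set_integrable_subset) auto
  also have "?this \<longleftrightarrow> ?thesis"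
  proof (rule set_integrable_cong)
    fix v :: real assume "v \<in> {1<..}"
    then have v: "v > 0" by simp
    have "v * sqrt v = v powr 1 * v powr (1/2)" using v by (simp add: powr_half_sqrt)
    also have "\<dots> = v powr (1 + 1/2)" by (rule powr_add[symmetric])
    also have "1 + 1/2 = (3/2 :: real)" by simp
    finally show "v powr (- 3/2) = 1 / (v * sqrt v)" by (simp add: powr_minus_divide[symmetric])
  qed auto
  finally show ?thesis .
qed

lemma continuous_on_logpoly: "logpoly P \<Longrightarrow> continuous_on {0<..} P"
  by (induction rule: logpoly.induct) (auto intro!: continuous_intros)

text \<open>
  The density is split into its value \<open>1\<close> at \<open>0\<close> and the polynomial \<open>P\<close>, both on \<open>v \<le> 1\<close>, and the
  remainder \<open>\<rho>\<close>, already divided by \<open>v\<close>. The first part yields \<open>ln t\<close>, the second the powers of \<open>1 / t\<close>.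
  The remainder is integrable, so it contributes a constant minus its Laplace transform, which is small
  by \<open>laplace_unit_bigo\<close> near \<open>0\<close> and by exponential decay away from \<open>0\<close>.
\<close>

lemma watson_log:
  fixes g :: "real \<Rightarrow> real"
  assumes cont: "continuous_on {0<..} g"
    and bound: "\<And>v. v > 0 \<Longrightarrow> \<bar>g v\<bar> \<le> C / sqrt v"
    and exp: "log_expandable N (\<lambda>v. g v - 1)"
  shows "(t::real) \<ge> 0 \<Longrightarrow> set_integrable lborel {0<..} (\<lambda>v. (1 - exp (- (v * t))) * (g v / v))" (is "_ \<Longrightarrow> ?A t")
    "tail_expansion N (\<lambda>t. (LINT v:{0<..}|lborel. (1 - exp (- (v * t))) * (g v / v)) - ln t)" (is ?B)
proof -
  obtain P where P: "logpoly P" and O: "(\<lambda>v. g v - 1 - P v) \<in> O[at_right 0](\<lambda>v. (v * ln v) ^ Suc N)"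
    using exp unfolding log_expandable_def by blast
  obtain K where K: "K > 0" "\<forall>\<^sub>F v in at_right 0. norm (g v - 1 - P v) \<le> K * norm ((v * ln v) ^ Suc N)"
    using landau_o.bigE[OF O] by blast
  then obtain \<delta>' where d': "\<delta>' > 0" "\<And>v. 0 < v \<Longrightarrow> v < \<delta>' \<Longrightarrow> norm (g v - 1 - P v) \<le> K * norm ((v * ln v) ^ Suc N)"
    unfolding eventually_at_right_field by auto
  define \<delta> where "\<delta> = min (\<delta>' / 2) (1 / 2)"
  have near: "\<bar>g v - 1 - P v\<bar> \<le> K * \<bar>(v * ln v) ^ Suc N\<bar>" if "0 < v" "v \<le> \<delta>" for v
    using d'(1) d'(2)[of v] that by (auto simp: \<delta>_def)
  have d: "\<delta> > 0" "\<delta> < 1" using d'(1) by (auto simp: \<delta>_def)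
  define \<rho> where "\<rho> v = (g v - (if v \<le> 1 then 1 + P v else 0)) / v" for v
  note contP = continuous_on_logpoly[OF P]
  have rho_near: "\<bar>\<rho> v\<bar> \<le> K * \<bar>v ^ N * ln v ^ Suc N\<bar>" if "0 < v" "v \<le> \<delta>" for v
  proof -
    have "\<bar>\<rho> v\<bar> = \<bar>g v - 1 - P v\<bar> / v" using that d by (simp add: \<rho>_def abs_divide)
    also have "\<dots> \<le> K * \<bar>(v * ln v) ^ Suc N\<bar> / v" using near[OF that] that by (intro divide_right_mono) auto
    also have "\<dots> = K * \<bar>v ^ N * ln v ^ Suc N\<bar>" using that by (simp add: power_mult_distrib abs_mult)
    finally show ?thesis .
  qed
  have mind: "(\<lambda>v. indicator S v *\<^sub>R f v) \<in> borel_measurable lborel"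
    if "continuous_on S f" "S \<in> sets borel" for S :: "real set" and f :: "real \<Rightarrow> real"
    using borel_measurable_continuous_on_indicator[OF that(2,1)] by simp
  have r1: "set_integrable lborel {0<..\<delta>} \<rho>"
    unfolding set_integrable_def
  proof (rule Bochner_Integration.integrable_bound)
    have "set_integrable lborel {0<..\<delta>} (\<lambda>v. K * (v ^ N * ln v ^ Suc N))"
      by (intro set_integrable_mult_right set_integrable_subset[OF set_integrable_unit_log_monomial[of "Suc N" "Suc N", simplified diff_Suc_1]]) (use d in auto)
    then show "integrable lborel (\<lambda>v. indicator {0<..\<delta>} v *\<^sub>R (K * (v ^ N * ln v ^ Suc N)))" by (simp add: set_integrable_def)
    have "continuous_on {0<..\<delta>} (\<lambda>v. (g v - (1 + P v)) / v)"
      by (intro continuous_intros continuous_on_subset[OF cont] continuous_on_subset[OF contP]) auto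
    then have "continuous_on {0<..\<delta>} \<rho>"
      by (rule continuous_on_cong[THEN iffD1, rotated -1]) (use d in \<open>auto simp: \<rho>_def\<close>)
    then show "(\<lambda>v. indicator {0<..\<delta>} v *\<^sub>R \<rho> v) \<in> borel_measurable lborel" by (rule mind) simp
    have "norm (indicator {0<..\<delta>} v *\<^sub>R \<rho> v) \<le> norm (indicator {0<..\<delta>} v *\<^sub>R (K * (v ^ N * ln v ^ Suc N)))" for v
      using rho_near[of v] K(1) by (auto simp: indicator_def abs_mult simp del: power_Suc)
    then show "AE v in lborel. norm (indicator {0<..\<delta>} v *\<^sub>R \<rho> v) \<le> norm (indicator {0<..\<delta>} v *\<^sub>R (K * (v ^ N * ln v ^ Suc N)))"
      by (rule AE_I2)
  qed
  have r2: "set_integrable lborel {\<delta><..1} \<rho>"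
  proof -
    have "set_integrable lborel {\<delta>..1} (\<lambda>v. (g v - (1 + P v)) / v)"
      using d by (intro borel_integrable_atLeastAtMost' continuous_intros continuous_on_subset[OF cont] continuous_on_subset[OF contP]) auto
    then have "set_integrable lborel {\<delta><..1} (\<lambda>v. (g v - (1 + P v)) / v)" by (rule set_integrable_subset) auto
    then show ?thesis by (rule set_integrable_cong[THEN iffD1, rotated -1]) (auto simp: \<rho>_def)
  qed
  have r3: "set_integrable lborel {1<..} \<rho>"
    unfolding set_integrable_def
  proof (rule Bochner_Integration.integrable_bound)
    show "integrable lborel (\<lambda>v. C * (indicator {1<..} v *\<^sub>R (1 / (v * sqrt v))))"
      using set_integrable_powr_tail unfolding set_integrable_def by (rule integrable_mult_right)
    have "continuous_on {1<..} (\<lambda>v. g v / v)"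
      by (intro continuous_intros continuous_on_subset[OF cont]) auto
    then have "continuous_on {1<..} \<rho>"
      by (rule continuous_on_cong[THEN iffD1, rotated -1]) (auto simp: \<rho>_def)
    then show "(\<lambda>v. indicator {1<..} v *\<^sub>R \<rho> v) \<in> borel_measurable lborel" by (rule mind) simp
    have "norm (indicator {1<..} v *\<^sub>R \<rho> v) \<le> norm (C * (indicator {1<..} v *\<^sub>R (1 / (v * sqrt v))))" for v
    proof (cases "v > 1")
      case True
      have "\<bar>\<rho> v\<bar> = \<bar>g v\<bar> / v" using True by (simp add: \<rho>_def abs_divide)
      also have "\<dots> \<le> C / sqrt v / v" using bound[of v] True by (intro divide_right_mono) auto
      also have "\<dots> \<le> norm (C / sqrt v / v)" unfolding real_norm_def by (rule abs_ge_self)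
      finally show ?thesis using True by (simp add: mult.commute abs_mult)
    qed simp
    then show "AE v in lborel. norm (indicator {1<..} v *\<^sub>R \<rho> v) \<le> norm (C * (indicator {1<..} v *\<^sub>R (1 / (v * sqrt v))))"
      by (rule AE_I2)
  qed
  have u1: "{\<delta><..} = {\<delta><..1} \<union> {1<..}" "{0<..} = {0<..\<delta>} \<union> {\<delta><..}" "{0<..\<delta>} \<inter> {\<delta><..} = {}" using d by auto
  have r23: "set_integrable lborel {\<delta><..} \<rho>" unfolding u1(1) by (rule set_integrable_Un[OF r2 r3]) auto
  have r: "set_integrable lborel {0<..} \<rho>" unfolding u1(2) by (rule set_integrable_Un[OF r1 r23]) auto
  note LP = logpoly_integral[OF P, of N]
  have split: "indicator {0<..} v *\<^sub>R ((1 - exp (- (v * t))) * (g v / v)) =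
      indicator {0<..1} v *\<^sub>R ((1 - exp (- (v * t))) / v) + indicator {0<..1} v *\<^sub>R ((1 - exp (- (v * t))) * (P v / v))
      + indicator {0<..} v *\<^sub>R ((1 - exp (- (v * t))) * \<rho> v)" for v t :: real
  proof (cases "v > 0")
    case True
    have e: "E * (a / v) = E / v + E * (p / v) + E * ((a - (1 + p)) / v)" for E a p :: real
      using True by (simp add: field_simps)
    show ?thesis using True e[of "1 - exp (- (v * t))" "g v" "P v"] by (auto simp: indicator_def \<rho>_def)
  qed simp
  have i1: "integrable lborel (\<lambda>v. indicator {0<..1} v *\<^sub>R ((1 - exp (- (v * t))) / v))" if "t \<ge> 0" for t :: real
    using log_integral_expansion(1)[OF that] by (simp add: set_integrable_def)
  have i2: "integrable lborel (\<lambda>v. indicator {0<..1} v *\<^sub>R ((1 - exp (- (v * t))) * (P v / v)))" if "t \<ge> 0" for t :: real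
    unfolding set_integrable_def[symmetric] by (rule set_integrable_exp_mult(2)[OF conjunct1[OF LP] that]) auto
  have i3: "integrable lborel (\<lambda>v. indicator {0<..} v *\<^sub>R ((1 - exp (- (v * t))) * \<rho> v))" if "t \<ge> 0" for t :: real
    unfolding set_integrable_def[symmetric] by (rule set_integrable_exp_mult(2)[OF r that]) auto
  show "?A t" if "t \<ge> 0"
    unfolding set_integrable_def split using i1[OF that] i2[OF that] i3[OF that] by (intro Bochner_Integration.integrable_add)
  have sum: "(LINT v:{0<..}|lborel. (1 - exp (- (v * t))) * (g v / v)) =
     (LINT v:{0<..1}|lborel. (1 - exp (- (v * t))) / v) + (LINT v:{0<..1}|lborel. (1 - exp (- (v * t))) * (P v / v))
      + ((LINT v:{0<..}|lborel. \<rho> v) + - ((LINT v:{0<..\<delta>}|lborel. exp (- (v * t)) * \<rho> v) + (LINT v:{\<delta><..}|lborel. exp (- (v * t)) * \<rho> v)))" if t: "t \<ge> 0" for t :: real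
  proof -
    have "(LINT v:{0<..}|lborel. (1 - exp (- (v * t))) * \<rho> v) = (LINT v:{0<..}|lborel. \<rho> v - exp (- (v * t)) * \<rho> v)"
      by (simp add: left_diff_distrib)
    also have "\<dots> = (LINT v:{0<..}|lborel. \<rho> v) - (LINT v:{0<..}|lborel. exp (- (v * t)) * \<rho> v)"
      by (intro set_integral_diff(2) r set_integrable_exp_mult(1) t) auto
    also have "(LINT v:{0<..}|lborel. exp (- (v * t)) * \<rho> v) = (LINT v:{0<..\<delta>}|lborel. exp (- (v * t)) * \<rho> v) + (LINT v:{\<delta><..}|lborel. exp (- (v * t)) * \<rho> v)"
      unfolding u1(2) using d by (intro set_integral_Un u1(3) set_integrable_exp_mult(1) r1 r23 t) auto
    finally have *: "(LINT v:{0<..}|lborel. (1 - exp (- (v * t))) * \<rho> v) = (LINT v:{0<..}|lborel. \<rho> v) - ((LINT v:{0<..\<delta>}|lborel. exp (- (v * t)) * \<rho> v) + (LINT v:{\<delta><..}|lborel. exp (- (v * t)) * \<rho> v))" .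
    have "(LINT v:{0<..}|lborel. (1 - exp (- (v * t))) * (g v / v)) =
     (LINT v:{0<..1}|lborel. (1 - exp (- (v * t))) / v) + (LINT v:{0<..1}|lborel. (1 - exp (- (v * t))) * (P v / v))
      + (LINT v:{0<..}|lborel. (1 - exp (- (v * t))) * \<rho> v)"
      unfolding set_lebesgue_integral_def split using i1[OF t] i2[OF t] i3[OF t]
      by (simp only: Bochner_Integration.integral_add Bochner_Integration.integrable_add)
    then show ?thesis unfolding * by simp
  qed
  have near0: "(\<lambda>t. LINT v:{0<..\<delta>}|lborel. exp (- (v * t)) * \<rho> v) \<in> O[at_top](\<lambda>t. (ln t / t) ^ Suc N)"
  proof (rule landau_o.big_trans[OF _ laplace_unit_bigo[of "Suc N" N]])
    show "(\<lambda>t. LINT v:{0<..\<delta>}|lborel. exp (- (v * t)) * \<rho> v) \<in> O[at_top](\<lambda>t. LINT v:{0<..1}|lborel. exp (- (v * t)) * v ^ N * ln v ^ Suc N)"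
    proof (rule bigoI[of _ K], rule eventually_mono[OF eventually_gt_at_top[of 0]])
      fix t :: real assume t: "0 < t"
      have i: "integrable lborel (\<lambda>v. K * ((- 1) ^ Suc N * (indicator {0<..1} v *\<^sub>R (exp (- (v * t)) * v ^ N * ln v ^ Suc N))))"
      proof (intro integrable_mult_right)
        have "set_integrable lborel {0<..1} (\<lambda>v. exp (- (v * t)) * (v ^ (Suc N - 1) * ln v ^ Suc N))"
          by (rule set_integrable_exp_mult(1)[OF set_integrable_unit_log_monomial]) (use t in auto)
        then show "integrable lborel (\<lambda>v. indicator {0<..1} v *\<^sub>R (exp (- (v * t)) * v ^ N * ln v ^ Suc N))"
          by (simp only: set_integrable_def diff_Suc_1 mult.assoc)
      qed
      have "norm (LINT v:{0<..\<delta>}|lborel. exp (- (v * t)) * \<rho> v) \<le> (LINT v|lborel. K * ((- 1) ^ Suc N * (indicator {0<..1} v *\<^sub>R (exp (- (v * t)) * v ^ N * ln v ^ Suc N))))"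
        unfolding set_lebesgue_integral_def
      proof (rule Bochner_Integration.integral_norm_bound_integral[OF _ i])
        show "integrable lborel (\<lambda>v. indicator {0<..\<delta>} v *\<^sub>R (exp (- (v * t)) * \<rho> v))"
          unfolding set_integrable_def[symmetric] by (rule set_integrable_exp_mult(1)[OF r1]) (use t in auto)
        fix v :: real
        \<comment> \<open>Replacing \<open>|ln v|\<close> by \<open>- ln v\<close> makes the majorant a multiple of the integrand of the comparison
          integral, without absolute values.\<close>
        have nn: "(- 1) ^ Suc N * ln v ^ Suc N = \<bar>ln v ^ Suc N\<bar>" if "0 < v" "v \<le> 1"
        proof -
          have "(- 1) ^ Suc N * ln v ^ Suc N = (- ln v) ^ Suc N" by (simp only: power_mult_distrib[symmetric] mult_minus1)
          also have "- ln v = \<bar>ln v\<bar>" using that by simp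
          finally show ?thesis by (simp only: power_abs)
        qed
        show "norm (indicator {0<..\<delta>} v *\<^sub>R (exp (- (v * t)) * \<rho> v)) \<le> K * ((- 1) ^ Suc N * (indicator {0<..1} v *\<^sub>R (exp (- (v * t)) * v ^ N * ln v ^ Suc N)))"
        proof (cases "0 < v \<and> v \<le> 1")
          case True
          have e: "K * ((- 1) ^ Suc N * (exp (- (v * t)) * v ^ N * ln v ^ Suc N)) = exp (- (v * t)) * (K * \<bar>v ^ N * ln v ^ Suc N\<bar>)"
          proof -
            have "K * ((- 1) ^ Suc N * (exp (- (v * t)) * v ^ N * ln v ^ Suc N)) = K * exp (- (v * t)) * v ^ N * ((- 1) ^ Suc N * ln v ^ Suc N)"
              by (simp only: mult_ac)
            also have "\<dots> = exp (- (v * t)) * (K * (\<bar>v ^ N\<bar> * \<bar>ln v ^ Suc N\<bar>))"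
              using nn True by (simp only: abs_of_nonneg zero_le_power less_imp_le mult_ac)
            finally show ?thesis by (simp only: abs_mult)
          qed
          show ?thesis
          proof (cases "v \<le> \<delta>")
            case True
            have "exp (- (v * t)) * \<bar>\<rho> v\<bar> \<le> exp (- (v * t)) * (K * \<bar>v ^ N * ln v ^ Suc N\<bar>)"
              using rho_near[of v] True \<open>0 < v \<and> v \<le> 1\<close> by (intro mult_left_mono) auto
            moreover have n1: "norm (indicator {0<..\<delta>} v *\<^sub>R (exp (- (v * t)) * \<rho> v)) = exp (- (v * t)) * \<bar>\<rho> v\<bar>"
              using True \<open>0 < v \<and> v \<le> 1\<close> by (simp add: abs_mult)
            moreover have n2: "indicator {0<..1} v *\<^sub>R (exp (- (v * t)) * v ^ N * ln v ^ Suc N) = exp (- (v * t)) * v ^ N * ln v ^ Suc N"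
              using \<open>0 < v \<and> v \<le> 1\<close> by simp
            ultimately show ?thesis unfolding n1 n2 e by argo
          next
            case False
            have "0 \<le> exp (- (v * t)) * (K * \<bar>v ^ N * ln v ^ Suc N\<bar>)" using K(1) by simp
            moreover have n2: "indicator {0<..1} v *\<^sub>R (exp (- (v * t)) * v ^ N * ln v ^ Suc N) = exp (- (v * t)) * v ^ N * ln v ^ Suc N"
              using True by simp
            moreover have n1: "norm (indicator {0<..\<delta>} v *\<^sub>R (exp (- (v * t)) * \<rho> v)) = 0" using False by simp
            ultimately show ?thesis unfolding n1 n2 e by argo
          qed
        qed (use d in \<open>auto simp: indicator_def\<close>)
      qed
      also have "\<dots> = K * ((- 1) ^ Suc N * (LINT v:{0<..1}|lborel. exp (- (v * t)) * v ^ N * ln v ^ Suc N))"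
        by (simp only: integral_mult_right_zero set_lebesgue_integral_def)
      also have "\<dots> \<le> K * norm (LINT v:{0<..1}|lborel. exp (- (v * t)) * v ^ N * ln v ^ Suc N)"
      proof (rule mult_left_mono)
        show "(- 1) ^ Suc N * x \<le> norm x" for x :: real
          by (cases "even (Suc N)") (auto simp: minus_one_power_iff)
      qed (use K in simp)
      finally show "norm (LINT v:{0<..\<delta>}|lborel. exp (- (v * t)) * \<rho> v) \<le> K * norm (LINT v:{0<..1}|lborel. exp (- (v * t)) * v ^ N * ln v ^ Suc N)" .
    qed
  qed simp
  have far: "(\<lambda>t. LINT v:{\<delta><..}|lborel. exp (- (v * t)) * \<rho> v) \<in> O[at_top](\<lambda>t. (ln t / t) ^ Suc N)"
  proof (rule laplace_tail_bigo[where \<delta> = \<delta>])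
    show "set_integrable lborel {\<delta><..} (\<lambda>v. exp (- v) * \<rho> v)"
      using set_integrable_exp_mult(1)[OF r23, of 1] d by auto
  qed (use d in auto)
  have "tail_expansion N (\<lambda>t. ((LINT v:{0<..1}|lborel. (1 - exp (- (v * t))) / v) - ln t) + (LINT v:{0<..1}|lborel. (1 - exp (- (v * t))) * (P v / v))
      + ((LINT v:{0<..}|lborel. \<rho> v) + - ((LINT v:{0<..\<delta>}|lborel. exp (- (v * t)) * \<rho> v) + (LINT v:{\<delta><..}|lborel. exp (- (v * t)) * \<rho> v))))"
    by (intro tail_expansion_add tail_expansion_const log_integral_expansion(2) conjunct2[OF LP] tail_expansion_bigo)
       (use sum_in_bigo(1)[OF near0 far] in \<open>simp only: landau_o.big.uminus_in_iff\<close>)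
  then show ?B
  proof (rule tail_expansion_eventually, intro eventually_mono[OF eventually_ge_at_top[of 0]])
    fix t :: real assume t: "0 \<le> t"
    show "(LINT v:{0<..1}|lborel. (1 - exp (- (v * t))) / v) - ln t + (LINT v:{0<..1}|lborel. (1 - exp (- (v * t))) * (P v / v))
      + ((LINT v:{0<..}|lborel. \<rho> v) + - ((LINT v:{0<..\<delta>}|lborel. exp (- (v * t)) * \<rho> v) + (LINT v:{\<delta><..}|lborel. exp (- (v * t)) * \<rho> v)))
      = (LINT v:{0<..}|lborel. (1 - exp (- (v * t))) * (g v / v)) - ln t"
      using sum[OF t] by argo
  qed
qed

section \<open>The heat kernel martingale stopped at a ball\<close>

definition gauss :: "real \<Rightarrow> 'a::euclidean_space \<Rightarrow> real" where
  "gauss t z = (\<Prod>b\<in>Basis. normal_density 0 (sqrt t) (z \<bullet> b))"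

text \<open>
  The kernel as a function of the distance, with the dimension as an explicit number: stopping on a
  sphere leaves only the distance.
\<close>

definition radial_gauss :: "nat \<Rightarrow> real \<Rightarrow> real \<Rightarrow> real" where
  "radial_gauss d t \<rho> = exp (- (\<rho>\<^sup>2 / (2 * t))) / sqrt (2 * pi * t) ^ d"

lemma gauss_radial:
  fixes z :: "'a::euclidean_space"
  assumes "t > 0"
  shows "gauss t z = radial_gauss DIM('a) t (norm z)"
proof -
  have "gauss t z = (\<Prod>b\<in>(Basis::'a set). 1 / sqrt (2 * pi * t)) * (\<Prod>b\<in>Basis. exp (- (z \<bullet> b)\<^sup>2 / (2 * t)))"
    unfolding gauss_def normal_density_def prod.distrib[symmetric] using assms by simp
  also have "(\<Prod>b\<in>Basis. exp (- (z \<bullet> b)\<^sup>2 / (2 * t))) = exp (\<Sum>b\<in>Basis. - (z \<bullet> b)\<^sup>2 / (2 * t))"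
    by (simp add: exp_sum)
  also have "(\<Sum>b\<in>Basis. - (z \<bullet> b)\<^sup>2 / (2 * t)) = - ((norm z)\<^sup>2 / (2 * t))"
    unfolding power2_norm_eq_inner euclidean_inner[of z z]
    by (simp add: sum_divide_distrib sum_negf power2_eq_square)
  finally show ?thesis by (simp add: radial_gauss_def power_one_over)
qed

lemma gauss_nonneg: "gauss t z \<ge> 0"
  unfolding gauss_def by (intro prod_nonneg) (simp add: normal_density_nonneg)

lemma borel_measurable_gauss [measurable]: "gauss t \<in> borel_measurable borel"
  unfolding gauss_def[abs_def] by measurable

text \<open>
  The kernel is a product over the coordinates, so this reduces to the convolution of one-dimensional
  normal densities.
\<close>

lemma gauss_semigroup:
  fixes y :: "'a::euclidean_space"
  assumes "s > 0" "h > 0"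
  shows "(\<integral>\<^sup>+z. ennreal (gauss h z) * ennreal (gauss s (y + z)) \<partial>lborel) = ennreal (gauss (s + h) y)"
proof -
  have "(\<integral>\<^sup>+z. ennreal (gauss h z) * ennreal (gauss s (y + z)) \<partial>lborel) =
     (\<integral>\<^sup>+z. (\<Prod>b\<in>Basis. ennreal (normal_density 0 (sqrt s) (- (y \<bullet> b) - z \<bullet> b) * normal_density 0 (sqrt h) (z \<bullet> b))) \<partial>lborel)"
  proof (rule nn_integral_cong)
    fix z :: 'a
    have e: "normal_density 0 (sqrt s) ((y + z) \<bullet> b) = normal_density 0 (sqrt s) (- (y \<bullet> b) - z \<bullet> b)" for b
      by (simp add: normal_density_def inner_add_left power2_eq_square algebra_simps)
    have "ennreal (gauss h z) * ennreal (gauss s (y + z)) = ennreal (\<Prod>b\<in>Basis. normal_density 0 (sqrt s) ((y + z) \<bullet> b) * normal_density 0 (sqrt h) (z \<bullet> b))"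
      unfolding ennreal_mult[OF gauss_nonneg gauss_nonneg, symmetric] unfolding gauss_def prod.distrib
      by (simp only: mult.commute)
    also have "\<dots> = (\<Prod>b\<in>Basis. ennreal (normal_density 0 (sqrt s) (- (y \<bullet> b) - z \<bullet> b) * normal_density 0 (sqrt h) (z \<bullet> b)))"
      unfolding e by (subst prod_ennreal) (auto simp: normal_density_nonneg)
    finally show "ennreal (gauss h z) * ennreal (gauss s (y + z)) = \<dots>" .
  qed
  also have "\<dots> = (\<Prod>b\<in>(Basis::'a set). \<integral>\<^sup>+v. ennreal (normal_density 0 (sqrt s) (- (y \<bullet> b) - v) * normal_density 0 (sqrt h) v) \<partial>lborel)"
    by (rule nn_integral_lborel_prod) auto
  also have "\<dots> = (\<Prod>b\<in>(Basis::'a set). ennreal (normal_density 0 (sqrt (s + h)) (y \<bullet> b)))"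
  proof (rule prod.cong[OF refl])
    fix b :: 'a
    have "(\<integral>\<^sup>+v. ennreal (normal_density 0 (sqrt s) (- (y \<bullet> b) - v) * normal_density 0 (sqrt h) v) \<partial>lborel)
      = ennreal (normal_density 0 (sqrt ((sqrt s)\<^sup>2 + (sqrt h)\<^sup>2)) (- (y \<bullet> b)))"
      using fun_cong[OF conv_normal_density_zero_mean[of "sqrt s" "sqrt h"], of "- (y \<bullet> b)"] assms by simp
    then show "(\<integral>\<^sup>+v. ennreal (normal_density 0 (sqrt s) (- (y \<bullet> b) - v) * normal_density 0 (sqrt h) v) \<partial>lborel)
      = ennreal (normal_density 0 (sqrt (s + h)) (y \<bullet> b))"
      using assms by (simp add: normal_density_def)
  qed
  also have "\<dots> = ennreal (gauss (s + h) y)"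
    by (simp add: gauss_def prod_ennreal normal_density_nonneg)
  finally show ?thesis .
qed

context brownian_motion
begin

lemma increment_distr:
  assumes "0 \<le> s" "s < t"
  shows "distr M borel (\<lambda>\<omega>. B t \<omega> - B s \<omega>) = density lborel (\<lambda>z. ennreal (gauss (t - s) z))"
  using distributed_distr_eq_density[OF gaussian_increments[OF assms]]
  by (simp add: gauss_def cong: distr_cong)

text \<open>
  The next increment is independent of the past, in particular of the event that the ball has not been
  entered yet, and averaging \<open>gauss (t - s)\<close> over a Gaussian increment is the semigroup property.
\<close>

lemma martingale_step:
  assumes u0: "u 0 = 0" and mono: "\<And>i. i \<le> k \<Longrightarrow> u i < u (Suc i)" and t: "u (Suc k) < t"
  shows "(\<integral>\<^sup>+\<omega>. indicator {\<omega>. \<forall>j\<le>k. R \<le> norm (B (u j) \<omega>)} \<omega> * ennreal (gauss (t - u (Suc k)) (B (u (Suc k)) \<omega>)) \<partial>M)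
       = (\<integral>\<^sup>+\<omega>. indicator {\<omega>. \<forall>j\<le>k. R \<le> norm (B (u j) \<omega>)} \<omega> * ennreal (gauss (t - u k) (B (u k) \<omega>)) \<partial>M)"
proof -
  \<comment> \<open>The past is carried by the vector \<open>XA\<close> of the first \<open>k\<close> increments and the new increment by \<open>Y\<close>;
    \<open>S\<close> recovers the path from the increments and \<open>G\<close> is the event that it has stayed outside.\<close>
  define X where "X i \<omega> = B (u (Suc i)) \<omega> - B (u i) \<omega>" for i \<omega>
  define XA where "XA \<omega> = restrict (\<lambda>i. X i \<omega>) {..<k}" for \<omega>
  define S where "S f j = x + (\<Sum>i<j. f i)" for f :: "nat \<Rightarrow> 'a" and j
  define G :: "(nat \<Rightarrow> 'a) \<Rightarrow> ennreal" where "G f = indicator {f. \<forall>j\<in>{..k}. R \<le> norm (S f j)} f" for f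
  have upos: "0 \<le> u j" if "j \<le> Suc k" for j
    using that by (induction j) (use u0 mono in \<open>auto intro: order_trans less_imp_le\<close>)
  have Bm [measurable]: "B (u j) \<in> borel_measurable M" if "j \<le> Suc k" for j
    using measurable_at[OF upos[OF that]] .
  have indep: "indep_vars (\<lambda>_. borel) X {..<Suc k}"
    using independent_increments[of u "Suc k"] u0 mono by (simp add: X_def[abs_def])
  have iv: "indep_var (PiM {..<k} (\<lambda>_. borel)) XA (PiM {k} (\<lambda>_. borel)) (\<lambda>\<omega>. restrict (\<lambda>i. X i \<omega>) {k})"
    unfolding XA_def by (rule indep_var_restrict[OF indep]) auto
  have Xkm [measurable]: "X k \<in> borel_measurable M"
    unfolding X_def[abs_def] using Bm[of k] Bm[of "Suc k"] by (intro borel_measurable_diff) auto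
  define Y where "Y \<omega> = restrict (\<lambda>i. X i \<omega>) {k}" for \<omega>
  have proj [measurable]: "(\<lambda>f. f k) \<in> measurable (PiM {k} (\<lambda>_. borel)) (borel :: 'a measure)" by measurable
  have Yk: "Y \<omega> k = X k \<omega>" for \<omega> by (simp add: Y_def)
  note iv2 = iv[folded Y_def[abs_def]]
  note rvA = indep_var_rv1[OF iv2] and rvk = indep_var_rv2[OF iv2]
  note de = conjunct2[OF conjunct2[OF iffD1[OF indep_var_distribution_eq iv2]]]
  have comp: "(\<lambda>f. f i) \<in> measurable (PiM {..<k} (\<lambda>_. borel)) (borel :: 'a measure)" if "i < k" for i
    by (rule measurable_component_singleton) (use that in simp)
  have Sm: "(\<lambda>f. S f j) \<in> borel_measurable (PiM {..<k} (\<lambda>_. borel))" if "j \<le> k" for j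
    unfolding S_def using that by (intro borel_measurable_add borel_measurable_const borel_measurable_sum comp) auto
  have Gm: "(\<lambda>f. G f :: ennreal) \<in> borel_measurable (PiM {..<k} (\<lambda>_. borel))"
  proof -
    have "Measurable.pred (PiM {..<k} (\<lambda>_. borel)) (\<lambda>f. R \<le> norm (S f j))" if "j \<in> {..k}" for j
    proof -
      have [measurable]: "(\<lambda>f. S f j) \<in> borel_measurable (PiM {..<k} (\<lambda>_. borel))" using Sm that by simp
      show ?thesis by measurable
    qed
    then have "Measurable.pred (PiM {..<k} (\<lambda>_. borel)) (\<lambda>f. \<forall>j\<in>{..k}. R \<le> norm (S f j))"
      by (intro pred_intros_finite) auto
    then have "(\<lambda>f. indicator {f. \<forall>j\<in>{..k}. R \<le> norm (S f j)} f :: ennreal) \<in> borel_measurable (PiM {..<k} (\<lambda>_. borel))"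
      by (intro borel_measurable_indicator') (simp add: pred_def)
    then show ?thesis by (simp only: G_def)
  qed
  have S_X: "S (XA \<omega>) j = B (u j) \<omega>" if "B 0 \<omega> = x" "j \<le> k" for j \<omega>
  proof -
    have "(\<Sum>i<j. XA \<omega> i) = (\<Sum>i<j. B (u (Suc i)) \<omega> - B (u i) \<omega>)"
      using that by (intro sum.cong) (auto simp: XA_def X_def)
    also have "\<dots> = B (u j) \<omega> - B (u 0) \<omega>" by (rule sum_lessThan_telescope)
    finally show ?thesis using that by (simp add: S_def u0)
  qed
  have h: "u (Suc k) - u k > 0" "t - u (Suc k) > 0" using mono[of k] t by auto
  have "(\<integral>\<^sup>+\<omega>. indicator {\<omega>. \<forall>j\<le>k. R \<le> norm (B (u j) \<omega>)} \<omega> * ennreal (gauss (t - u (Suc k)) (B (u (Suc k)) \<omega>)) \<partial>M)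
     = (\<integral>\<^sup>+\<omega>. (\<lambda>(f, z). G f * ennreal (gauss (t - u (Suc k)) (S f k + z k))) (XA \<omega>, Y \<omega>) \<partial>M)"
    by (rule nn_integral_cong_AE, use starts_at in eventually_elim) (auto simp: G_def S_X X_def Yk indicator_def)
  also have "\<dots> = (\<integral>\<^sup>+p. (\<lambda>(f, z). G f * ennreal (gauss (t - u (Suc k)) (S f k + z k))) p \<partial>distr M (PiM {..<k} (\<lambda>_. borel) \<Otimes>\<^sub>M PiM {k} (\<lambda>_. borel)) (\<lambda>\<omega>. (XA \<omega>, Y \<omega>)))"
    using rvA rvk Gm Sm[of k] by (subst nn_integral_distr) (auto intro!: measurable_Pair)
  also have "\<dots> = (\<integral>\<^sup>+f. \<integral>\<^sup>+z. G f * ennreal (gauss (t - u (Suc k)) (S f k + z k)) \<partial>distr M (PiM {k} (\<lambda>_. borel)) Y \<partial>distr M (PiM {..<k} (\<lambda>_. borel)) XA)"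
  proof -
    interpret D: prob_space "distr M (PiM {k} (\<lambda>_. borel)) Y" by (rule prob_space_distr[OF rvk])
    show ?thesis unfolding de[symmetric]
      by (subst D.nn_integral_fst[symmetric]) (use Gm Sm[of k] in \<open>auto intro!: measurable_compose[OF _ borel_measurable_gauss]\<close>)
  qed
  also have "\<dots> = (\<integral>\<^sup>+f. G f * ennreal (gauss (t - u k) (S f k)) \<partial>distr M (PiM {..<k} (\<lambda>_. borel)) XA)"
  proof (rule nn_integral_cong)
    fix f
    have "(\<integral>\<^sup>+z. G f * ennreal (gauss (t - u (Suc k)) (S f k + z k)) \<partial>distr M (PiM {k} (\<lambda>_. borel)) Y)
       = G f * (\<integral>\<^sup>+z. ennreal (gauss (t - u (Suc k)) (S f k + z k)) \<partial>distr M (PiM {k} (\<lambda>_. borel)) Y)"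
      by (rule nn_integral_cmult) measurable
    also have "(\<integral>\<^sup>+z. ennreal (gauss (t - u (Suc k)) (S f k + z k)) \<partial>distr M (PiM {k} (\<lambda>_. borel)) Y)
       = (\<integral>\<^sup>+\<omega>. ennreal (gauss (t - u (Suc k)) (S f k + X k \<omega>)) \<partial>M)"
      by (subst nn_integral_distr[OF rvk]) (simp_all add: Yk)
    also have "\<dots> = (\<integral>\<^sup>+z. ennreal (gauss (t - u (Suc k)) (S f k + z)) \<partial>distr M borel (X k))"
      by (subst nn_integral_distr[OF Xkm]) simp_all
    also have "distr M borel (X k) = density lborel (\<lambda>z. ennreal (gauss (u (Suc k) - u k) z))"
      unfolding X_def[abs_def] by (rule increment_distr) (use upos[of k] mono[of k] in auto)
    also have "(\<integral>\<^sup>+z. ennreal (gauss (t - u (Suc k)) (S f k + z)) \<partial>density lborel (\<lambda>z. ennreal (gauss (u (Suc k) - u k) z)))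
       = ennreal (gauss (t - u (Suc k) + (u (Suc k) - u k)) (S f k))"
      by (subst nn_integral_density) (auto simp: gauss_semigroup[OF h(2,1)])
    finally show "(\<integral>\<^sup>+z. G f * ennreal (gauss (t - u (Suc k)) (S f k + z k)) \<partial>distr M (PiM {k} (\<lambda>_. borel)) Y) = G f * ennreal (gauss (t - u k) (S f k))"
      by simp
  qed
  also have "\<dots> = (\<integral>\<^sup>+\<omega>. G (XA \<omega>) * ennreal (gauss (t - u k) (S (XA \<omega>) k)) \<partial>M)"
    using rvA Gm Sm[of k] by (subst nn_integral_distr) auto
  also have "\<dots> = (\<integral>\<^sup>+\<omega>. indicator {\<omega>. \<forall>j\<le>k. R \<le> norm (B (u j) \<omega>)} \<omega> * ennreal (gauss (t - u k) (B (u k) \<omega>)) \<partial>M)"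
    by (rule nn_integral_cong_AE, use starts_at in eventually_elim) (auto simp: G_def S_X indicator_def)
  finally show ?thesis .
qed

end

text \<open>
  The martingale on the time grid \<open>u\<close>, stopped at the first grid point at which the path is in the open
  ball of radius \<open>R\<close>, or at index \<open>k\<close> if there is none.
\<close>

primrec stopped_gauss ::
  "(real \<Rightarrow> 'w \<Rightarrow> 'a::euclidean_space) \<Rightarrow> (nat \<Rightarrow> real) \<Rightarrow> real \<Rightarrow> real \<Rightarrow> nat \<Rightarrow> 'w \<Rightarrow> real" where
  "stopped_gauss B u R t 0 \<omega> = gauss (t - u 0) (B (u 0) \<omega>)"
| "stopped_gauss B u R t (Suc k) \<omega> =
    (if \<forall>j\<le>k. R \<le> norm (B (u j) \<omega>) then gauss (t - u (Suc k)) (B (u (Suc k)) \<omega>) else stopped_gauss B u R t k \<omega>)"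

lemma stopped_gauss_running:
  assumes "\<forall>j<k. R \<le> norm (B (u j) \<omega>)"
  shows "stopped_gauss B u R t k \<omega> = gauss (t - u k) (B (u k) \<omega>)"
  using assms by (cases k) auto

lemma stopped_gauss_nonneg: "stopped_gauss B u R t k \<omega> \<ge> 0"
  by (induction k) (auto simp: gauss_nonneg)

lemma stopped_gauss_index:
  "\<exists>j\<le>k. stopped_gauss B u R t k \<omega> = gauss (t - u j) (B (u j) \<omega>) \<and>
     (\<forall>i<j. R \<le> norm (B (u i) \<omega>)) \<and> (j < k \<longrightarrow> norm (B (u j) \<omega>) < R)"
proof (induction k)
  case (Suc k)
  then obtain j where j: "j \<le> k" "stopped_gauss B u R t k \<omega> = gauss (t - u j) (B (u j) \<omega>)"
     "\<forall>i<j. R \<le> norm (B (u i) \<omega>)" "j < k \<longrightarrow> norm (B (u j) \<omega>) < R" by blast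
  show ?case
  proof (cases "\<forall>i\<le>k. R \<le> norm (B (u i) \<omega>)")
    case True
    then show ?thesis by (intro exI[of _ "Suc k"]) auto
  next
    case False
    then obtain i where i: "i \<le> k" "norm (B (u i) \<omega>) < R" by force
    have "\<not> i < j" using j(3) i(2) by force
    then have "j < k \<or> i = j" using j(1) i(1) by linarith
    then have "norm (B (u j) \<omega>) < R" using j i by auto
    then show ?thesis using j False by (intro exI[of _ j]) auto
  qed
qed auto

text \<open>
  The entry time of an open ball, capped at \<open>T\<close>. An open ball is used because continuity makes the path
  stay in it for a while after entering, so that fine grids notice the entry; the closed ball is reached
  by letting \<open>R\<close> decrease to \<open>r\<close>. The cap \<open>T < t\<close> keeps the kernel away from its singularity.
\<close>

definition ball_entry :: "(real \<Rightarrow> 'a::real_normed_vector) \<Rightarrow> real \<Rightarrow> real \<Rightarrow> real" where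
  "ball_entry b R T = Inf (insert T {s. 0 \<le> s \<and> s \<le> T \<and> norm (b s) < R})"

lemma ball_entry_bounds:
  assumes "T \<ge> 0"
  shows "0 \<le> ball_entry b R T" "ball_entry b R T \<le> T"
    "0 \<le> s \<Longrightarrow> s \<le> T \<Longrightarrow> norm (b s) < R \<Longrightarrow> ball_entry b R T \<le> s"
proof -
  have bdd: "bdd_below (insert T {s. 0 \<le> s \<and> s \<le> T \<and> norm (b s) < R})"
    by (rule bdd_belowI[of _ 0]) (use assms in auto)
  show "0 \<le> ball_entry b R T" unfolding ball_entry_def using assms by (intro cInf_greatest) auto
  show "ball_entry b R T \<le> T" unfolding ball_entry_def by (intro cInf_lower bdd) auto
  show "0 \<le> s \<Longrightarrow> s \<le> T \<Longrightarrow> norm (b s) < R \<Longrightarrow> ball_entry b R T \<le> s"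
    unfolding ball_entry_def by (intro cInf_lower bdd) auto
qed

lemma ball_entry_ge:
  assumes "c \<le> T" "\<And>s. 0 \<le> s \<Longrightarrow> s \<le> T \<Longrightarrow> norm (b s) < R \<Longrightarrow> c \<le> s"
  shows "c \<le> ball_entry b R T"
  unfolding ball_entry_def using assms by (intro cInf_greatest) auto

lemma continuous_norm_less_nbhd:
  fixes b :: "real \<Rightarrow> 'a::real_normed_vector"
  assumes "continuous_on {0..} b" "0 \<le> s" "norm (b s) < R"
  obtains \<eta> where "\<eta> > 0" "\<And>s'. 0 \<le> s' \<Longrightarrow> \<bar>s' - s\<bar> < \<eta> \<Longrightarrow> norm (b s') < R"
proof -
  have "continuous_on {0..} (\<lambda>s. norm (b s))" using assms(1) by (intro continuous_intros)
  then obtain d where d: "d > 0" "\<And>s'. s' \<in> {0..} \<Longrightarrow> dist s' s < d \<Longrightarrow> dist (norm (b s')) (norm (b s)) < R - norm (b s)"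
    unfolding continuous_on_iff using assms(2,3) by (metis atLeast_iff diff_gt_0_iff_gt)
  show ?thesis
  proof (rule that[OF d(1)])
    fix s' :: real assume "0 \<le> s'" "\<bar>s' - s\<bar> < d"
    then have "dist (norm (b s')) (norm (b s)) < R - norm (b s)" by (intro d(2)) (auto simp: dist_real_def)
    then show "norm (b s') < R" by (simp add: dist_real_def)
  qed
qed

text \<open>
  A grid never notices the entry too early. If the path is in the ball at a time \<open>s\<close>, it is there
  during a neighbourhood of \<open>s\<close>, and the largest grid point below \<open>s\<close> lies in it once the mesh is small.
\<close>

lemma grid_entry_tendsto:
  fixes b :: "real \<Rightarrow> 'a::real_normed_vector"
  assumes cont: "continuous_on {0..} b" and T: "T > 0"
    and j: "\<And>n. j n \<le> Suc n" "\<And>n i. i < j n \<Longrightarrow> R \<le> norm (b (real i * T / real (Suc n)))"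
      "\<And>n. j n < Suc n \<Longrightarrow> norm (b (real (j n) * T / real (Suc n))) < R"
  shows "(\<lambda>n. real (j n) * T / real (Suc n)) \<longlonglongrightarrow> ball_entry b R T"
proof -
  define \<sigma> where "\<sigma> = ball_entry b R T"
  define g where "g n = real (j n) * T / real (Suc n)" for n
  have gT: "0 \<le> g n" "g n \<le> T" for n
  proof -
    show "0 \<le> g n" using T by (simp add: g_def)
    have "real (j n) * T \<le> real (Suc n) * T" using j(1)[of n] T by (intro mult_right_mono) auto
    then show "g n \<le> T" by (simp add: g_def pos_divide_le_eq mult.commute)
  qed
  have lower: "\<sigma> \<le> g n" for n
  proof (cases "j n < Suc n")
    case True
    then show ?thesis unfolding \<sigma>_def using gT[of n] j(3)[of n] T
      by (intro ball_entry_bounds) (auto simp: g_def)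
  next
    case False
    then have "g n = T" using j(1)[of n] by (simp add: g_def)
    then show ?thesis using ball_entry_bounds(2)[of T b R] T by (simp add: \<sigma>_def)
  qed
  have upper: "\<forall>\<^sub>F n in sequentially. g n < \<sigma> + e" if e: "e > 0" for e
  proof -
    obtain s where s: "s = T \<or> (0 \<le> s \<and> s \<le> T \<and> norm (b s) < R)" "s < \<sigma> + e"
      using cInf_lessD[of "insert T {s. 0 \<le> s \<and> s \<le> T \<and> norm (b s) < R}" "\<sigma> + e"] e
      by (auto simp: \<sigma>_def ball_entry_def)
    show ?thesis
    proof (cases "s = T")
      case True
      then have "g n < \<sigma> + e" for n using gT(2)[of n] s(2) by linarith
      then show ?thesis by simp
    next
      case False
      then have s': "0 \<le> s" "s \<le> T" "norm (b s) < R" using s(1) by auto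
      obtain \<eta> where eta: "\<eta> > 0" "\<And>s'. 0 \<le> s' \<Longrightarrow> \<bar>s' - s\<bar> < \<eta> \<Longrightarrow> norm (b s') < R"
        using continuous_norm_less_nbhd[OF cont s'(1,3)] by blast
      have "(\<lambda>n. T / real (Suc n)) \<longlonglongrightarrow> 0" using LIMSEQ_Suc[OF lim_const_over_n[of T]] .
      then have "\<forall>\<^sub>F n in sequentially. T / real (Suc n) < \<eta>" using eta(1) by (rule order_tendstoD(2))
      then show ?thesis
      proof eventually_elim
        case (elim n)
        define i where "i = nat \<lfloor>s * real (Suc n) / T\<rfloor>"
        have q0: "0 \<le> s * real (Suc n) / T" using s' T by simp
        have i1: "real i \<le> s * real (Suc n) / T" "s * real (Suc n) / T < real i + 1"
          using q0 unfolding i_def by linarith+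
        have a1: "real i * T / real (Suc n) \<le> s" using i1(1) T by (simp add: field_simps)
        have "s < (real i + 1) * T / real (Suc n)" using i1(2) T by (simp add: field_simps)
        then have a2: "s < real i * T / real (Suc n) + T / real (Suc n)" by (simp add: add_divide_distrib distrib_right)
        have "norm (b (real i * T / real (Suc n))) < R"
          by (rule eta(2)) (use a1 a2 elim T in auto)
        then have "\<not> i < j n" using j(2)[of i n] by force
        then have "real (j n) * T / real (Suc n) \<le> real i * T / real (Suc n)"
          using T by (intro divide_right_mono mult_right_mono) auto
        then show ?case using a1 s(2) by (simp add: g_def)
      qed
    qed
  qed
  have "g \<longlonglongrightarrow> \<sigma>"
  proof (rule tendstoI)
    fix e :: real assume "e > 0"
    from upper[OF this] show "\<forall>\<^sub>F n in sequentially. dist (g n) \<sigma> < e"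
      by eventually_elim (use lower in \<open>auto simp: dist_real_def abs_less_iff intro: le_less_trans\<close>)
  qed
  then show ?thesis unfolding g_def[abs_def] \<sigma>_def .
qed

lemma gauss_path_tendsto:
  fixes b :: "real \<Rightarrow> 'a::euclidean_space"
  assumes cont: "continuous_on {0..} b" and s: "s \<longlonglongrightarrow> \<sigma>" "\<And>n. 0 \<le> s n" "\<And>n. s n < t" "\<sigma> < t"
  shows "(\<lambda>n. gauss (t - s n) (b (s n))) \<longlonglongrightarrow> gauss (t - \<sigma>) (b \<sigma>)"
proof -
  have sig: "0 \<le> \<sigma>" using s(1,2) by (intro LIMSEQ_le_const) auto
  have "(\<lambda>n. b (s n)) \<longlonglongrightarrow> b \<sigma>"
    using continuous_on_tendsto_compose[OF cont s(1)] sig s(2) by auto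
  then have "(\<lambda>n. radial_gauss DIM('a) (t - s n) (norm (b (s n)))) \<longlonglongrightarrow> radial_gauss DIM('a) (t - \<sigma>) (norm (b \<sigma>))"
    unfolding radial_gauss_def using s by (intro tendsto_intros) auto
  then show ?thesis using s by (simp add: gauss_radial)
qed

lemma radial_gauss_mono:
  assumes "t > 0" "0 \<le> \<rho>" "\<rho> \<le> \<rho>'"
  shows "radial_gauss d t \<rho>' \<le> radial_gauss d t \<rho>"
  unfolding radial_gauss_def using assms
  by (intro divide_right_mono) (auto intro!: divide_right_mono power_mono)

lemma gauss_le:
  fixes z :: "'a::euclidean_space"
  assumes "0 < c" "c \<le> t"
  shows "gauss t z \<le> 1 / sqrt (2 * pi * c) ^ DIM('a)"
proof -
  have "gauss t z \<le> radial_gauss DIM('a) t 0"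
    using assms by (simp add: gauss_radial radial_gauss_mono)
  also have "\<dots> \<le> 1 / sqrt (2 * pi * c) ^ DIM('a)"
    unfolding radial_gauss_def using assms by (auto intro!: divide_left_mono power_mono mult_pos_pos)
  finally show ?thesis .
qed

context brownian_motion
begin

lemma stopped_gauss_measurable:
  assumes "\<And>i. i \<le> k \<Longrightarrow> 0 \<le> u i"
  shows "stopped_gauss B u R t k \<in> borel_measurable M"
  using assms
proof (induction k)
  case 0
  have [measurable]: "B (u 0) \<in> borel_measurable M" by (rule measurable_at) (use 0 in auto)
  have "(\<lambda>\<omega>. gauss (t - u 0) (B (u 0) \<omega>)) \<in> borel_measurable M" by measurable
  then show ?case by (simp cong: measurable_cong)
next
  case (Suc k)
  have Bm: "B (u j) \<in> borel_measurable M" if "j \<le> Suc k" for j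
    by (rule measurable_at) (use Suc that in auto)
  have [measurable]: "stopped_gauss B u R t k \<in> borel_measurable M" using Suc by auto
  have [measurable]: "B (u (Suc k)) \<in> borel_measurable M" by (rule Bm) simp
  have [measurable]: "Measurable.pred M (\<lambda>\<omega>. \<forall>j\<in>{..k}. R \<le> norm (B (u j) \<omega>))"
  proof (intro pred_intros_finite)
    fix j assume "j \<in> {..k}"
    then have [measurable]: "B (u j) \<in> borel_measurable M" by (intro Bm) auto
    show "Measurable.pred M (\<lambda>\<omega>. R \<le> norm (B (u j) \<omega>))" by measurable
  qed simp
  have "(\<lambda>\<omega>. if \<forall>j\<in>{..k}. R \<le> norm (B (u j) \<omega>) then gauss (t - u (Suc k)) (B (u (Suc k)) \<omega>) else stopped_gauss B u R t k \<omega>) \<in> borel_measurable M"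
    by measurable
  also have "(\<lambda>\<omega>. if \<forall>j\<in>{..k}. R \<le> norm (B (u j) \<omega>) then gauss (t - u (Suc k)) (B (u (Suc k)) \<omega>) else stopped_gauss B u R t k \<omega>) = stopped_gauss B u R t (Suc k)"
    by (auto simp: fun_eq_iff)
  finally show ?case .
qed

text \<open>
  Raising the index by one only changes the value on the event that the path has stayed outside, and
  there \<open>martingale_step\<close> applies.
\<close>

lemma stopped_gauss_nn_integral:
  assumes u0: "u 0 = 0" and mono: "\<And>i. i < n \<Longrightarrow> u i < u (Suc i)" and t: "u n < t"
  shows "k \<le> n \<Longrightarrow> (\<integral>\<^sup>+\<omega>. ennreal (stopped_gauss B u R t k \<omega>) \<partial>M) = ennreal (gauss t x)"
proof (induction k)
  case 0
  have "(\<integral>\<^sup>+\<omega>. ennreal (stopped_gauss B u R t 0 \<omega>) \<partial>M) = (\<integral>\<^sup>+\<omega>. ennreal (gauss t x) \<partial>M)"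
    by (rule nn_integral_cong_AE, use starts_at in eventually_elim) (simp add: u0)
  then show ?case by (simp add: emeasure_space_1)
next
  case (Suc k)
  have un: "u i \<le> u j" if "i \<le> j" "j \<le> n" for i j
    using that(1,2) by (induction rule: dec_induct) (auto intro: order_trans[OF _ less_imp_le[OF mono]])
  have upos: "0 \<le> u i" if "i \<le> n" for i using un[of 0 i] that u0 by simp
  let ?A = "{\<omega>. \<forall>j\<le>k. R \<le> norm (B (u j) \<omega>)}"
  let ?N = "\<lambda>j \<omega>. ennreal (gauss (t - u j) (B (u j) \<omega>))"
  let ?V = "\<lambda>k \<omega>. ennreal (stopped_gauss B u R t k \<omega>)"
  have Bm: "B (u j) \<in> borel_measurable M" if "j \<le> Suc k" for j
    by (rule measurable_at) (use Suc that upos in auto)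
  have [measurable]: "B (u k) \<in> borel_measurable M" "B (u (Suc k)) \<in> borel_measurable M" by (rule Bm, simp)+
  have [measurable]: "stopped_gauss B u R t k \<in> borel_measurable M"
    by (rule stopped_gauss_measurable) (use Suc upos in auto)
  have A1: "Measurable.pred M (\<lambda>\<omega>. \<forall>j\<in>{..k}. R \<le> norm (B (u j) \<omega>))"
  proof (intro pred_intros_finite)
    fix j assume "j \<in> {..k}"
    then have [measurable]: "B (u j) \<in> borel_measurable M" by (intro Bm) auto
    show "Measurable.pred M (\<lambda>\<omega>. R \<le> norm (B (u j) \<omega>))" by measurable
  qed simp
  have A2: "{\<omega>. \<forall>j\<in>{..k}. R \<le> norm (B (u j) \<omega>)} = ?A" by auto
  have A: "Measurable.pred M (\<lambda>\<omega>. \<omega> \<in> ?A)"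
    unfolding A2[symmetric] mem_Collect_eq by (rule A1)
  have nA: "Measurable.pred M (\<lambda>\<omega>. \<omega> \<in> - ?A)"
    unfolding Compl_iff by (rule pred_intros_logic(2)[OF A])
  have Am: "(\<lambda>\<omega>. indicator ?A \<omega> :: ennreal) \<in> borel_measurable M"
      "(\<lambda>\<omega>. indicator (- ?A) \<omega> :: ennreal) \<in> borel_measurable M"
    using A nA by (auto intro!: borel_measurable_indicator' simp only: pred_def)
  have "(\<integral>\<^sup>+\<omega>. ?V (Suc k) \<omega> \<partial>M) = (\<integral>\<^sup>+\<omega>. indicator ?A \<omega> * ?N (Suc k) \<omega> + indicator (- ?A) \<omega> * ?V k \<omega> \<partial>M)"
    by (intro nn_integral_cong) (auto simp: indicator_def)
  also have "\<dots> = (\<integral>\<^sup>+\<omega>. indicator ?A \<omega> * ?N (Suc k) \<omega> \<partial>M) + (\<integral>\<^sup>+\<omega>. indicator (- ?A) \<omega> * ?V k \<omega> \<partial>M)"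
    by (intro nn_integral_add borel_measurable_times_ennreal Am) measurable
  also have "(\<integral>\<^sup>+\<omega>. indicator ?A \<omega> * ?N (Suc k) \<omega> \<partial>M) = (\<integral>\<^sup>+\<omega>. indicator ?A \<omega> * ?N k \<omega> \<partial>M)"
    by (rule martingale_step[where u = u, OF u0]) (use Suc mono un[of "Suc k" n] t in auto)
  also have "\<dots> + (\<integral>\<^sup>+\<omega>. indicator (- ?A) \<omega> * ?V k \<omega> \<partial>M) = (\<integral>\<^sup>+\<omega>. indicator ?A \<omega> * ?N k \<omega> + indicator (- ?A) \<omega> * ?V k \<omega> \<partial>M)"
    by (intro nn_integral_add[symmetric] borel_measurable_times_ennreal Am) measurable
  also have "\<dots> = (\<integral>\<^sup>+\<omega>. ?V k \<omega> \<partial>M)"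
    by (intro nn_integral_cong) (auto simp: indicator_def stopped_gauss_running)
  finally show ?case using Suc by simp
qed

text \<open>
  The grids become finer with \<open>T\<close> fixed; the kernels stay below the constant \<open>K\<close>, since \<open>t - T\<close> remains
  as a lower bound for their time, and dominated convergence applies.
\<close>

lemma expectation_ball_entry:
  assumes T: "0 < T" "T < t"
  shows "(\<lambda>\<omega>. gauss (t - ball_entry (\<lambda>s. B s \<omega>) R T) (B (ball_entry (\<lambda>s. B s \<omega>) R T) \<omega>)) \<in> borel_measurable M" (is "?f \<in> _")
    "(LINT \<omega>|M. gauss (t - ball_entry (\<lambda>s. B s \<omega>) R T) (B (ball_entry (\<lambda>s. B s \<omega>) R T) \<omega>)) = gauss t x"
proof -
  define u where "u n i = real i * T / real (Suc n)" for n i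
  define V where "V n = stopped_gauss B (u n) R t (Suc n)" for n
  have u: "u n 0 = 0" "u n i < u n (Suc i)" "u n (Suc n) = T" "0 \<le> u n i" for n i
    using T by (auto simp: u_def divide_strict_right_mono)
  have uT: "u n j \<le> T" if "j \<le> Suc n" for n j
  proof -
    have "real j * T \<le> real (Suc n) * T" using that T by (intro mult_right_mono) auto
    then show ?thesis by (simp add: u_def pos_divide_le_eq mult.commute)
  qed
  have Vm: "V n \<in> borel_measurable M" for n
    unfolding V_def by (rule stopped_gauss_measurable) (rule u)
  have lim: "(\<lambda>n. V n \<omega>) \<longlonglongrightarrow> ?f \<omega>" if w: "\<omega> \<in> space M" for \<omega>
  proof -
    have "\<forall>n. \<exists>j. j \<le> Suc n \<and> V n \<omega> = gauss (t - u n j) (B (u n j) \<omega>) \<and>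
      (\<forall>i<j. R \<le> norm (B (u n i) \<omega>)) \<and> (j < Suc n \<longrightarrow> norm (B (u n j) \<omega>) < R)"
      using stopped_gauss_index[of "Suc _" B "u _" R t \<omega>] unfolding V_def by blast
    then obtain j where jj: "\<forall>n. j n \<le> Suc n \<and> V n \<omega> = gauss (t - u n (j n)) (B (u n (j n)) \<omega>) \<and>
      (\<forall>i<j n. R \<le> norm (B (u n i) \<omega>)) \<and> (j n < Suc n \<longrightarrow> norm (B (u n (j n)) \<omega>) < R)"
      using choice[of "\<lambda>n j. j \<le> Suc n \<and> V n \<omega> = gauss (t - u n j) (B (u n j) \<omega>) \<and>
      (\<forall>i<j. R \<le> norm (B (u n i) \<omega>)) \<and> (j < Suc n \<longrightarrow> norm (B (u n j) \<omega>) < R)"] by blast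
    then have j: "\<And>n. j n \<le> Suc n" "\<And>n. V n \<omega> = gauss (t - u n (j n)) (B (u n (j n)) \<omega>)"
      "\<And>n i. i < j n \<Longrightarrow> R \<le> norm (B (u n i) \<omega>)" "\<And>n. j n < Suc n \<Longrightarrow> norm (B (u n (j n)) \<omega>) < R"
      by blast+
    have "(\<lambda>n. u n (j n)) \<longlonglongrightarrow> ball_entry (\<lambda>s. B s \<omega>) R T"
      unfolding u_def
      by (rule grid_entry_tendsto[OF continuous_paths[OF w] T(1)]) (use j in \<open>auto simp: u_def\<close>)
    then show ?thesis unfolding j(2)
      using u(4) uT[OF j(1)] ball_entry_bounds(2)[of T "\<lambda>s. B s \<omega>" R] T
      by (intro gauss_path_tendsto[OF continuous_paths[OF w]]) (auto intro: le_less_trans)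
  qed
  show fm: "?f \<in> borel_measurable M"
    by (rule borel_measurable_LIMSEQ_real[OF lim Vm])
  define K where "K = 1 / sqrt (2 * pi * (t - T)) ^ DIM('a)"
  have VK: "\<bar>V n \<omega>\<bar> \<le> K" for n \<omega>
  proof -
    obtain j where j: "j \<le> Suc n" "V n \<omega> = gauss (t - u n j) (B (u n j) \<omega>)"
      using stopped_gauss_index[of "Suc n" B "u n" R t \<omega>] unfolding V_def by auto
    then show ?thesis using gauss_le[of "t - T" "t - u n j" "B (u n j) \<omega>"] uT[OF j(1)] T
      by (simp add: K_def gauss_nonneg)
  qed
  have V0: "0 \<le> V n \<omega>" for n \<omega> unfolding V_def by (rule stopped_gauss_nonneg)
  have EV: "(LINT \<omega>|M. V n \<omega>) = gauss t x" for n
  proof -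
    have "(\<integral>\<^sup>+\<omega>. ennreal (V n \<omega>) \<partial>M) = ennreal (gauss t x)"
      unfolding V_def by (rule stopped_gauss_nn_integral[where n = "Suc n"]) (use u T in auto)
    then show ?thesis
      by (subst integral_eq_nn_integral) (auto simp: Vm V0 gauss_nonneg)
  qed
  have "(\<lambda>n. LINT \<omega>|M. V n \<omega>) \<longlonglongrightarrow> (LINT \<omega>|M. ?f \<omega>)"
    by (rule integral_dominated_convergence[where w = "\<lambda>_. K"]) (use fm Vm lim VK in auto)
  then have "gauss t x = (LINT \<omega>|M. ?f \<omega>)"
    unfolding EV by (rule LIMSEQ_unique[OF tendsto_const])
  then show "(LINT \<omega>|M. ?f \<omega>) = gauss t x" by simp
qed

end

section \<open>Optional stopping at the hitting time\<close>

lemma closed_hitting_set: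
  fixes b :: "real \<Rightarrow> 'a::real_normed_vector"
  assumes "continuous_on {0..} b" "closed D"
  shows "closed {s. 0 \<le> s \<and> b s \<in> D}"
proof -
  have "closed ({0..} \<inter> b -` D)" using assms by (intro continuous_closed_preimage) auto
  also have "{0..} \<inter> b -` D = {s. 0 \<le> s \<and> b s \<in> D}" by auto
  finally show ?thesis .
qed

lemma hitting_time_attained:
  fixes B :: "real \<Rightarrow> 'w \<Rightarrow> 'a::real_normed_vector"
  assumes cont: "continuous_on {0..} (\<lambda>s. B s \<omega>)" and D: "closed D"
    and hit: "0 \<le> s" "B s \<omega> \<in> D"
  obtains \<theta> where "0 \<le> \<theta>" "\<theta> \<le> s" "B \<theta> \<omega> \<in> D" "hitting_time B D \<omega> = ereal \<theta>"
    "\<And>s'. 0 \<le> s' \<Longrightarrow> B s' \<omega> \<in> D \<Longrightarrow> \<theta> \<le> s'"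
proof -
  let ?H = "{s. 0 \<le> s \<and> B s \<omega> \<in> D}"
  have ne: "?H \<noteq> {}" and bdd: "bdd_below ?H" using hit by (auto intro: bdd_belowI[of _ 0])
  have mem: "Inf ?H \<in> ?H" by (rule closed_contains_Inf[OF ne bdd closed_hitting_set[OF cont D]])
  have le: "Inf ?H \<le> s'" if "0 \<le> s'" "B s' \<omega> \<in> D" for s' using that by (intro cInf_lower bdd) auto
  have "hitting_time B D \<omega> = ereal (Inf ?H)"
    unfolding hitting_time_def using mem le by (intro antisym INF_lower2[OF mem] INF_greatest) auto
  then show ?thesis using that[of "Inf ?H"] mem le hit by auto
qed

lemma hitting_time_le_iff:
  fixes B :: "real \<Rightarrow> 'w \<Rightarrow> 'a::real_normed_vector"
  assumes cont: "continuous_on {0..} (\<lambda>s. B s \<omega>)" and D: "closed D"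
  shows "hitting_time B D \<omega> \<le> ereal t \<longleftrightarrow> (\<exists>s. 0 \<le> s \<and> s \<le> t \<and> B s \<omega> \<in> D)"
proof
  assume le: "hitting_time B D \<omega> \<le> ereal t"
  have "\<exists>s. 0 \<le> s \<and> B s \<omega> \<in> D"
  proof (rule ccontr)
    assume "\<nexists>s. 0 \<le> s \<and> B s \<omega> \<in> D"
    then have e: "{s. 0 \<le> s \<and> B s \<omega> \<in> D} = {}" by auto
    have "hitting_time B D \<omega> = \<infinity>" unfolding hitting_time_def e by (simp add: top_ereal_def)
    with le show False by simp
  qed
  then obtain s where "0 \<le> s" "B s \<omega> \<in> D" by blast
  from hitting_time_attained[where B = B and \<omega> = \<omega>, OF cont D this] le show "\<exists>s. 0 \<le> s \<and> s \<le> t \<and> B s \<omega> \<in> D" by (metis ereal_less_eq(3))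
next
  assume "\<exists>s. 0 \<le> s \<and> s \<le> t \<and> B s \<omega> \<in> D"
  then obtain s where s: "0 \<le> s" "s \<le> t" "B s \<omega> \<in> D" by blast
  then show "hitting_time B D \<omega> \<le> ereal t"
    unfolding hitting_time_def by (intro INF_lower2[of s]) auto
qed

text \<open>
  The case distinction is needed because \<open>real_of_ereal\<close> sends \<open>\<infinity>\<close> to \<open>0\<close>, which would give a path that
  never hits the ball the value \<open>1\<close>.
\<close>

definition discount :: "ereal \<Rightarrow> real" where
  "discount \<tau> = (if \<tau> = \<infinity> then 0 else exp (- real_of_ereal \<tau>))"

text \<open>
  The limit of the stopped martingale: at a hitting time before \<open>t\<close> the path is on the sphere of radius
  \<open>r\<close>, and otherwise it is outside the ball at time \<open>t\<close>, where the kernel has decayed to \<open>0\<close>.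
\<close>

definition delayed_gauss :: "nat \<Rightarrow> real \<Rightarrow> real \<Rightarrow> ereal \<Rightarrow> real" where
  "delayed_gauss d r t \<tau> = (if \<tau> < ereal t then radial_gauss d (t - real_of_ereal \<tau>) r else 0)"

lemma radial_gauss_tendsto_0:
  assumes "r > 0"
  shows "((\<lambda>t. radial_gauss d t r) \<longlongrightarrow> 0) (at_right 0)"
proof -
  have "(\<lambda>t. radial_gauss d t r) = (\<lambda>t. exp (- (r\<^sup>2 / (2 * t))) / sqrt (2 * pi * t) ^ d)"
    by (simp add: radial_gauss_def fun_eq_iff)
  moreover have "((\<lambda>t. exp (- (r\<^sup>2 / (2 * t))) / sqrt (2 * pi * t) ^ d) \<longlongrightarrow> 0) (at_right 0)"
    using assms by real_asymp
  ultimately show ?thesis by simp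
qed

text \<open>
  Away from the centre the kernel stays bounded as the time shrinks to \<open>0\<close>, which dominates the stopped
  martingale up to the time \<open>t\<close>.
\<close>

lemma radial_gauss_bounded:
  assumes r: "r > 0"
  obtains K where "\<And>t. t > 0 \<Longrightarrow> radial_gauss d t r \<le> K"
proof -
  have "\<forall>\<^sub>F t in at_right 0. radial_gauss d t r < 1"
    using radial_gauss_tendsto_0[OF r, of d] by (rule order_tendstoD(2)) simp
  then obtain c where c: "c > 0" "\<And>t. 0 < t \<Longrightarrow> t < c \<Longrightarrow> radial_gauss d t r < 1"
    unfolding eventually_at_right_field by auto
  show ?thesis
  proof (rule that[of "1 + 1 / sqrt (2 * pi * c) ^ d"])
    fix t :: real assume t: "t > 0"
    show "radial_gauss d t r \<le> 1 + 1 / sqrt (2 * pi * c) ^ d"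
    proof (cases "t < c")
      case True
      then have "radial_gauss d t r < 1" using c(2) t by simp
      moreover have "0 \<le> 1 / sqrt (2 * pi * c) ^ d" using c by simp
      ultimately show ?thesis by linarith
    next
      case False
      have "radial_gauss d t r \<le> 1 / sqrt (2 * pi * t) ^ d"
        unfolding radial_gauss_def using t by (intro divide_right_mono) auto
      also have "\<dots> \<le> 1 / sqrt (2 * pi * c) ^ d"
        using False c(1) t by (auto intro!: divide_left_mono power_mono mult_pos_pos)
      finally show ?thesis by simp
    qed
  qed
qed

lemma ball_entry_norm_ge:
  fixes b :: "real \<Rightarrow> 'a::real_normed_vector"
  assumes cont: "continuous_on {0..} b" and T: "T \<ge> 0" and r: "r \<le> norm (b 0)" "r \<le> R"
  shows "r \<le> norm (b (ball_entry b R T))"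
proof (rule ccontr)
  assume "\<not> r \<le> norm (b (ball_entry b R T))"
  then have less: "norm (b (ball_entry b R T)) < r" by simp
  let ?s = "ball_entry b R T"
  note bd = ball_entry_bounds[OF T, where b = b and R = R]
  have "?s \<noteq> 0" using less r(1) by auto
  then have pos: "?s > 0" using bd(1) by linarith
  obtain \<eta> where eta: "\<eta> > 0" "\<And>s'. 0 \<le> s' \<Longrightarrow> \<bar>s' - ?s\<bar> < \<eta> \<Longrightarrow> norm (b s') < r"
    using continuous_norm_less_nbhd[OF cont bd(1) less] by blast
  define s' where "s' = max 0 (?s - \<eta> / 2)"
  have s': "0 \<le> s'" "s' < ?s" "\<bar>s' - ?s\<bar> < \<eta>" using pos eta(1) by (auto simp: s'_def)
  then have "norm (b s') < R" using eta(2)[of s'] r(2) by simp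
  then have "?s \<le> s'" using s' bd(2) by (intro bd(3)) auto
  then show False using s' by simp
qed

text \<open>
  On a compact time interval a path that is outside the closed ball of radius \<open>r\<close> keeps a positive
  distance from it, hence is outside the slightly larger balls as well.
\<close>

lemma ball_entry_eventually_ge:
  fixes b :: "real \<Rightarrow> 'a::real_normed_vector"
  assumes cont: "continuous_on {0..} b" and out: "\<And>s'. 0 \<le> s' \<Longrightarrow> s' \<le> s \<Longrightarrow> r < norm (b s')"
    and R: "R \<longlonglongrightarrow> r" and s: "0 \<le> s"
  shows "\<forall>\<^sub>F m in sequentially. min s (T m) \<le> ball_entry b (R m) (T m)"
proof -
  have "continuous_on {0..s} (\<lambda>s. norm (b s))"
    by (intro continuous_intros continuous_on_subset[OF cont]) auto
  then obtain s0 where s0: "s0 \<in> {0..s}" "\<And>s'. s' \<in> {0..s} \<Longrightarrow> norm (b s0) \<le> norm (b s')"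
    using continuous_attains_inf[of "{0..s}" "\<lambda>s. norm (b s)"] s by auto
  have "r < norm (b s0)" using out s0(1) by auto
  from order_tendstoD(2)[OF R this] show ?thesis
  proof eventually_elim
    case (elim m)
    show ?case
    proof (rule ball_entry_ge)
      fix s' assume s': "0 \<le> s'" "s' \<le> T m" "norm (b s') < R m"
      have "\<not> s' \<le> s" using s0(2)[of s'] s' elim by force
      then show "min s (T m) \<le> s'" by simp
    qed simp
  qed
qed

text \<open>
  If the closed ball is hit at a time \<open>\<theta> < t\<close>, the entry times of the larger balls converge to \<open>\<theta>\<close> and the
  path is on the sphere at \<open>\<theta>\<close>. If it is not hit before \<open>t\<close>, the entry times converge to \<open>t\<close>, and the
  kernel at times close to \<open>0\<close> and at distance at least \<open>r\<close> tends to \<open>0\<close>.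
\<close>

lemma ball_entry_hitting_limit:
  fixes B :: "real \<Rightarrow> 'w \<Rightarrow> 'a::euclidean_space"
  assumes cont: "continuous_on {0..} (\<lambda>s. B s \<omega>)" and r: "r > 0" "r < norm (B 0 \<omega>)"
    and R: "R \<longlonglongrightarrow> r" "\<And>m. r < R m" and T: "T \<longlonglongrightarrow> t" "\<And>m. 0 < T m" "\<And>m. T m < t"
  shows "(\<lambda>m. gauss (t - ball_entry (\<lambda>s. B s \<omega>) (R m) (T m)) (B (ball_entry (\<lambda>s. B s \<omega>) (R m) (T m)) \<omega>))
     \<longlonglongrightarrow> delayed_gauss DIM('a) r t (hitting_time B (cball 0 r) \<omega>)"
proof -
  define b where "b s = B s \<omega>" for s
  define \<sigma> where "\<sigma> m = ball_entry b (R m) (T m)" for m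
  have contb: "continuous_on {0..} b" using cont by (simp add: b_def[abs_def])
  have T0: "0 \<le> T m" for m using T(2)[of m] by simp
  have sig: "0 \<le> \<sigma> m" "\<sigma> m \<le> T m" "\<sigma> m < t" for m
    using ball_entry_bounds(1,2)[OF T0[of m], where b = b and R = "R m"] T(3)[of m] by (auto simp: \<sigma>_def)
  have nrm: "r \<le> norm (b (\<sigma> m))" for m
    unfolding \<sigma>_def by (rule ball_entry_norm_ge[OF contb T0]) (use r R(2)[of m] in \<open>auto simp: b_def\<close>)
  have "(\<lambda>m. gauss (t - \<sigma> m) (b (\<sigma> m))) \<longlonglongrightarrow> delayed_gauss DIM('a) r t (hitting_time B (cball 0 r) \<omega>)"
  proof (cases "\<exists>s. 0 \<le> s \<and> s < t \<and> b s \<in> cball 0 r")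
    case True
    then obtain s where s: "0 \<le> s" "s < t" "b s \<in> cball 0 r" by blast
    obtain \<theta> where th: "0 \<le> \<theta>" "\<theta> \<le> s" "b \<theta> \<in> cball 0 r" "hitting_time B (cball 0 r) \<omega> = ereal \<theta>"
      "\<And>s'. 0 \<le> s' \<Longrightarrow> b s' \<in> cball 0 r \<Longrightarrow> \<theta> \<le> s'"
      using hitting_time_attained[where B = B and \<omega> = \<omega>, OF cont closed_cball, of s 0 r] s unfolding b_def by blast
    have tht: "\<theta> < t" using th s by simp
    have out: "r < norm (b s')" if "0 \<le> s'" "s' < \<theta>" for s'
      using th(5)[of s'] that by force
    have "\<theta> \<noteq> 0" using th(3) r by (auto simp: b_def)
    then have thpos: "\<theta> > 0" using th by simp
    have up: "\<forall>\<^sub>F m in sequentially. \<sigma> m \<le> \<theta>"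
      using order_tendstoD(1)[OF T(1) tht]
    proof eventually_elim
      case (elim m)
      have "norm (b \<theta>) < R m" using th(3) R(2)[of m] by simp
      then show ?case unfolding \<sigma>_def using elim th(1) by (intro ball_entry_bounds(3)[OF T0]) auto
    qed
    have lim: "\<sigma> \<longlonglongrightarrow> \<theta>"
    proof (rule order_tendstoI)
      fix a assume a: "a < \<theta>"
      define s' where "s' = max 0 ((a + \<theta>) / 2)"
      have s': "0 \<le> s'" "a < s'" "s' < \<theta>" using a thpos by (auto simp: s'_def less_max_iff_disj)
      have "\<forall>\<^sub>F m in sequentially. min s' (T m) \<le> \<sigma> m"
        unfolding \<sigma>_def by (rule ball_entry_eventually_ge[OF contb _ R(1) s'(1)]) (use out s' in auto)
      moreover have "\<forall>\<^sub>F m in sequentially. \<theta> < T m" by (rule order_tendstoD(1)[OF T(1) tht])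
      ultimately show "\<forall>\<^sub>F m in sequentially. a < \<sigma> m" by eventually_elim (use s' in auto)
    next
      fix a assume "\<theta> < a"
      with up show "\<forall>\<^sub>F m in sequentially. \<sigma> m < a" by (auto elim: eventually_mono)
    qed
    have "norm (b \<theta>) = r"
    proof (rule antisym)
      have "(\<lambda>m. norm (b (\<sigma> m))) \<longlonglongrightarrow> norm (b \<theta>)"
        using continuous_on_tendsto_compose[OF contb lim] th(1) sig(1) by (intro tendsto_norm) auto
      then show "r \<le> norm (b \<theta>)" by (rule LIMSEQ_le_const) (use nrm in auto)
    qed (use th(3) in simp)
    then have "delayed_gauss DIM('a) r t (hitting_time B (cball 0 r) \<omega>) = gauss (t - \<theta>) (b \<theta>)"
      using tht by (simp add: delayed_gauss_def th(4) gauss_radial)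
    then show ?thesis using gauss_path_tendsto[OF contb lim sig(1) sig(3) tht] by simp
  next
    case False
    then have out: "r < norm (b s')" if "0 \<le> s'" "s' < t" for s' using that by force
    have "\<not> hitting_time B (cball 0 r) \<omega> < ereal t"
    proof
      assume "hitting_time B (cball 0 r) \<omega> < ereal t"
      then obtain s where s: "hitting_time B (cball 0 r) \<omega> < ereal s" "ereal s < ereal t"
        using ereal_dense2 by blast
      then have "hitting_time B (cball 0 r) \<omega> \<le> ereal s" by simp
      then show False using hitting_time_le_iff[where B = B and \<omega> = \<omega>, OF cont closed_cball] False s(2) by (force simp: b_def)
    qed
    then have z: "delayed_gauss DIM('a) r t (hitting_time B (cball 0 r) \<omega>) = 0" by (simp add: delayed_gauss_def)
    have tpos: "t > 0" using T(2)[of 0] T(3)[of 0] by simp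
    have lim: "\<sigma> \<longlonglongrightarrow> t"
    proof (rule order_tendstoI)
      fix a assume a: "a < t"
      define s' where "s' = max 0 ((a + t) / 2)"
      have s': "0 \<le> s'" "a < s'" "s' < t" using a tpos by (auto simp: s'_def less_max_iff_disj)
      have "\<forall>\<^sub>F m in sequentially. min s' (T m) \<le> \<sigma> m"
        unfolding \<sigma>_def by (rule ball_entry_eventually_ge[OF contb _ R(1) s'(1)]) (use out s' in auto)
      moreover have "\<forall>\<^sub>F m in sequentially. a < T m" by (rule order_tendstoD(1)[OF T(1) a])
      ultimately show "\<forall>\<^sub>F m in sequentially. a < \<sigma> m" by eventually_elim (use s' in auto)
    next
      fix a assume a: "t < a"
      have "\<sigma> m < a" for m using sig(3)[of m] a by simp
      then show "\<forall>\<^sub>F m in sequentially. \<sigma> m < a" by simp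
    qed
    have "filterlim (\<lambda>m. t - \<sigma> m) (at_right 0) sequentially"
    proof (rule tendsto_imp_filterlim_at_right)
      show "(\<lambda>m. t - \<sigma> m) \<longlonglongrightarrow> 0" using tendsto_diff[OF tendsto_const lim, of t] by simp
    qed (use sig(3) in auto)
    from filterlim_compose[OF radial_gauss_tendsto_0[OF r(1)] this]
    have rl: "(\<lambda>m. radial_gauss DIM('a) (t - \<sigma> m) r) \<longlonglongrightarrow> 0" .
    have "(\<lambda>m. gauss (t - \<sigma> m) (b (\<sigma> m))) \<longlonglongrightarrow> 0"
    proof (rule tendsto_sandwich[OF _ _ tendsto_const rl])
      show "\<forall>\<^sub>F m in sequentially. gauss (t - \<sigma> m) (b (\<sigma> m)) \<le> radial_gauss DIM('a) (t - \<sigma> m) r"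
        using sig(3) nrm r(1) by (intro always_eventually allI) (simp add: gauss_radial radial_gauss_mono)
    qed (simp add: gauss_nonneg)
    then show ?thesis unfolding z .
  qed
  then show ?thesis by (simp add: \<sigma>_def b_def[abs_def])
qed

context brownian_motion
begin

lemma hitting_time_measurable:
  assumes D: "D = cball 0 r"
  shows "hitting_time B D \<in> borel_measurable M"
proof -
  have "{\<omega> \<in> space M. hitting_time B D \<omega> \<le> ereal s} \<in> sets M" for s
  proof -
    let ?Q = "\<rat> \<inter> {0..s}"
    have "hitting_time B D \<omega> \<le> ereal s \<longleftrightarrow> 0 \<le> s \<and> (B s \<omega> \<in> D \<or> (\<forall>m::nat. \<exists>q\<in>?Q. norm (B q \<omega>) < r + 1 / real (Suc m)))"
      if w: "\<omega> \<in> space M" for \<omega>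
    proof -
      note cont = continuous_paths[OF w]
      have contn: "continuous_on {0..} (\<lambda>s. norm (B s \<omega>))" using cont by (intro continuous_intros)
      have iff: "hitting_time B D \<omega> \<le> ereal s \<longleftrightarrow> (\<exists>s'. 0 \<le> s' \<and> s' \<le> s \<and> B s' \<omega> \<in> D)"
        by (rule hitting_time_le_iff[where B = B and \<omega> = \<omega>, OF cont]) (simp add: D)
      show ?thesis
        unfolding iff
      proof
        assume "\<exists>s'. 0 \<le> s' \<and> s' \<le> s \<and> B s' \<omega> \<in> D"
        then obtain s' where s': "0 \<le> s'" "s' \<le> s" "B s' \<omega> \<in> D" by blast
        have "\<exists>q\<in>?Q. norm (B q \<omega>) < r + 1 / real (Suc m)" if nD: "B s \<omega> \<notin> D" for m :: nat
        proof -
          from nD have "s' < s" using s' by (cases "s' = s") auto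
          have "norm (B s' \<omega>) < r + 1 / real (Suc m)" using s'(3) by (simp add: D add_strict_increasing2 add.commute le_less_trans)
          then obtain \<eta> where eta: "\<eta> > 0" "\<And>u. 0 \<le> u \<Longrightarrow> \<bar>u - s'\<bar> < \<eta> \<Longrightarrow> norm (B u \<omega>) < r + 1 / real (Suc m)"
            using continuous_norm_less_nbhd[OF cont s'(1)] by blast
          obtain q where q: "q \<in> \<rat>" "s' < q" "q < min s (s' + \<eta>)"
            using Rats_dense_in_real[of s' "min s (s' + \<eta>)"] \<open>s' < s\<close> eta(1) by auto
          then show ?thesis
            using s'(1) eta(2)[of q] by (intro bexI[of _ q]) auto
        qed
        then show "0 \<le> s \<and> (B s \<omega> \<in> D \<or> (\<forall>m::nat. \<exists>q\<in>?Q. norm (B q \<omega>) < r + 1 / real (Suc m)))"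
          using s' by auto
      next
        assume s_or: "0 \<le> s \<and> (B s \<omega> \<in> D \<or> (\<forall>m::nat. \<exists>q\<in>?Q. norm (B q \<omega>) < r + 1 / real (Suc m)))"
        show "\<exists>s'. 0 \<le> s' \<and> s' \<le> s \<and> B s' \<omega> \<in> D"
        proof (cases "B s \<omega> \<in> D")
          case False
          with s_or have s: "0 \<le> s" and *: "\<forall>m::nat. \<exists>q\<in>?Q. norm (B q \<omega>) < r + 1 / real (Suc m)" by auto
          obtain s0 where s0: "s0 \<in> {0..s}" "\<And>u. u \<in> {0..s} \<Longrightarrow> norm (B s0 \<omega>) \<le> norm (B u \<omega>)"
            using continuous_attains_inf[of "{0..s}" "\<lambda>s. norm (B s \<omega>)"] s continuous_on_subset[OF contn] by auto
          have "norm (B s0 \<omega>) \<le> r + 1 / real (Suc m)" for m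
            using * s0(2) by (metis IntD2 less_imp_le order_trans)
          moreover have "(\<lambda>m. r + 1 / real (Suc m)) \<longlonglongrightarrow> r + 0"
            by (intro tendsto_intros LIMSEQ_Suc[OF lim_const_over_n])
          ultimately have "norm (B s0 \<omega>) \<le> r" using LIMSEQ_le_const[of "\<lambda>m. r + 1 / real (Suc m)" r] by auto
          then show "\<exists>s'. 0 \<le> s' \<and> s' \<le> s \<and> B s' \<omega> \<in> D" using s0(1) by (auto simp: D)
        qed (use s_or in auto)
      qed
    qed
    then have eq: "{\<omega> \<in> space M. hitting_time B D \<omega> \<le> ereal s} =
        {\<omega> \<in> space M. 0 \<le> s \<and> (B s \<omega> \<in> D \<or> (\<forall>m::nat. \<exists>q\<in>?Q. norm (B q \<omega>) < r + 1 / real (Suc m)))}"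
      by blast
    show ?thesis
    proof (cases "0 \<le> s")
      case True
      have [measurable]: "B s \<in> borel_measurable M" by (rule measurable_at[OF True])
      have "{\<omega> \<in> space M. \<exists>q\<in>?Q. norm (B q \<omega>) < r + 1 / real (Suc m)} \<in> sets M" for m
      proof -
        have "{\<omega> \<in> space M. \<exists>q\<in>?Q. norm (B q \<omega>) < r + 1 / real (Suc m)} = (\<Union>q\<in>?Q. {\<omega> \<in> space M. norm (B q \<omega>) < r + 1 / real (Suc m)})"
          by auto
        also have "\<dots> \<in> sets M"
        proof (rule sets.countable_UN'')
          show "countable ?Q" by (intro countable_Int1 countable_rat)
          fix q assume "q \<in> ?Q"
          then have [measurable]: "B q \<in> borel_measurable M" by (intro measurable_at) auto
          show "{\<omega> \<in> space M. norm (B q \<omega>) < r + 1 / real (Suc m)} \<in> sets M" by measurable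
        qed
        finally show ?thesis .
      qed
      then have "{\<omega> \<in> space M. \<forall>m::nat. \<exists>q\<in>?Q. norm (B q \<omega>) < r + 1 / real (Suc m)} \<in> sets M"
        by (rule sets.sets_Collect_countable_All)
      moreover have "{\<omega> \<in> space M. norm (B s \<omega>) \<le> r} \<in> sets M" by measurable
      then have "{\<omega> \<in> space M. B s \<omega> \<in> D} \<in> sets M" by (simp add: D)
      ultimately show ?thesis unfolding eq using True by (simp add: sets.sets_Collect_disj)
    qed (simp add: eq)
  qed
  then have 1: "{\<omega> \<in> space M. hitting_time B D \<omega> \<le> ereal s} \<in> sets M" for s .
  show ?thesis
  proof (rule borel_measurableI_le)
    fix a :: ereal
    show "{\<omega> \<in> space M. hitting_time B D \<omega> \<le> a} \<in> sets M"
    proof (cases a)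
      case (real s)
      then show ?thesis using 1[of s] by simp
    next
      case PInf
      then show ?thesis by simp
    next
      case MInf
      have "0 \<le> hitting_time B D \<omega>" for \<omega> unfolding hitting_time_def by (intro INF_greatest) auto
      then have "\<not> hitting_time B D \<omega> \<le> a" for \<omega>
        unfolding MInf by (metis ereal_infty_less_eq(2) MInfty_neq_ereal(1) zero_ereal_def)
      then show ?thesis by simp
    qed
  qed
qed

text \<open>
  Optional stopping: the identities of \<open>expectation_ball_entry\<close> pass to the limit as the radii decrease
  to \<open>r\<close> and the caps increase to \<open>t\<close>.
\<close>

lemma expectation_delayed_gauss:
  assumes r: "0 < r" "r < norm x" and t: "t > 0"
  shows "(LINT \<omega>|M. delayed_gauss DIM('a) r t (hitting_time B (cball 0 r) \<omega>)) = gauss t x"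
    "integrable M (\<lambda>\<omega>. delayed_gauss DIM('a) r t (hitting_time B (cball 0 r) \<omega>))"
proof -
  define R where "R m = r + 1 / real (Suc m)" for m
  define T where "T m = t - t / real (Suc (Suc m))" for m
  define F where "F m \<omega> = gauss (t - ball_entry (\<lambda>s. B s \<omega>) (R m) (T m)) (B (ball_entry (\<lambda>s. B s \<omega>) (R m) (T m)) \<omega>)" for m \<omega>
  have R: "R \<longlonglongrightarrow> r" "r < R m" for m
  proof -
    have "(\<lambda>m. r + 1 / real (Suc m)) \<longlonglongrightarrow> r + 0" by (intro tendsto_intros LIMSEQ_Suc[OF lim_const_over_n])
    then show "R \<longlonglongrightarrow> r" by (simp add: R_def[abs_def])
  qed (simp add: R_def)
  have T: "T \<longlonglongrightarrow> t" "0 < T m" "T m < t" for m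
  proof -
    have "(\<lambda>m. t - t / real (Suc (Suc m))) \<longlonglongrightarrow> t - 0" by (intro tendsto_intros LIMSEQ_Suc[OF LIMSEQ_Suc[OF lim_const_over_n]])
    then show "T \<longlonglongrightarrow> t" by (simp add: T_def[abs_def])
    show "0 < T m" "T m < t" using t by (auto simp: T_def field_simps intro!: add_pos_nonneg)
  qed
  obtain K where K: "\<And>t. t > 0 \<Longrightarrow> radial_gauss DIM('a) t r \<le> K" using radial_gauss_bounded[OF r(1)] by blast
  have start: "AE \<omega> in M. B 0 \<omega> = x \<and> \<omega> \<in> space M" using starts_at AE_space by eventually_elim simp
  have Fm: "F m \<in> borel_measurable M" for m
    unfolding F_def[abs_def] by (rule expectation_ball_entry(1)[OF T(2,3)])
  have dm: "(\<lambda>\<omega>. delayed_gauss DIM('a) r t (hitting_time B (cball 0 r) \<omega>)) \<in> borel_measurable M"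
  proof -
    have [measurable]: "hitting_time B (cball 0 r) \<in> borel_measurable M" by (rule hitting_time_measurable[OF refl])
    show ?thesis unfolding delayed_gauss_def radial_gauss_def by measurable
  qed
  have lim: "AE \<omega> in M. (\<lambda>m. F m \<omega>) \<longlonglongrightarrow> delayed_gauss DIM('a) r t (hitting_time B (cball 0 r) \<omega>)"
    using start
  proof eventually_elim
    case (elim \<omega>)
    show ?case unfolding F_def
      by (rule ball_entry_hitting_limit[OF continuous_paths r(1) _ R(1) R(2) T(1) T(2) T(3)]) (use elim r in auto)
  qed
  have bound: "AE \<omega> in M. norm (F m \<omega>) \<le> K" for m
    using start
  proof eventually_elim
    case (elim \<omega>)
    let ?s = "ball_entry (\<lambda>s. B s \<omega>) (R m) (T m)"
    have T0: "0 \<le> T m" using T(2)[of m] by simp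
    have nr: "r \<le> norm (B ?s \<omega>)"
      by (rule ball_entry_norm_ge[OF continuous_paths T0]) (use elim r R(2)[of m] in auto)
    have ts: "t - ?s > 0" using ball_entry_bounds(2)[OF T0, of "\<lambda>s. B s \<omega>" "R m"] T(3)[of m] by linarith
    have "F m \<omega> \<le> radial_gauss DIM('a) (t - ?s) r"
      unfolding F_def gauss_radial[OF ts] using ts nr r by (intro radial_gauss_mono) auto
    also have "\<dots> \<le> K" by (rule K[OF ts])
    finally show ?case by (simp add: F_def gauss_nonneg)
  qed
  have "(\<lambda>m. LINT \<omega>|M. F m \<omega>) \<longlonglongrightarrow> (LINT \<omega>|M. delayed_gauss DIM('a) r t (hitting_time B (cball 0 r) \<omega>))"
    by (rule integral_dominated_convergence[where w = "\<lambda>_. K"]) (use dm Fm lim bound in auto)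
  moreover have "(LINT \<omega>|M. F m \<omega>) = gauss t x" for m
    unfolding F_def by (rule expectation_ball_entry(2)[OF T(2,3)])
  ultimately have "(\<lambda>m. gauss t x) \<longlonglongrightarrow> (LINT \<omega>|M. delayed_gauss DIM('a) r t (hitting_time B (cball 0 r) \<omega>))" by simp
  then have "gauss t x = (LINT \<omega>|M. delayed_gauss DIM('a) r t (hitting_time B (cball 0 r) \<omega>))"
    by (rule LIMSEQ_unique[OF tendsto_const])
  then show "(LINT \<omega>|M. delayed_gauss DIM('a) r t (hitting_time B (cball 0 r) \<omega>)) = gauss t x" by simp
  show "integrable M (\<lambda>\<omega>. delayed_gauss DIM('a) r t (hitting_time B (cball 0 r) \<omega>))"
    by (rule integrable_dominated_convergence[where w = "\<lambda>_. K" and s = F]) (use dm Fm lim bound in auto)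
qed

end

section \<open>The Laplace transform of the hitting time\<close>

text \<open>
  The resolvent kernel of Brownian motion at \<open>k\<close> as a function of the distance. The values are extended
  nonnegative reals, so that integrals can be interchanged freely.
\<close>

definition laplace_gauss :: "nat \<Rightarrow> nat \<Rightarrow> real \<Rightarrow> ennreal" where
  "laplace_gauss d k \<rho> = (\<integral>\<^sup>+t. indicator {0<..} t * ennreal (exp (- (real k * t)) * radial_gauss d t \<rho>) \<partial>lborel)"

lemma hitting_time_nonneg: "0 \<le> hitting_time B D \<omega>"
  unfolding hitting_time_def by (intro INF_greatest) auto

lemma discount_bounds: "0 \<le> discount \<tau>" "0 \<le> \<tau> \<Longrightarrow> discount \<tau> \<le> 1"
  by (auto simp: discount_def real_of_ereal_pos)

lemma discount_ge_iff:
  assumes "0 \<le> \<tau>" "t \<ge> 0"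
  shows "exp (- t) \<le> discount \<tau> \<longleftrightarrow> \<tau> \<le> ereal t"
  using assms by (cases \<tau>) (auto simp: discount_def)

lemma radial_gauss_nonneg: "0 \<le> radial_gauss d t \<rho>" if "t > 0"
  using that by (simp add: radial_gauss_def)

text \<open>
  A delay by \<open>\<tau>\<close> multiplies the Laplace transform at \<open>k\<close> by \<open>exp (- k \<tau>)\<close>.
\<close>

lemma laplace_delayed_gauss:
  assumes k: "k \<ge> 1" and tau: "0 \<le> \<tau>"
  shows "(\<integral>\<^sup>+t. indicator {0<..} t * ennreal (exp (- (real k * t)) * delayed_gauss d r t \<tau>) \<partial>lborel)
    = ennreal (discount \<tau> ^ k) * laplace_gauss d k r"
proof (cases \<tau>)
  case (real \<theta>)
  then have th: "0 \<le> \<theta>" using tau by simp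
  let ?f = "\<lambda>t. indicator {0<..} t * ennreal (exp (- (real k * t)) * delayed_gauss d r t \<tau>)"
  have [measurable]: "(\<lambda>t. delayed_gauss d r t \<tau>) \<in> borel_measurable borel"
    unfolding delayed_gauss_def radial_gauss_def by measurable
  have "(\<integral>\<^sup>+t. ?f t \<partial>lborel) = ennreal \<bar>1\<bar> * (\<integral>\<^sup>+u. ?f (\<theta> + 1 * u) \<partial>lborel)"
    by (rule nn_integral_real_affine) auto
  also have "(\<integral>\<^sup>+u. ?f (\<theta> + 1 * u) \<partial>lborel)
     = (\<integral>\<^sup>+u. ennreal (exp (- \<theta>) ^ k) * (indicator {0<..} u * ennreal (exp (- (real k * u)) * radial_gauss d u r)) \<partial>lborel)"
  proof (rule nn_integral_cong)
    fix u :: real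
    show "?f (\<theta> + 1 * u) = ennreal (exp (- \<theta>) ^ k) * (indicator {0<..} u * ennreal (exp (- (real k * u)) * radial_gauss d u r))"
    proof (cases "u > 0")
      case True
      have "exp (- (real k * (\<theta> + u))) = exp (- \<theta>) ^ k * exp (- (real k * u))"
        by (simp add: exp_of_nat_mult[symmetric] exp_add[symmetric] algebra_simps)
      then show ?thesis using True th real
        by (simp add: delayed_gauss_def ennreal_mult[symmetric] radial_gauss_nonneg mult.assoc)
    next
      case False
      then show ?thesis using real by (auto simp: delayed_gauss_def indicator_def)
    qed
  qed
  also have "\<dots> = ennreal (exp (- \<theta>) ^ k) * laplace_gauss d k r"
    unfolding laplace_gauss_def radial_gauss_def by (rule nn_integral_cmult) measurable
  finally show ?thesis using real by (simp add: discount_def)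
next
  case PInf
  then show ?thesis using k by (simp add: delayed_gauss_def discount_def)
qed (use tau in auto)

context brownian_motion
begin

lemma discount_measurable:
  "(\<lambda>\<omega>. discount (hitting_time B (cball 0 r) \<omega>)) \<in> borel_measurable M"
proof -
  have [measurable]: "hitting_time B (cball 0 r) \<in> borel_measurable M" by (rule hitting_time_measurable[OF refl])
  show ?thesis unfolding discount_def by measurable
qed

lemma integrable_discount_power:
  "integrable M (\<lambda>\<omega>. discount (hitting_time B (cball 0 r) \<omega>) ^ k)"
proof (rule integrable_const_bound[where B = 1])
  show "(\<lambda>\<omega>. discount (hitting_time B (cball 0 r) \<omega>) ^ k) \<in> borel_measurable M"
    using discount_measurable by (rule borel_measurable_power)
qed (auto intro!: AE_I2 power_le_one simp: discount_bounds hitting_time_nonneg)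

text \<open>
  The Laplace transform in \<open>t\<close> of \<open>expectation_delayed_gauss\<close>. On the right it factors, because the delay
  only enters through \<open>exp (- k \<tau>)\<close>.
\<close>

lemma laplace_hitting_time:
  assumes r: "0 < r" "r < norm x" and k: "k \<ge> 1"
  shows "laplace_gauss DIM('a) k (norm x) =
     ennreal (LINT \<omega>|M. discount (hitting_time B (cball 0 r) \<omega>) ^ k) * laplace_gauss DIM('a) k r"
proof -
  let ?\<tau> = "hitting_time B (cball 0 r)"
  have [measurable]: "?\<tau> \<in> borel_measurable M" by (rule hitting_time_measurable[OF refl])
  interpret L: pair_sigma_finite M "lborel :: real measure" ..
  have "laplace_gauss DIM('a) k (norm x) = (\<integral>\<^sup>+t. \<integral>\<^sup>+\<omega>. indicator {0<..} t * ennreal (exp (- (real k * t)) * delayed_gauss DIM('a) r t (?\<tau> \<omega>)) \<partial>M \<partial>lborel)"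
    unfolding laplace_gauss_def
  proof (rule nn_integral_cong)
    fix t :: real
    show "indicator {0<..} t * ennreal (exp (- (real k * t)) * radial_gauss DIM('a) t (norm x)) =
      (\<integral>\<^sup>+\<omega>. indicator {0<..} t * ennreal (exp (- (real k * t)) * delayed_gauss DIM('a) r t (?\<tau> \<omega>)) \<partial>M)"
    proof (cases "t > 0")
      case True
      have dn: "0 \<le> delayed_gauss DIM('a) r t (?\<tau> \<omega>)" for \<omega>
        using hitting_time_nonneg[of B "cball 0 r" \<omega>]
        by (cases "?\<tau> \<omega>") (auto simp: delayed_gauss_def radial_gauss_nonneg)
      have "(\<integral>\<^sup>+\<omega>. ennreal (exp (- (real k * t)) * delayed_gauss DIM('a) r t (?\<tau> \<omega>)) \<partial>M)
         = ennreal (LINT \<omega>|M. exp (- (real k * t)) * delayed_gauss DIM('a) r t (?\<tau> \<omega>))"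
        using expectation_delayed_gauss(2)[OF r True] dn by (intro nn_integral_eq_integral) auto
      also have "(LINT \<omega>|M. exp (- (real k * t)) * delayed_gauss DIM('a) r t (?\<tau> \<omega>)) = exp (- (real k * t)) * gauss t x"
        using expectation_delayed_gauss(1)[OF r True] by simp
      finally show ?thesis using True by (simp add: gauss_radial)
    qed simp
  qed
  also have "\<dots> = (\<integral>\<^sup>+\<omega>. \<integral>\<^sup>+t. indicator {0<..} t * ennreal (exp (- (real k * t)) * delayed_gauss DIM('a) r t (?\<tau> \<omega>)) \<partial>lborel \<partial>M)"
    unfolding delayed_gauss_def radial_gauss_def by (rule L.Fubini') measurable
  also have "\<dots> = (\<integral>\<^sup>+\<omega>. ennreal (discount (?\<tau> \<omega>) ^ k) * laplace_gauss DIM('a) k r \<partial>M)"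
    by (simp add: laplace_delayed_gauss[OF k hitting_time_nonneg])
  also have "\<dots> = (\<integral>\<^sup>+\<omega>. ennreal (discount (?\<tau> \<omega>) ^ k) \<partial>M) * laplace_gauss DIM('a) k r"
    using discount_measurable[of r] by (intro nn_integral_multc) measurable
  also have "(\<integral>\<^sup>+\<omega>. ennreal (discount (?\<tau> \<omega>) ^ k) \<partial>M) = ennreal (LINT \<omega>|M. discount (?\<tau> \<omega>) ^ k)"
    by (intro nn_integral_eq_integral integrable_discount_power AE_I2) (simp add: discount_bounds)
  finally show ?thesis .
qed

end

section \<open>Exponential moments in dimension four\<close>

text \<open>
  The kernel is written as an integral of indicators of balls, with the weight \<open>w\<close> (minus the derivative
  in the radius). With the volume \<open>\<pi>\<^sup>2 s\<^sup>4 / 2\<close> of the ball of radius \<open>s\<close> only a one-dimensional integral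
  with an explicit antiderivative remains.
\<close>

lemma gauss_tail_mass:
  fixes t r :: real
  assumes t: "t > 0" and r: "r > 0"
  shows "(\<integral>\<^sup>+x. indicator (- cball 0 r) x * ennreal (gauss t (x :: real ^ 4)) \<partial>lborel)
     = ennreal ((1 + r\<^sup>2 / 2 / t) * exp (- (r\<^sup>2 / 2 / t)))"
proof -
  define w where "w s = s / t * radial_gauss 4 t s" for s
  have wm [measurable]: "w \<in> borel_measurable borel" unfolding w_def[abs_def] radial_gauss_def by measurable
  have rgd: "((\<lambda>s. - radial_gauss 4 t s) has_real_derivative w s) (at s)" for s
    unfolding radial_gauss_def w_def using t
    by (auto intro!: derivative_eq_intros simp: field_simps)
  have w0: "w s \<ge> 0" if "s \<ge> 0" for s using that t by (simp add: w_def radial_gauss_nonneg)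
  have dec: "((\<lambda>s. exp (- (s\<^sup>2 / (2 * t)))) \<longlongrightarrow> 0) at_top" using t by real_asymp
  have rg0: "((\<lambda>s. - radial_gauss 4 t s) \<longlongrightarrow> 0) at_top"
    using tendsto_minus[OF tendsto_divide_zero[OF dec, of "sqrt (2 * pi * t) ^ 4"]] by (simp add: radial_gauss_def)
  have layer: "ennreal (radial_gauss 4 t \<rho>) = (\<integral>\<^sup>+s. ennreal (w s) * indicator {\<rho>..} s \<partial>lborel)" if "\<rho> \<ge> 0" for \<rho>
    using nn_integral_FTC_atLeast[of w \<rho> "\<lambda>s. - radial_gauss 4 t s" 0] rgd w0 rg0 that by auto
  have "(\<integral>\<^sup>+x. indicator (- cball 0 r) x * ennreal (gauss t (x :: real ^ 4)) \<partial>lborel)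
     = (\<integral>\<^sup>+x. \<integral>\<^sup>+s. indicator (- cball 0 r) (x :: real ^ 4) * (ennreal (w s) * indicator {norm x..} s) \<partial>lborel \<partial>lborel)"
  proof (rule nn_integral_cong)
    fix x :: "real ^ 4"
    have "ennreal (gauss t x) = (\<integral>\<^sup>+s. ennreal (w s) * indicator {norm x..} s \<partial>lborel)"
      using layer[of "norm x"] gauss_radial[OF t, of x] by simp
    then show "indicator (- cball 0 r) x * ennreal (gauss t x) = (\<integral>\<^sup>+s. indicator (- cball 0 r) x * (ennreal (w s) * indicator {norm x..} s) \<partial>lborel)"
      by (simp add: nn_integral_cmult)
  qed
  also have "\<dots> = (\<integral>\<^sup>+s. \<integral>\<^sup>+x. indicator (- cball 0 r) (x :: real ^ 4) * (ennreal (w s) * indicator {norm x..} s) \<partial>lborel \<partial>lborel)"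
  proof (rule lborel_pair.Fubini'[symmetric])
    have "(\<lambda>(x, s). indicator {x :: real ^ 4. r < norm x} x * (ennreal (w s) * indicator {p. norm (fst p :: real ^ 4) \<le> snd p} (x, s))) \<in> borel_measurable (lborel \<Otimes>\<^sub>M lborel)"
      by measurable
    also have "(\<lambda>(x, s). indicator {x :: real ^ 4. r < norm x} x * (ennreal (w s) * indicator {p. norm (fst p :: real ^ 4) \<le> snd p} (x, s))) = (\<lambda>(x, s). indicator (- cball 0 r) (x :: real ^ 4) * (ennreal (w s) * indicator {norm x..} s))"
      by (auto simp: fun_eq_iff indicator_def)
    finally show "(\<lambda>(x, s). indicator (- cball 0 r) (x :: real ^ 4) * (ennreal (w s) * indicator {norm x..} s)) \<in> borel_measurable (lborel \<Otimes>\<^sub>M lborel)" .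
  qed
  also have "\<dots> = (\<integral>\<^sup>+s. ennreal (w s * (pi\<^sup>2 / 2 * (s ^ 4 - r ^ 4))) * indicator {r..} s \<partial>lborel)"
  proof (rule nn_integral_cong)
    fix s :: real
    have "(\<integral>\<^sup>+x. indicator (- cball 0 r) (x :: real ^ 4) * (ennreal (w s) * indicator {norm x..} s) \<partial>lborel)
       = (\<integral>\<^sup>+x. ennreal (w s) * indicator (cball 0 s - cball 0 r) (x :: real ^ 4) \<partial>lborel)"
      by (intro nn_integral_cong) (auto simp: indicator_def)
    also have "\<dots> = ennreal (w s) * emeasure lborel (cball 0 s - cball 0 r :: (real ^ 4) set)"
      by (rule nn_integral_cmult_indicator) auto
    also have "\<dots> = ennreal (w s * (pi\<^sup>2 / 2 * (s ^ 4 - r ^ 4))) * indicator {r..} s"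
    proof (cases "r \<le> s")
      case True
      have v: "emeasure lborel (cball 0 u :: (real ^ 4) set) = ennreal (pi\<^sup>2 / 2 * u ^ 4)" if "u \<ge> 0" for u
        using emeasure_cball[OF that, of "0 :: real ^ 4"] unit_ball_vol_even[of 2] by (simp add: fact_2)
      have "emeasure lborel (cball 0 s - cball 0 r :: (real ^ 4) set) = ennreal (pi\<^sup>2 / 2 * s ^ 4) - ennreal (pi\<^sup>2 / 2 * r ^ 4)"
        using True r by (subst emeasure_Diff) (auto simp: v)
      also have "\<dots> = ennreal (pi\<^sup>2 / 2 * (s ^ 4 - r ^ 4))"
        using r by (subst ennreal_minus) (auto simp: right_diff_distrib)
      finally have e: "emeasure lborel (cball 0 s - cball 0 r :: (real ^ 4) set) = ennreal (pi\<^sup>2 / 2 * (s ^ 4 - r ^ 4))" .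
      have "0 \<le> pi\<^sup>2 / 2 * (s ^ 4 - r ^ 4)" using True r by (simp add: power_mono)
      then show ?thesis unfolding e using True r w0[of s] by (simp only: ennreal_mult) simp
    next
      case False
      then have e: "cball 0 s - cball 0 r = ({} :: (real ^ 4) set)" by auto
      show ?thesis unfolding e using False by simp
    qed
    finally show "(\<integral>\<^sup>+x. indicator (- cball 0 r) (x :: real ^ 4) * (ennreal (w s) * indicator {norm x..} s) \<partial>lborel) = \<dots>" .
  qed
  also have "\<dots> = ennreal (0 - (- (1 / (8 * t\<^sup>2) * exp (- (r\<^sup>2 / (2 * t))) * (r ^ 4 - r ^ 4 + 4 * t * r\<^sup>2 + 8 * t\<^sup>2))))"
  proof (rule nn_integral_FTC_atLeast[where F = "\<lambda>s. - (1 / (8 * t\<^sup>2) * exp (- (s\<^sup>2 / (2 * t))) * (s ^ 4 - r ^ 4 + 4 * t * s\<^sup>2 + 8 * t\<^sup>2))"])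
    have sq: "sqrt (2 * pi * t) ^ 4 = 4 * pi\<^sup>2 * t\<^sup>2"
    proof -
      have "sqrt (2 * pi * t) ^ 4 = ((sqrt (2 * pi * t))\<^sup>2)\<^sup>2" by simp
      also have "\<dots> = (2 * pi * t)\<^sup>2" using t by (subst real_sqrt_pow2) auto
      finally show ?thesis by (simp add: power_mult_distrib)
    qed
    fix s :: real assume s: "r \<le> s"
    have "((\<lambda>s. - (1 / (8 * t\<^sup>2) * exp (- (s\<^sup>2 / (2 * t))) * (s ^ 4 - r ^ 4 + 4 * t * s\<^sup>2 + 8 * t\<^sup>2))) has_real_derivative
       (1 / (8 * t\<^sup>2) * exp (- (s\<^sup>2 / (2 * t))) * (s / t * (s ^ 4 - r ^ 4)))) (at s)"
      using t by (auto intro!: derivative_eq_intros simp: field_simps power2_eq_square power3_eq_cube power4_eq_xxxx)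
    also have "1 / (8 * t\<^sup>2) * exp (- (s\<^sup>2 / (2 * t))) * (s / t * (s ^ 4 - r ^ 4)) = w s * (pi\<^sup>2 / 2 * (s ^ 4 - r ^ 4))"
      unfolding w_def radial_gauss_def sq using t by (simp add: field_simps)
    finally show "((\<lambda>s. - (1 / (8 * t\<^sup>2) * exp (- (s\<^sup>2 / (2 * t))) * (s ^ 4 - r ^ 4 + 4 * t * s\<^sup>2 + 8 * t\<^sup>2))) has_real_derivative w s * (pi\<^sup>2 / 2 * (s ^ 4 - r ^ 4))) (at s)" .
    show "0 \<le> w s * (pi\<^sup>2 / 2 * (s ^ 4 - r ^ 4))"
      using s r w0[of s] by (intro mult_nonneg_nonneg) (auto intro: power_mono)
  next
    show "((\<lambda>s. - (1 / (8 * t\<^sup>2) * exp (- (s\<^sup>2 / (2 * t))) * (s ^ 4 - r ^ 4 + 4 * t * s\<^sup>2 + 8 * t\<^sup>2))) \<longlongrightarrow> 0) at_top"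
      using t by real_asymp
  qed measurable
  also have "0 - (- (1 / (8 * t\<^sup>2) * exp (- (r\<^sup>2 / (2 * t))) * (r ^ 4 - r ^ 4 + 4 * t * r\<^sup>2 + 8 * t\<^sup>2))) = (1 + r\<^sup>2 / 2 / t) * exp (- (r\<^sup>2 / 2 / t))"
    using t by (simp add: field_simps power2_eq_square)
  finally show ?thesis .
qed

lemma integrable_cosh_moment_real:
  assumes "x > 0"
  shows "integrable lborel (\<lambda>u::real. cosh u ^ n * exp (- (x * cosh u)))"
  using integrable_norm[OF integrable_cosh_moment[of "of_real x" n]] assms
  by (simp add: norm_mult norm_power cosh_real_nonneg)

text \<open>
  The function \<open>sinh\<close> is odd, so \<open>exp w\<close> and \<open>exp (- w)\<close> can both be replaced by \<open>cosh w\<close>.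
\<close>

lemma exp_cosh_integrals:
  assumes "x > 0"
  shows "integrable lborel (\<lambda>w::real. exp (- (x * cosh w)) * exp w)"
    "(LINT w|lborel. exp (- (x * cosh w)) * exp w) = (LINT u|lborel. cosh u * exp (- (x * cosh u)))"
    "integrable lborel (\<lambda>w::real. exp (- (x * cosh w)) * exp (- w))"
    "(LINT w|lborel. exp (- (x * cosh w)) * exp (- w)) = (LINT u|lborel. cosh u * exp (- (x * cosh u)))"
proof -
  let ?s = "\<lambda>w::real. sinh w * exp (- (x * cosh w))" and ?c = "\<lambda>w::real. cosh w * exp (- (x * cosh w))"
  have ic: "integrable lborel ?c" using integrable_cosh_moment_real[OF assms, of 1] by simp
  have iss: "integrable lborel ?s"
  proof (rule Bochner_Integration.integrable_bound[OF ic])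
    have "\<bar>sinh w\<bar> \<le> cosh w" for w :: real
      using sinh_le_cosh_real[of w] sinh_le_cosh_real[of "- w"] by (simp add: abs_le_iff)
    then show "AE w in lborel. norm (?s w) \<le> norm (?c w)"
      by (intro AE_I2) (auto simp: abs_mult cosh_real_nonneg intro!: mult_right_mono)
    show "?s \<in> borel_measurable lborel"
      by (simp, intro borel_measurable_continuous_onI continuous_intros)
  qed
  have "(LINT w|lborel. ?s w) = \<bar>-1\<bar> *\<^sub>R (LINT w|lborel. ?s (0 + (-1) * w))"
    by (rule lborel_integral_real_affine) simp
  then have s0: "(LINT w|lborel. ?s w) = 0" by simp
  have e: "exp (- (x * cosh w)) * exp w = ?c w + ?s w" "exp (- (x * cosh w)) * exp (- w) = ?c w - ?s w" for w
    by (simp_all only: distrib_right[symmetric] left_diff_distrib[symmetric] cosh_plus_sinh cosh_minus_sinh mult.commute)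
  show "integrable lborel (\<lambda>w::real. exp (- (x * cosh w)) * exp w)" unfolding e by (intro Bochner_Integration.integrable_add ic iss)
  show "integrable lborel (\<lambda>w::real. exp (- (x * cosh w)) * exp (- w))" unfolding e by (intro Bochner_Integration.integrable_diff ic iss)
  show "(LINT w|lborel. exp (- (x * cosh w)) * exp w) = (LINT u|lborel. ?c u)" unfolding e using ic iss s0 by simp
  show "(LINT w|lborel. exp (- (x * cosh w)) * exp (- w)) = (LINT u|lborel. ?c u)" unfolding e using ic iss s0 by simp
qed

text \<open>
  The substitution \<open>t = c exp w\<close> balances the two terms of the exponent: \<open>k t + a / t\<close> becomes
  \<open>z cosh w\<close>.
\<close>

lemma bessel_laplace_integrals:
  fixes a k :: real
  assumes a: "a > 0" and k: "k > 0"
  defines "c \<equiv> sqrt (a / k)" and "z \<equiv> 2 * sqrt (a * k)"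
  shows "set_integrable lborel {0<..} (\<lambda>t. exp (- (k * t) - a / t) / t\<^sup>2)"
    "(LINT t:{0<..}|lborel. exp (- (k * t) - a / t) / t\<^sup>2) = (LINT u|lborel. cosh u * exp (- (z * cosh u))) / c"
    "set_integrable lborel {0<..} (\<lambda>t. exp (- (k * t) - a / t) * (1 + a / t))"
    "(LINT t:{0<..}|lborel. exp (- (k * t) - a / t) * (1 + a / t)) =
       c * (LINT u|lborel. cosh u * exp (- (z * cosh u))) + a * (LINT u|lborel. exp (- (z * cosh u)))"
proof -
  have c: "c > 0" and z: "z > 0" using a k by (auto simp: c_def z_def)
  have kc: "k * c = z / 2" "a / c = z / 2"
  proof -
    have c2: "c\<^sup>2 = a / k" using a k by (simp add: c_def)
    have "(k * c)\<^sup>2 = a * k" unfolding power_mult_distrib c2 using k by (simp add: power2_eq_square)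
    then have "sqrt (a * k) = k * c" using k c by (intro real_sqrt_unique) auto
    then show 1: "k * c = z / 2" by (simp add: z_def)
    have "c * c = a / k" using a k by (simp add: c_def)
    then have "a = k * c * c" using k by (simp add: field_simps)
    then show "a / c = z / 2" using c 1 by simp
  qed
  let ?g = "\<lambda>w::real. c * exp w"
  have img: "?g ` UNIV = {0<..}"
  proof (intro equalityI subsetI)
    fix t :: real assume "t \<in> {0<..}"
    then have "t = ?g (ln (t / c))" using c by simp
    then show "t \<in> ?g ` UNIV" by blast
  qed (use c in auto)
  have E: "exp (- (k * ?g w) - a / ?g w) = exp (- (z * cosh w))" for w
  proof -
    have "a / ?g w = (a / c) * exp (- w)" by (simp add: exp_minus divide_inverse)
    then have "- (k * ?g w) - a / ?g w = - (z / 2 * exp w + z / 2 * exp (- w))"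
      by (simp add: kc mult.assoc[symmetric])
    also have "\<dots> = - (z * cosh w)" by (simp add: cosh_def field_simps)
    finally show ?thesis by simp
  qed
  have inj: "inj_on ?g UNIV" using c by (auto simp: inj_on_def)
  have der: "(?g has_field_derivative ?g w) (at w within UNIV)" for w by (auto intro!: derivative_eq_intros)
  have cont: "set_borel_measurable borel {0<..} f" if "continuous_on {0<..} f" for f :: "real \<Rightarrow> real"
    unfolding set_borel_measurable_def using borel_measurable_continuous_on_indicator[OF _ that] by simp
  have contU: "set_borel_measurable borel UNIV f" if "continuous_on UNIV f" for f :: "real \<Rightarrow> real"
    unfolding set_borel_measurable_def using borel_measurable_continuous_onI[OF that] by simp
  have UI: "set_integrable lborel UNIV f \<longleftrightarrow> integrable lborel f" "(LINT w:UNIV|lborel. f w) = (LINT w|lborel. f w)" for f :: "real \<Rightarrow> real"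
    by (simp_all add: set_integrable_def set_lebesgue_integral_def)
  let ?f1 = "\<lambda>t. exp (- (k * t) - a / t) / t\<^sup>2" and ?f2 = "\<lambda>t. exp (- (k * t) - a / t) * (1 + a / t)"
  have f1: "\<bar>?g w\<bar> * ?f1 (?g w) = 1 / c * (exp (- (z * cosh w)) * exp (- w))" for w
  proof -
    have "\<bar>?g w\<bar> * ?f1 (?g w) = ?g w * (exp (- (z * cosh w)) / (?g w)\<^sup>2)" using c unfolding E by simp
    also have "\<dots> = exp (- (z * cosh w)) / ?g w" using c by (simp add: power2_eq_square)
    finally show ?thesis by (simp add: exp_minus divide_inverse)
  qed
  have f2: "\<bar>?g w\<bar> * ?f2 (?g w) = c * (exp (- (z * cosh w)) * exp w) + a * (cosh w ^ 0 * exp (- (z * cosh w)))" for w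
  proof -
    have "\<bar>?g w\<bar> * ?f2 (?g w) = ?g w * (exp (- (z * cosh w)) * (1 + a / ?g w))" using c unfolding E by simp
    also have "\<dots> = exp (- (z * cosh w)) * (?g w + ?g w * (a / ?g w))" by (simp only: algebra_simps)
    also have "?g w * (a / ?g w) = a" using c by simp
    finally show ?thesis by (simp add: algebra_simps)
  qed
  have m1: "set_borel_measurable borel UNIV (\<lambda>w. \<bar>?g w\<bar> * ?f1 (?g w))" "set_borel_measurable borel {0<..} ?f1"
    unfolding f1 by (intro cont contU continuous_intros; simp)+
  have m2: "set_borel_measurable borel UNIV (\<lambda>w. \<bar>?g w\<bar> * ?f2 (?g w))" "set_borel_measurable borel {0<..} ?f2"
    unfolding f2 by (intro cont contU continuous_intros; simp)+
  note ei = exp_cosh_integrals[OF z] and i0 = integrable_cosh_moment_real[OF z, of 0]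
  note s1 = set_integral_substitution[OF _ _ der inj m1(1), unfolded img, OF _ _ m1(2), unfolded f1 UI]
  note s2 = set_integral_substitution[OF _ _ der inj m2(1), unfolded img, OF _ _ m2(2), unfolded f2 UI]
  show r1: "set_integrable lborel {0<..} ?f1"
    using s1(1) ei(3) by simp
  show "(LINT t:{0<..}|lborel. ?f1 t) = (LINT u|lborel. cosh u * exp (- (z * cosh u))) / c"
    using s1(2)[OF _ _ r1] unfolding integral_mult_right_zero ei(4) by simp
  show r2: "set_integrable lborel {0<..} ?f2"
    using s2(1) ei(1) i0 by simp
  have "(LINT w|lborel. c * (exp (- (z * cosh w)) * exp w) + a * (cosh w ^ 0 * exp (- (z * cosh w)))) =
      c * (LINT w|lborel. exp (- (z * cosh w)) * exp w) + a * (LINT w|lborel. cosh w ^ 0 * exp (- (z * cosh w)))"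
    using ei(1) i0 by (subst Bochner_Integration.integral_add) auto
  then show "(LINT t:{0<..}|lborel. ?f2 t) =
       c * (LINT u|lborel. cosh u * exp (- (z * cosh u))) + a * (LINT u|lborel. exp (- (z * cosh u)))"
    using s2(2)[OF _ _ r2] unfolding ei(2) by simp
qed

lemma nn_set_integral_eq:
  fixes f :: "real \<Rightarrow> real"
  assumes "set_integrable lborel {0<..} f" "\<And>t. t > 0 \<Longrightarrow> 0 \<le> f t"
  shows "(\<integral>\<^sup>+t. indicator {0<..} t * ennreal (f t) \<partial>lborel) = ennreal (LINT t:{0<..}|lborel. f t)"
proof -
  have "(\<integral>\<^sup>+t. indicator {0<..} t * ennreal (f t) \<partial>lborel) = (\<integral>\<^sup>+t. ennreal (indicator {0<..} t *\<^sub>R f t) \<partial>lborel)"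
    by (intro nn_integral_cong) (auto simp: indicator_def)
  also have "\<dots> = ennreal (LINT t|lborel. indicator {0<..} t *\<^sub>R f t)"
    using assms by (intro nn_integral_eq_integral) (auto simp: set_integrable_def indicator_def)
  finally show ?thesis by (simp add: set_lebesgue_integral_def)
qed

lemma radial_gauss_4: "t > 0 \<Longrightarrow> radial_gauss 4 t \<rho> = exp (- (\<rho>\<^sup>2 / 2 / t)) / (4 * pi\<^sup>2 * t\<^sup>2)"
proof -
  assume t: "t > 0"
  have "sqrt (2 * pi * t) ^ 4 = ((sqrt (2 * pi * t))\<^sup>2)\<^sup>2" by simp
  also have "\<dots> = (2 * pi * t)\<^sup>2" using t by (subst real_sqrt_pow2) auto
  finally show ?thesis by (simp add: radial_gauss_def power_mult_distrib)
qed

lemma borel_measurable_laplace_gauss [measurable]: "laplace_gauss d k \<in> borel_measurable borel"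
  unfolding laplace_gauss_def[abs_def] radial_gauss_def by measurable

text \<open>
  For the second value the integrals over space and time are interchanged and \<open>gauss_tail_mass\<close> is
  inserted, so that both values are instances of \<open>bessel_laplace_integrals\<close>.
\<close>

lemma laplace_gauss_values:
  fixes r :: real and n :: nat
  assumes r: "r > 0" and n: "n \<ge> 1"
  defines "c \<equiv> sqrt (r\<^sup>2 / 2 / real n)" and "z \<equiv> r * sqrt (2 * real n)"
  defines "K0 \<equiv> (LINT u|lborel. exp (- (z * cosh u)))" and "K1 \<equiv> (LINT u|lborel. cosh u * exp (- (z * cosh u)))"
  shows "laplace_gauss 4 n r = ennreal (K1 / (4 * pi\<^sup>2 * c))"
    "(\<integral>\<^sup>+x. indicator (- cball 0 r) (x :: real ^ 4) * laplace_gauss 4 n (norm x) \<partial>lborel) = ennreal (c * K1 + r\<^sup>2 / 2 * K0)"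
proof -
  have a: "r\<^sup>2 / 2 > 0" using r by simp
  have k: "real n > 0" using n by simp
  have z: "2 * sqrt (r\<^sup>2 / 2 * real n) = z"
  proof -
    have "sqrt (r\<^sup>2 / 2 * real n) = z / 2"
      using r by (intro real_sqrt_unique) (auto simp: z_def power_mult_distrib power_divide)
    then show ?thesis by simp
  qed
  note bl = bessel_laplace_integrals[OF a k, folded c_def, unfolded z, folded K0_def K1_def]
  let ?E = "\<lambda>t. exp (- (real n * t) - r\<^sup>2 / 2 / t)"
  have E: "exp (- (real n * t)) * exp (- (r\<^sup>2 / 2 / t)) = ?E t" for t by (simp add: exp_add[symmetric])
  have "laplace_gauss 4 n r = (\<integral>\<^sup>+t. indicator {0<..} t * ennreal (1 / (4 * pi\<^sup>2) * (?E t / t\<^sup>2)) \<partial>lborel)"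
    unfolding laplace_gauss_def
    by (intro nn_integral_cong) (auto simp: indicator_def radial_gauss_4 mult_exp_exp)
  also have "\<dots> = ennreal (LINT t:{0<..}|lborel. 1 / (4 * pi\<^sup>2) * (?E t / t\<^sup>2))"
    by (intro nn_set_integral_eq set_integrable_mult_right bl(1)) auto
  also have "(LINT t:{0<..}|lborel. 1 / (4 * pi\<^sup>2) * (?E t / t\<^sup>2)) = 1 / (4 * pi\<^sup>2) * (K1 / c)"
    by (simp only: set_integral_mult_right bl(2))
  finally show "laplace_gauss 4 n r = ennreal (K1 / (4 * pi\<^sup>2 * c))" by simp
  have "(\<integral>\<^sup>+x. indicator (- cball 0 r) (x :: real ^ 4) * laplace_gauss 4 n (norm x) \<partial>lborel)
     = (\<integral>\<^sup>+x. \<integral>\<^sup>+t. indicator (- cball 0 r) (x :: real ^ 4) * (indicator {0<..} t * ennreal (exp (- (real n * t)) * radial_gauss 4 t (norm x))) \<partial>lborel \<partial>lborel)"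
    unfolding laplace_gauss_def by (intro nn_integral_cong nn_integral_cmult[symmetric]) (simp add: radial_gauss_def)
  also have "\<dots> = (\<integral>\<^sup>+t. \<integral>\<^sup>+x. indicator (- cball 0 r) (x :: real ^ 4) * (indicator {0<..} t * ennreal (exp (- (real n * t)) * radial_gauss 4 t (norm x))) \<partial>lborel \<partial>lborel)"
  proof (rule lborel_pair.Fubini'[symmetric])
    have [measurable]: "- cball (0::real^4) r \<in> sets borel" by auto
    show "(\<lambda>(x, t). indicator (- cball 0 r) (x :: real ^ 4) * (indicator {0<..} t * ennreal (exp (- (real n * t)) * radial_gauss 4 t (norm x)))) \<in> borel_measurable (lborel \<Otimes>\<^sub>M lborel)"
      unfolding radial_gauss_def by measurable
  qed
  also have "\<dots> = (\<integral>\<^sup>+t. indicator {0<..} t * ennreal (?E t * (1 + r\<^sup>2 / 2 / t)) \<partial>lborel)"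
  proof (rule nn_integral_cong)
    fix t :: real
    show "(\<integral>\<^sup>+x. indicator (- cball 0 r) (x :: real ^ 4) * (indicator {0<..} t * ennreal (exp (- (real n * t)) * radial_gauss 4 t (norm x))) \<partial>lborel)
       = indicator {0<..} t * ennreal (?E t * (1 + r\<^sup>2 / 2 / t))"
    proof (cases "t > 0")
      case True
      have [measurable]: "- cball (0::real^4) r \<in> sets borel" by auto
      have "(\<integral>\<^sup>+x. indicator (- cball 0 r) (x :: real ^ 4) * (indicator {0<..} t * ennreal (exp (- (real n * t)) * radial_gauss 4 t (norm x))) \<partial>lborel)
        = (\<integral>\<^sup>+x. ennreal (exp (- (real n * t))) * (indicator (- cball 0 r) (x :: real ^ 4) * ennreal (gauss t x)) \<partial>lborel)"
        using True by (intro nn_integral_cong) (simp add: gauss_radial ennreal_mult radial_gauss_nonneg mult_ac)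
      also have "\<dots> = ennreal (exp (- (real n * t))) * ennreal ((1 + r\<^sup>2 / 2 / t) * exp (- (r\<^sup>2 / 2 / t)))"
        unfolding gauss_tail_mass[OF True r, symmetric] by (rule nn_integral_cmult) measurable
      also have "\<dots> = ennreal (exp (- (real n * t)) * ((1 + r\<^sup>2 / 2 / t) * exp (- (r\<^sup>2 / 2 / t))))"
        using True by (intro ennreal_mult[symmetric]) auto
      also have "exp (- (real n * t)) * ((1 + r\<^sup>2 / 2 / t) * exp (- (r\<^sup>2 / 2 / t))) = ?E t * (1 + r\<^sup>2 / 2 / t)"
        unfolding E[symmetric] by (simp only: mult_ac)
      finally show ?thesis using True by simp
    qed simp
  qed
  also have "\<dots> = ennreal (LINT t:{0<..}|lborel. ?E t * (1 + r\<^sup>2 / 2 / t))"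
    by (intro nn_set_integral_eq bl(3)) auto
  also have "(LINT t:{0<..}|lborel. ?E t * (1 + r\<^sup>2 / 2 / t)) = c * K1 + r\<^sup>2 / 2 * K0" by (rule bl(4))
  finally show "(\<integral>\<^sup>+x. indicator (- cball 0 r) (x :: real ^ 4) * laplace_gauss 4 n (norm x) \<partial>lborel) = ennreal (c * K1 + r\<^sup>2 / 2 * K0)" .
qed

text \<open>
  By \<open>laplace_hitting_time\<close> the moment at \<open>x\<close> is the resolvent kernel at \<open>x\<close> divided by its value \<open>h\<close> on the
  sphere, so its integral is the quotient of the two values in \<open>laplace_gauss_values\<close>.
\<close>

lemma hitting_moment_mass:
  fixes P :: "real ^ 4 \<Rightarrow> 'w measure"
  assumes fam: "brownian_family \<Omega> P B" and r: "r > 0" and n: "n \<ge> 1"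
  defines "z \<equiv> r * sqrt (2 * real n)"
  shows "set_integrable lborel (UNIV - cball 0 r) (\<lambda>x. LINT \<omega>|P x. discount (hitting_time B (cball 0 r) \<omega>) ^ n)"
    "(LINT x:UNIV - cball 0 r|lborel. LINT \<omega>|P x. discount (hitting_time B (cball 0 r) \<omega>) ^ n)
       = 2 * pi\<^sup>2 * r\<^sup>2 * (1 / real n + r\<^sup>2 / z * macdonald_ratio z)"
proof -
  define c where "c = sqrt (r\<^sup>2 / 2 / real n)"
  define K0 where "K0 = (LINT u|lborel. exp (- (z * cosh u)))"
  define K1 where "K1 = (LINT u|lborel. cosh u * exp (- (z * cosh u)))"
  note lv = laplace_gauss_values[OF r n, folded z_def c_def, folded K0_def K1_def]
  have z: "z > 0" using r n by (simp add: z_def)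
  have c: "c > 0" using r n by (simp add: c_def)
  have K: "K1 > 0" "K0 > 0"
    using cosh_moment_real_pos[OF z, of 1] cosh_moment_real_pos[OF z, of 0] by (simp_all add: K0_def K1_def)
  define h where "h = K1 / (4 * pi\<^sup>2 * c)"
  have h: "h > 0" using K c by (simp add: h_def)
  let ?m = "\<lambda>x. LINT \<omega>|P x. discount (hitting_time B (cball 0 r) \<omega>) ^ n"
  have m0: "0 \<le> ?m x" for x by (intro integral_nonneg_AE AE_I2) (simp add: discount_bounds)
  have eq: "ennreal (?m x) = ennreal (1 / h) * laplace_gauss 4 n (norm x)" if "x \<in> - cball 0 r" for x
  proof -
    interpret brownian_motion "P x" B x using fam by (simp add: brownian_family_def)
    have "laplace_gauss 4 n (norm x) = ennreal (?m x) * ennreal h"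
      using laplace_hitting_time[OF r _ n] that lv(1) by (simp add: h_def)
    then have "ennreal (1 / h) * laplace_gauss 4 n (norm x) = ennreal (1 / h * (?m x * h))"
      using h m0 by (simp add: ennreal_mult[symmetric])
    also have "1 / h * (?m x * h) = ?m x" using h by simp
    finally show ?thesis by simp
  qed
  let ?f = "\<lambda>x. indicator (- cball 0 r) x *\<^sub>R ?m x"
  have fe: "?f x = enn2real (indicator (- cball 0 r) x * (ennreal (1 / h) * laplace_gauss 4 n (norm x)))" for x
    using eq[of x] m0[of x] by (cases "x \<in> - cball 0 r") (auto simp: indicator_def simp flip: eq)
  have [measurable]: "- cball (0::real^4) r \<in> sets borel" by auto
  have fm: "?f \<in> borel_measurable lborel" unfolding fe by measurable
  have "(\<integral>\<^sup>+x. ennreal (?f x) \<partial>lborel) = (\<integral>\<^sup>+x. ennreal (1 / h) * (indicator (- cball 0 r) (x :: real ^ 4) * laplace_gauss 4 n (norm x)) \<partial>lborel)"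
    by (intro nn_integral_cong) (use eq in \<open>auto simp: indicator_def\<close>)
  also have "\<dots> = ennreal (1 / h) * ennreal (c * K1 + r\<^sup>2 / 2 * K0)"
    unfolding lv(2)[symmetric] by (rule nn_integral_cmult) measurable
  also have "\<dots> = ennreal (1 / h * (c * K1 + r\<^sup>2 / 2 * K0))"
    using h c K by (intro ennreal_mult[symmetric]) auto
  finally have nn: "(\<integral>\<^sup>+x. ennreal (?f x) \<partial>lborel) = ennreal (1 / h * (c * K1 + r\<^sup>2 / 2 * K0))" .
  have f0: "0 \<le> ?f x" for x using m0 by simp
  have int: "integrable lborel ?f"
    using nn f0 by (intro integrableI_nonneg fm AE_I2) auto
  have val: "(LINT x|lborel. ?f x) = 1 / h * (c * K1 + r\<^sup>2 / 2 * K0)"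
    using nn f0 h c K by (subst integral_eq_nn_integral[OF fm]) auto
  have compl: "UNIV - cball 0 r = - cball (0 :: real ^ 4) r" by auto
  show "set_integrable lborel (UNIV - cball 0 r) ?m" using int unfolding compl set_integrable_def .
  have cc: "c * c = r\<^sup>2 / 2 / real n" using r n by (simp add: c_def)
  have cz: "c = r\<^sup>2 / z"
  proof -
    have "c = r / sqrt (2 * real n)" using r n by (simp add: c_def real_sqrt_divide)
    then show ?thesis using r by (simp add: z_def power2_eq_square)
  qed
  have "1 / h * (c * K1 + r\<^sup>2 / 2 * K0) = 4 * pi\<^sup>2 * (c * c + r\<^sup>2 / 2 * c * (K0 / K1))"
    using K c by (simp add: h_def field_simps)
  also have "\<dots> = 4 * pi\<^sup>2 * (r\<^sup>2 / 2 / real n + r\<^sup>2 / 2 * (r\<^sup>2 / z) * (K0 / K1))"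
    unfolding cc by (simp add: cz)
  also have "\<dots> = 2 * pi\<^sup>2 * r\<^sup>2 * (1 / real n + r\<^sup>2 / z * (K0 / K1))"
    by (simp add: algebra_simps)
  also have "K0 / K1 = macdonald_ratio z" by (simp add: macdonald_ratio_def K0_def K1_def)
  finally show "(LINT x:UNIV - cball 0 r|lborel. ?m x) = 2 * pi\<^sup>2 * r\<^sup>2 * (1 / real n + r\<^sup>2 / z * macdonald_ratio z)"
    unfolding compl set_lebesgue_integral_def val .
qed

section \<open>Inversion of the exponential moments\<close>

text \<open>
  Continuous functions that equal \<open>1 / y\<close> from \<open>c\<close> on and fall linearly to \<open>0\<close> within a distance \<open>1 / m\<close>
  below \<open>c\<close> are approximated by polynomials within \<open>1 / (m + 1)\<close>. Multiplied by \<open>y\<close>, the polynomials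
  have no constant term and tend to the indicator of \<open>c \<le> y\<close>, at the endpoint \<open>y = c\<close> as well.
\<close>

lemma inverse_step_polynomials:
  assumes c: "0 < c"
  obtains a :: "nat \<Rightarrow> nat \<Rightarrow> real" and N :: "nat \<Rightarrow> nat" where
    "\<And>y. y \<in> {0..1} \<Longrightarrow> (\<lambda>m. \<Sum>i\<le>N m. a m i * y ^ i) \<longlonglongrightarrow> (if c \<le> y then 1 / y else 0)"
    "\<And>m y. y \<in> {0..1} \<Longrightarrow> \<bar>\<Sum>i\<le>N m. a m i * y ^ i\<bar> \<le> 1 / c + 1"
proof -
  define g where "g m y = max 0 (min 1 (1 + real m * (y - c))) / max y c" for m :: nat and y :: real
  have "\<exists>a n. \<forall>y\<in>{0..1}. \<bar>g m y - (\<Sum>i\<le>n. a i * y ^ i)\<bar> < 1 / real (Suc m)" for m :: nat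
  proof -
    have "continuous_on {0..1} (g m)" unfolding g_def[abs_def] using c by (intro continuous_intros) auto
    then obtain p where p: "real_polynomial_function p" "\<And>y. y \<in> {0..1} \<Longrightarrow> \<bar>g m y - p y\<bar> < 1 / real (Suc m)"
      using Stone_Weierstrass_real_polynomial_function[of "{0..1}" "g m" "1 / real (Suc m)"] by auto
    from p(1) obtain a n where "p = (\<lambda>y. \<Sum>i\<le>n. a i * y ^ i)" unfolding real_polynomial_function_iff_sum by blast
    with p(2) show ?thesis by blast
  qed
  then obtain a N where aN: "\<And>m y. y \<in> {0..1} \<Longrightarrow> \<bar>g m y - (\<Sum>i\<le>N m. a m i * y ^ i)\<bar> < 1 / real (Suc m)"
    by metis
  show ?thesis
  proof (rule that[of a N])
    fix y :: real assume y: "y \<in> {0..1}"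
    have g: "(\<lambda>m. g m y) \<longlonglongrightarrow> (if c \<le> y then 1 / y else 0)"
    proof (cases "c \<le> y")
      case True
      then have "g m y = 1 / y" for m by (simp add: g_def)
      then show ?thesis using True by simp
    next
      case False
      obtain m0 :: nat where m0: "1 / (c - y) < real m0" using reals_Archimedean2 by blast
      have "g m y = 0" if "m \<ge> m0" for m
      proof -
        have "1 / (c - y) < real m" using m0 that by (meson less_le_trans of_nat_le_iff)
        then have "1 < real m * (c - y)" using False by (simp add: field_simps)
        then have "1 + real m * (y - c) \<le> 0" by (simp add: algebra_simps)
        then show ?thesis by (simp add: g_def)
      qed
      then have "\<forall>\<^sub>F m in sequentially. 0 = g m y" by (auto simp: eventually_sequentially)
      then show ?thesis using False by (auto intro: Lim_transform_eventually[OF tendsto_const])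
    qed
    have "(\<lambda>m. g m y - (g m y - (\<Sum>i\<le>N m. a m i * y ^ i))) \<longlonglongrightarrow> (if c \<le> y then 1 / y else 0) - 0"
    proof (intro tendsto_diff g)
      show "(\<lambda>m. g m y - (\<Sum>i\<le>N m. a m i * y ^ i)) \<longlonglongrightarrow> 0"
        by (rule Lim_null_comparison[OF _ LIMSEQ_Suc[OF lim_const_over_n[of 1]]])
           (use aN[OF y] in \<open>auto intro!: always_eventually less_imp_le\<close>)
    qed
    then show "(\<lambda>m. \<Sum>i\<le>N m. a m i * y ^ i) \<longlonglongrightarrow> (if c \<le> y then 1 / y else 0)" by simp
  next
    fix m :: nat and y :: real assume y: "y \<in> {0..1}"
    have "\<bar>g m y\<bar> \<le> 1 / c" unfolding g_def using c by (auto intro!: frac_le simp: abs_divide)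
    moreover have "1 / real (Suc m) \<le> 1" by simp
    ultimately show "\<bar>\<Sum>i\<le>N m. a m i * y ^ i\<bar> \<le> 1 / c + 1" using aN[OF y, of m] by linarith
  qed
qed

lemma exponential_integral:
  fixes \<alpha> :: real
  assumes "\<alpha> > 0"
  shows "set_integrable lborel {0<..} (\<lambda>s. exp (- (\<alpha> * s)))" "(LINT s:{0<..}|lborel. exp (- (\<alpha> * s))) = 1 / \<alpha>"
proof -
  have "(\<integral>\<^sup>+s. ennreal (exp (- (\<alpha> * s))) * indicator {0..} s \<partial>lborel) = ennreal (0 - (- (exp (- (\<alpha> * 0)) / \<alpha>)))"
  proof (rule nn_integral_FTC_atLeast[where F = "\<lambda>s. - (exp (- (\<alpha> * s)) / \<alpha>)"])
    show "((\<lambda>s. - (exp (- (\<alpha> * s)) / \<alpha>)) \<longlongrightarrow> 0) at_top" using assms by real_asymp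
  qed (use assms in \<open>auto intro!: derivative_eq_intros\<close>)
  also have "(\<integral>\<^sup>+s. ennreal (exp (- (\<alpha> * s))) * indicator {0..} s \<partial>lborel) = (\<integral>\<^sup>+s. ennreal (indicator {0<..} s *\<^sub>R exp (- (\<alpha> * s))) \<partial>lborel)"
    by (rule nn_integral_cong_AE, use AE_lborel_singleton[of 0] in eventually_elim) (auto simp: indicator_def)
  finally have nn: "(\<integral>\<^sup>+s. ennreal (indicator {0<..} s *\<^sub>R exp (- (\<alpha> * s))) \<partial>lborel) = ennreal (1 / \<alpha>)" by simp
  have m: "(\<lambda>s. indicator {0<..} s *\<^sub>R exp (- (\<alpha> * s))) \<in> borel_measurable lborel" by measurable
  show "set_integrable lborel {0<..} (\<lambda>s. exp (- (\<alpha> * s)))"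
    unfolding set_integrable_def using nn by (intro integrableI_nonneg m) auto
  show "(LINT s:{0<..}|lborel. exp (- (\<alpha> * s))) = 1 / \<alpha>"
    unfolding set_lebesgue_integral_def using nn assms by (subst integral_eq_nn_integral[OF m]) auto
qed

text \<open>
  Since \<open>1 / (i + 1 + v)\<close> is the integral of \<open>exp (- (1 + v) s) exp (- s)\<^sup>i\<close>, the sum is the integral
  of \<open>exp (- (1 + v) s) p (exp (- s))\<close> for the approximating polynomial \<open>p\<close>. In the limit \<open>p\<close> cancels
  one factor \<open>exp (- s)\<close> for \<open>s \<le> t\<close> and vanishes for \<open>s > t\<close>.
\<close>

lemma moment_functional_limit:
  fixes a :: "nat \<Rightarrow> nat \<Rightarrow> real" and N :: "nat \<Rightarrow> nat"
  assumes lim: "\<And>y. y \<in> {0..1} \<Longrightarrow> (\<lambda>m. \<Sum>i\<le>N m. a m i * y ^ i) \<longlonglongrightarrow> (if exp (- t) \<le> y then 1 / y else 0)"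
    and bound: "\<And>m y. y \<in> {0..1} \<Longrightarrow> \<bar>\<Sum>i\<le>N m. a m i * y ^ i\<bar> \<le> C"
    and v: "v \<ge> 0" and t: "t \<ge> 0"
  shows "(\<lambda>m. \<Sum>i\<le>N m. a m i / (real (Suc i) + v)) \<longlonglongrightarrow> (if v = 0 then t else (1 - exp (- (v * t))) / v)"
    "\<bar>\<Sum>i\<le>N m. a m i / (real (Suc i) + v)\<bar> \<le> C / (1 + v)"
proof -
  let ?p = "\<lambda>m y. \<Sum>i\<le>N m. a m i * y ^ i"
  let ?f = "\<lambda>m s. indicator {0<..} s *\<^sub>R (exp (- ((1 + v) * s)) * ?p m (exp (- s)))"
  have C: "C \<ge> 0" using order_trans[OF abs_ge_zero bound[of 0 0]] by simp
  have i1: "integrable lborel (\<lambda>s. indicator {0<..} s *\<^sub>R exp (- ((1 + v) * s)))"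
    using exponential_integral(1)[of "1 + v"] v by (simp add: set_integrable_def)
  have fe: "?f m s = (\<Sum>i\<le>N m. a m i * (indicator {0<..} s *\<^sub>R exp (- ((real (Suc i) + v) * s))))" for m s
  proof -
    have e: "exp (- ((1 + v) * s)) * (a m i * exp (- s) ^ i) = a m i * exp (- ((real (Suc i) + v) * s))" for i
      by (simp add: exp_of_nat_mult[symmetric] mult_exp_exp mult.left_commute algebra_simps)
    have "?f m s = indicator {0<..} s *\<^sub>R (\<Sum>i\<le>N m. exp (- ((1 + v) * s)) * (a m i * exp (- s) ^ i))"
      by (simp only: sum_distrib_left)
    also have "\<dots> = indicator {0<..} s *\<^sub>R (\<Sum>i\<le>N m. a m i * exp (- ((real (Suc i) + v) * s)))" by (simp only: e)
    also have "\<dots> = (\<Sum>i\<le>N m. a m i * (indicator {0<..} s *\<^sub>R exp (- ((real (Suc i) + v) * s))))"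
      by (simp add: sum_distrib_left mult.left_commute)
    finally show ?thesis .
  qed
  have int_i: "integrable lborel (\<lambda>s. indicator {0<..} s *\<^sub>R exp (- ((real (Suc i) + v) * s)))" for i
    using exponential_integral(1)[of "real (Suc i) + v"] v by (simp add: set_integrable_def)
  have val: "(LINT s|lborel. ?f m s) = (\<Sum>i\<le>N m. a m i / (real (Suc i) + v))" for m
  proof -
    have "(LINT s|lborel. ?f m s) = (\<Sum>i\<le>N m. a m i * (LINT s:{0<..}|lborel. exp (- ((real (Suc i) + v) * s))))"
      unfolding fe set_lebesgue_integral_def using int_i by (subst Bochner_Integration.integral_sum) auto
    also have "\<dots> = (\<Sum>i\<le>N m. a m i / (real (Suc i) + v))"
      using v by (intro sum.cong refl) (subst exponential_integral(2), auto)
    finally show ?thesis .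
  qed
  have fb: "norm (?f m s) \<le> C * (indicator {0<..} s *\<^sub>R exp (- ((1 + v) * s)))" for m s
  proof (cases "s > 0")
    case True
    then have "\<bar>?p m (exp (- s))\<bar> \<le> C" by (intro bound) auto
    then show ?thesis using True by (simp add: abs_mult mult.commute[of C] mult_left_mono)
  qed simp
  have ib: "integrable lborel (\<lambda>s. C * (indicator {0<..} s *\<^sub>R exp (- ((1 + v) * s))))"
    using i1 by (rule integrable_mult_right)
  have fm: "?f m \<in> borel_measurable lborel" for m by measurable
  have "norm (LINT s|lborel. ?f m s) \<le> (LINT s|lborel. C * (indicator {0<..} s *\<^sub>R exp (- ((1 + v) * s))))"
    by (rule Bochner_Integration.integral_norm_bound_integral[OF Bochner_Integration.integrable_bound[OF ib fm] ib fb])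
       (use fb in \<open>auto intro!: AE_I2 order_trans[OF _ abs_ge_self]\<close>)
  also have "\<dots> = C * (LINT s:{0<..}|lborel. exp (- ((1 + v) * s)))" by (simp add: set_lebesgue_integral_def)
  also have "\<dots> = C / (1 + v)" using v by (subst exponential_integral(2)) auto
  finally show "\<bar>\<Sum>i\<le>N m. a m i / (real (Suc i) + v)\<bar> \<le> C / (1 + v)" unfolding val by simp
  have "(\<lambda>m. LINT s|lborel. ?f m s) \<longlonglongrightarrow> (LINT s|lborel. indicator {0<..t} s *\<^sub>R exp (- (v * s)))"
  proof (rule integral_dominated_convergence[where w = "\<lambda>s. C * (indicator {0<..} s *\<^sub>R exp (- ((1 + v) * s)))"])
    show "AE s in lborel. (\<lambda>m. ?f m s) \<longlonglongrightarrow> indicator {0<..t} s *\<^sub>R exp (- (v * s))"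
    proof (rule AE_I2)
      fix s :: real
      show "(\<lambda>m. ?f m s) \<longlonglongrightarrow> indicator {0<..t} s *\<^sub>R exp (- (v * s))"
      proof (cases "s > 0")
        case True
        have "(\<lambda>m. ?f m s) \<longlonglongrightarrow> indicator {0<..} s *\<^sub>R (exp (- ((1 + v) * s)) * (if exp (- t) \<le> exp (- s) then 1 / exp (- s) else 0))"
          using True by (intro tendsto_scaleR tendsto_mult tendsto_const lim) auto
        also have "indicator {0<..} s *\<^sub>R (exp (- ((1 + v) * s)) * (if exp (- t) \<le> exp (- s) then 1 / exp (- s) else 0)) = indicator {0<..t} s *\<^sub>R exp (- (v * s))"
        proof -
          have "exp (- ((1 + v) * s)) / exp (- s) = exp (- (v * s))" by (simp add: exp_diff[symmetric] algebra_simps)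
          then show ?thesis using True by (auto simp: indicator_def)
        qed
        finally show ?thesis .
      qed simp
    qed
    show "AE s in lborel. norm (?f m s) \<le> C * (indicator {0<..} s *\<^sub>R exp (- ((1 + v) * s)))" for m
      by (rule AE_I2) (rule fb)
  qed (use ib fm in measurable)
  also have "(LINT s|lborel. indicator {0<..t} s *\<^sub>R exp (- (v * s))) = (if v = 0 then t else (1 - exp (- (v * t))) / v)"
  proof (cases "v = 0")
    case False
    have si: "set_integrable lborel {0..t} (\<lambda>s. exp (- (v * s)))" by (intro borel_integrable_atLeastAtMost' continuous_intros)
    have "((\<lambda>s. exp (- (v * s))) has_integral (- (exp (- (v * t)) / v) - - (exp (- (v * 0)) / v))) {0..t}"
      using t False by (intro fundamental_theorem_of_calculus) (auto intro!: derivative_eq_intros simp: has_real_derivative_iff_has_vector_derivative[symmetric])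
    then have "(LINT s:{0..t}|lborel. exp (- (v * s))) = (1 - exp (- (v * t))) / v"
      using set_borel_integral_eq_integral(2)[OF si] by (simp add: integral_unique diff_divide_distrib)
    moreover have "(LINT s:{0..t}|lborel. exp (- (v * s))) = (LINT s|lborel. indicator {0<..t} s *\<^sub>R exp (- (v * s)))"
      unfolding set_lebesgue_integral_def
      by (rule integral_cong_AE) (use AE_lborel_singleton[of 0] in \<open>auto simp: indicator_def elim!: eventually_mono\<close>)
    ultimately show ?thesis using False by simp
  qed (use t in simp)
  finally show "(\<lambda>m. \<Sum>i\<le>N m. a m i / (real (Suc i) + v)) \<longlonglongrightarrow> (if v = 0 then t else (1 - exp (- (v * t))) / v)" unfolding val .
qed

section \<open>Expansion of the density at zero\<close>

lemma bigo_power_vlnv: "(\<lambda>v. v ^ n) \<in> O[at_right 0](\<lambda>v::real. (v * ln v) ^ n)"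
  by (intro landau_o.big_power vlnv_bigo)

lemma pseries_unfold:
  fixes w :: real
  assumes "\<And>n. \<bar>c n\<bar> \<le> C / fact n"
  shows "pseries c w = c 0 + w * pseries (\<lambda>n. c (Suc n)) w"
proof -
  have s: "\<bar>c (Suc n)\<bar> \<le> C / fact n" for n
  proof -
    have "C \<ge> 0" using order_trans[OF abs_ge_zero assms[of 0]] by simp
    then have "C / fact (Suc n) \<le> C / fact n" by (intro divide_left_mono fact_mono) auto
    with assms[of "Suc n"] show ?thesis by linarith
  qed
  have "pseries c w = c 0 + (\<Sum>n. c (Suc n) * w ^ Suc n)"
    unfolding pseries_def using suminf_split_head[OF summable_pseries[OF assms, of w]] by simp
  also have "(\<Sum>n. c (Suc n) * w ^ Suc n) = (\<Sum>n. w * (c (Suc n) * w ^ n))" by (simp add: algebra_simps)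
  also have "\<dots> = w * pseries (\<lambda>n. c (Suc n)) w"
    unfolding pseries_def using suminf_mult[OF summable_pseries[of "\<lambda>n. c (Suc n)", OF s], of w w] by simp
  finally show ?thesis .
qed

text \<open>
  Induction on the order: splitting off the constant term leaves \<open>v\<close> times a series of the same kind.
\<close>

lemma pseries_taylor_bigo:
  fixes k :: real
  assumes "\<And>n. \<bar>c n\<bar> \<le> C / fact n"
  shows "(\<lambda>v. pseries c (k * v) - (\<Sum>n<m. c n * (k * v) ^ n)) \<in> O[at_right 0](\<lambda>v. v ^ m)"
  using assms
proof (induction m arbitrary: c)
  case 0
  have "((\<lambda>v. pseries c (k * v)) \<longlongrightarrow> pseries c (k * 0)) (at_right 0)"
    by (intro continuous_on_tendsto_compose[OF continuous_on_pseries[OF 0, of UNIV]] tendsto_intros) auto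
  then have "(\<lambda>v. pseries c (k * v)) \<in> O[at_right 0](\<lambda>_. 1)"
    by (intro bigoI_tendsto[where c = "pseries c (k * 0)"]) simp_all
  then show ?case by simp
next
  case (Suc m)
  let ?c = "\<lambda>n. c (Suc n)"
  have s: "\<bar>?c n\<bar> \<le> C / fact n" for n
  proof -
    have "C \<ge> 0" using order_trans[OF abs_ge_zero Suc.prems[of 0]] by simp
    then have "C / fact (Suc n) \<le> C / fact n" by (intro divide_left_mono fact_mono) auto
    with Suc.prems[of "Suc n"] show ?thesis by linarith
  qed
  have "(\<lambda>v. pseries c (k * v) - (\<Sum>n<Suc m. c n * (k * v) ^ n)) = (\<lambda>v. k * (v * (pseries ?c (k * v) - (\<Sum>n<m. ?c n * (k * v) ^ n))))"
    unfolding pseries_unfold[OF Suc.prems] sum.lessThan_Suc_shift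
    by (simp add: fun_eq_iff algebra_simps sum_distrib_left)
  moreover have "(\<lambda>v. k * (v * (pseries ?c (k * v) - (\<Sum>n<m. ?c n * (k * v) ^ n)))) \<in> O[at_right 0](\<lambda>v. 1 * (v * v ^ m))"
    by (intro landau_o.big.mult Suc.IH s landau_o.big_refl) auto
  ultimately show ?case by simp
qed

lemma log_expandable_pseries:
  fixes k :: real
  assumes "\<And>n. \<bar>c n\<bar> \<le> C / fact n"
  shows "log_expandable N (\<lambda>v. pseries c (k * v) - c 0)"
proof -
  have "log_expandable N (\<lambda>v. (\<Sum>n\<in>{1..<Suc N}. (c n * k ^ n) * v ^ n) + (pseries c (k * v) - (\<Sum>n<Suc N. c n * (k * v) ^ n)))"
    by (rule log_expandable_bigo_add[OF log_expandable_sum landau_o.big_trans[OF pseries_taylor_bigo[OF assms] bigo_power_vlnv]])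
       (auto intro!: log_expandable_cmult log_expandable_power log_expandable_id)
  moreover have "(\<Sum>n<Suc N. c n * (k * v) ^ n) = c 0 + (\<Sum>n\<in>{1..<Suc N}. (c n * k ^ n) * v ^ n)" for v
    unfolding lessThan_atLeast0 by (subst sum.atLeast_Suc_lessThan) (auto simp: power_mult_distrib mult.assoc)
  ultimately show ?thesis by simp
qed

text \<open>
  The only logarithm in the denominator of the density is multiplied by \<open>u\<close>, and \<open>ln (c v) = ln c + ln v\<close>. So
  the denominator is \<open>1\<close> plus an expandable function, and so is its reciprocal.
\<close>

lemma log_expandable_cut_density:
  assumes c: "c > 0"
  shows "log_expandable N (\<lambda>v. cut_density \<kappa> (c * v) - 1)"
proof -
  define A1 where "A1 v = pseries I0_coeff (- c / 4 * v) - I0_coeff 0" for v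
  define A2 where "A2 v = pseries I0_coeff' (- c / 4 * v) - I0_coeff' 0" for v
  define A3 where "A3 v = pseries N0_coeff' (- c / 4 * v) - N0_coeff' 0" for v
  define A where "A v = A1 v + (- (c / 2 * (\<kappa> + ln c / 2))) * (v + v * A2 v) + (- (c / 4)) * (v * ln v + (v * ln v) * A2 v)
     + (c / 2) * (N0_coeff' 0 * v + v * A3 v)" for v
  define D where "D v = pi * c / 4 * (v + v * A2 v)" for v
  have l: "log_expandable N A1" "log_expandable N A2" "log_expandable N A3"
    unfolding A1_def[abs_def] A2_def[abs_def] A3_def[abs_def] by (rule log_expandable_pseries[where C = 1], rule coeff_bounds)+
  have lA: "log_expandable N A" unfolding A_def[abs_def]
    by (intro log_expandable_add log_expandable_cmult log_expandable_mult l log_expandable_id log_expandable_vlnv)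
  have lD: "log_expandable N D" unfolding D_def[abs_def]
    by (intro log_expandable_add log_expandable_cmult log_expandable_mult l log_expandable_id)
  have "log_expandable N (\<lambda>v. 2 * A v + A v * A v + D v * D v)"
    by (intro log_expandable_add log_expandable_cmult log_expandable_mult lA lD)
  from log_expandable_reciprocal[OF this] show ?thesis
  proof (rule log_expandable_eventually)
    have "1 / (1 + (2 * A v + A v * A v + D v * D v)) - 1 = cut_density \<kappa> (c * v) - 1" if v: "v > 0" for v
    proof -
      have lc: "ln (c * v) = ln c + ln v" using c v by (simp add: ln_mult)
      have c0: "I0_coeff 0 = 1" "I0_coeff' 0 = 1" by (simp_all add: I0_coeff'_def I0_coeff_def)
      have arg: "- (c * v) / 4 = - c / 4 * v" by simp
      have e: "pseries I0_coeff (- c / 4 * v) = 1 + A1 v" "pseries I0_coeff' (- c / 4 * v) = 1 + A2 v" "pseries N0_coeff' (- c / 4 * v) = N0_coeff' 0 + A3 v"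
        by (simp_all add: A1_def A2_def A3_def c0)
      have re: "cut_re \<kappa> (c * v) = 1 + A v"
        unfolding cut_re_def arg e lc A_def by (simp add: field_simps)
      have im: "cut_im (c * v) = D v" unfolding cut_im_def arg e D_def by (simp add: field_simps)
      show ?thesis unfolding cut_density_def re im by (simp add: power2_eq_square algebra_simps)
    qed
    then show "\<forall>\<^sub>F v in at_right 0. 1 / (1 + (2 * A v + A v * A v + D v * D v)) - 1 = cut_density \<kappa> (c * v) - 1"
      by (auto simp: eventually_at_right_field intro: exI[of _ 1])
  qed
qed

section \<open>The hitting integral\<close>

text \<open>
  With \<open>u = 2 r\<^sup>2 v\<close> the kernel \<open>1 / (z\<^sup>2 + u)\<close> at \<open>z\<^sup>2 = 2 r\<^sup>2 n\<close> becomes a multiple of \<open>1 / (n + v)\<close>,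
  which is linear in the same functional as the term \<open>1 / n\<close> of the moments.
\<close>

lemma stieltjes_rescaled:
  fixes r :: real and n :: nat
  assumes r: "r > 0" and n: "n \<ge> 1"
    and int: "\<And>x. x > 0 \<Longrightarrow> set_integrable lborel {0<..} (\<lambda>u. cut_density \<kappa> u / (x\<^sup>2 + u))"
    and ratio: "\<And>x. x > 0 \<Longrightarrow> macdonald_ratio x = x / 2 * (LINT u:{0<..}|lborel. cut_density \<kappa> u / (x\<^sup>2 + u))"
  defines "z \<equiv> r * sqrt (2 * real n)"
  shows "set_integrable lborel {0<..} (\<lambda>v. cut_density \<kappa> (2 * r\<^sup>2 * v) / (real n + v))"
    "r\<^sup>2 / z * macdonald_ratio z = r\<^sup>2 / 2 * (LINT v:{0<..}|lborel. cut_density \<kappa> (2 * r\<^sup>2 * v) / (real n + v))"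
proof -
  have z: "z > 0" and z2: "z\<^sup>2 = 2 * r\<^sup>2 * real n" using r n by (auto simp: z_def power_mult_distrib)
  let ?c = "2 * r\<^sup>2"
  have c: "?c > 0" using r by simp
  let ?F = "\<lambda>u. indicator {0<..} u *\<^sub>R (cut_density \<kappa> u / (z\<^sup>2 + u))"
  let ?G = "\<lambda>v. indicator {0<..} v *\<^sub>R (cut_density \<kappa> (?c * v) / (real n + v))"
  have FG: "?F (0 + ?c * v) = 1 / ?c * ?G v" for v
  proof (cases "v > 0")
    case True
    have "?c * real n + ?c * v = ?c * (real n + v)" by (simp only: distrib_left)
    then show ?thesis using True c unfolding z2 by simp
  next
    case False
    then have "\<not> ?c * v > 0" using c by (simp add: zero_less_mult_iff)
    then show ?thesis using False by simp
  qed
  have iF: "integrable lborel ?F" using int[OF z] by (simp add: set_integrable_def)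
  have "integrable lborel (\<lambda>v. ?F (0 + ?c * v))" using iF c by (subst lborel_integrable_real_affine_iff) auto
  then have "integrable lborel (\<lambda>v. ?c * (1 / ?c * ?G v))" unfolding FG by (rule integrable_mult_right)
  then show iG: "set_integrable lborel {0<..} (\<lambda>v. cut_density \<kappa> (?c * v) / (real n + v))"
    using r by (simp add: set_integrable_def)
  have "(LINT u|lborel. ?F u) = \<bar>?c\<bar> *\<^sub>R (LINT v|lborel. ?F (0 + ?c * v))"
    by (rule lborel_integral_real_affine) (use c in simp)
  also have "\<dots> = (LINT v|lborel. ?G v)" unfolding FG integral_mult_right_zero using r by simp
  finally have "(LINT u:{0<..}|lborel. cut_density \<kappa> u / (z\<^sup>2 + u)) = (LINT v:{0<..}|lborel. cut_density \<kappa> (?c * v) / (real n + v))"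
    by (simp add: set_lebesgue_integral_def)
  moreover have "r\<^sup>2 / z * macdonald_ratio z = r\<^sup>2 / 2 * (LINT u:{0<..}|lborel. cut_density \<kappa> u / (z\<^sup>2 + u))"
    unfolding ratio[OF z] using z by simp
  ultimately show "r\<^sup>2 / z * macdonald_ratio z = r\<^sup>2 / 2 * (LINT v:{0<..}|lborel. cut_density \<kappa> (2 * r\<^sup>2 * v) / (real n + v))"
    by (simp only:)
qed

text \<open>
  Let \<open>Y = exp (- \<tau>)\<close>, so that \<open>\<tau> \<le> t\<close> means \<open>exp (- t) \<le> Y\<close>. With the polynomials \<open>p\<close> of
  \<open>inverse_step_polynomials\<close>, \<open>Y p(Y)\<close> tends to the indicator of this event and is bounded by a multiple
  of \<open>Y\<close>, whose expectation is integrable in \<open>x\<close> although the constant \<open>1\<close> is not. Hence \<open>L(t)\<close> is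
  the limit of the corresponding combinations of the moments, and on the other side
  \<open>moment_functional_limit\<close> evaluates the limit under the integral against \<open>g\<close>.
\<close>

lemma hitting_integral_formula:
  fixes P :: "real ^ 4 \<Rightarrow> 'w measure"
  assumes fam: "brownian_family \<Omega> P B" and r: "r > 0" and t: "t > 0"
    and g: "\<And>v. v > 0 \<Longrightarrow> 0 \<le> g v"
    and ig: "\<And>n::nat. n \<ge> 1 \<Longrightarrow> set_integrable lborel {0<..} (\<lambda>v. g v / (real n + v))"
    and ratio: "\<And>n::nat. n \<ge> 1 \<Longrightarrow> r\<^sup>2 / (r * sqrt (2 * real n)) * macdonald_ratio (r * sqrt (2 * real n)) = r\<^sup>2 / 2 * (LINT v:{0<..}|lborel. g v / (real n + v))"
    and ilim: "set_integrable lborel {0<..} (\<lambda>v. (1 - exp (- (v * t))) * (g v / v))"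
  shows "hitting_integral P B (cball 0 r) t
     = 2 * pi\<^sup>2 * r\<^sup>2 * (t + r\<^sup>2 / 2 * (LINT v:{0<..}|lborel. (1 - exp (- (v * t))) * (g v / v)))"
proof -
  define c where "c = exp (- t)"
  have c: "c > 0" by (simp add: c_def)
  define C where "C = 1 / c + 1"
  obtain a N where aN: "\<And>y. y \<in> {0..1} \<Longrightarrow> (\<lambda>m. \<Sum>i\<le>N m. a m i * y ^ i) \<longlonglongrightarrow> (if c \<le> y then 1 / y else 0)"
    "\<And>m y. y \<in> {0..1} \<Longrightarrow> \<bar>\<Sum>i\<le>N m. a m i * y ^ i\<bar> \<le> C"
  proof (rule inverse_step_polynomials[OF c], fold C_def)
    fix a :: "nat \<Rightarrow> nat \<Rightarrow> real" and N :: "nat \<Rightarrow> nat"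
    assume "\<And>y. y \<in> {0..1} \<Longrightarrow> (\<lambda>m. \<Sum>i\<le>N m. a m i * y ^ i) \<longlonglongrightarrow> (if c \<le> y then 1 / y else 0)"
      "\<And>m y. y \<in> {0..1} \<Longrightarrow> \<bar>\<Sum>i\<le>N m. a m i * y ^ i\<bar> \<le> C"
    then show thesis by (rule that)
  qed
  have C0: "C \<ge> 0" using c by (simp add: C_def)
  define Y where "Y \<omega> = discount (hitting_time B (cball 0 r) \<omega>)" for \<omega>
  have Y: "0 \<le> Y \<omega>" "Y \<omega> \<le> 1" for \<omega> by (auto simp: Y_def discount_bounds hitting_time_nonneg)
  define mo where "mo n x = (LINT \<omega>|P x. Y \<omega> ^ n)" for n x
  let ?D = "UNIV - cball (0 :: real ^ 4) r"
  \<comment> \<open>The expectation of \<open>Y p(Y)\<close>, and the probability to which it converges.\<close>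
  define F where "F m x = (\<Sum>i\<le>N m. a m i * mo (Suc i) x)" for m x
  define p where "p x = measure (P x) {\<omega> \<in> space (P x). hitting_time B (cball 0 r) \<omega> \<le> ereal t}" for x
  note mass = hitting_moment_mass[OF fam r, folded Y_def, folded mo_def]
  have pt: "(\<lambda>m. F m x) \<longlonglongrightarrow> p x" "\<bar>F m x\<bar> \<le> C * mo 1 x" for x m
  proof -
    interpret brownian_motion "P x" B x using fam by (simp add: brownian_family_def)
    have Ym [measurable]: "Y \<in> borel_measurable (P x)" unfolding Y_def[abs_def] by (rule discount_measurable)
    have iY: "integrable (P x) (\<lambda>\<omega>. Y \<omega> ^ n)" for n unfolding Y_def by (rule integrable_discount_power)
    have FE: "F m x = (LINT \<omega>|P x. Y \<omega> * (\<Sum>i\<le>N m. a m i * Y \<omega> ^ i))" for m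
    proof -
      have "(LINT \<omega>|P x. Y \<omega> * (\<Sum>i\<le>N m. a m i * Y \<omega> ^ i)) = (LINT \<omega>|P x. (\<Sum>i\<le>N m. a m i * Y \<omega> ^ Suc i))"
        by (simp add: sum_distrib_left mult.left_commute)
      also have "\<dots> = F m x" unfolding F_def mo_def by (subst Bochner_Integration.integral_sum) (simp_all del: power_Suc add: iY)
      finally show ?thesis by simp
    qed
    have bd: "norm (Y \<omega> * (\<Sum>i\<le>N m. a m i * Y \<omega> ^ i)) \<le> C * Y \<omega> ^ 1" for m \<omega>
      using aN(2)[of "Y \<omega>" m] Y[of \<omega>] by (simp add: abs_mult mult.commute[of C] mult_left_mono)
    have iC: "integrable (P x) (\<lambda>\<omega>. C * Y \<omega> ^ 1)" by (intro integrable_mult_right iY)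
    have im: "integrable (P x) (\<lambda>\<omega>. Y \<omega> * (\<Sum>i\<le>N m. a m i * Y \<omega> ^ i))" for m
      by (rule Bochner_Integration.integrable_bound[OF iC]) (use bd in \<open>auto intro!: AE_I2 order_trans[OF _ abs_ge_self]\<close>)
    have "norm (LINT \<omega>|P x. Y \<omega> * (\<Sum>i\<le>N m. a m i * Y \<omega> ^ i)) \<le> (LINT \<omega>|P x. C * Y \<omega> ^ 1)"
      by (rule order_trans[OF integral_norm_bound integral_mono[OF integrable_norm[OF im] iC]]) (rule bd)
    then show "\<bar>F m x\<bar> \<le> C * mo 1 x" unfolding FE by (simp add: mo_def)
    let ?A = "{\<omega> \<in> space (P x). hitting_time B (cball 0 r) \<omega> \<le> ereal t}"
    have A: "?A \<in> sets (P x)"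
    proof -
      have [measurable]: "hitting_time B (cball 0 r) \<in> borel_measurable (P x)" by (rule hitting_time_measurable[OF refl])
      show ?thesis by measurable
    qed
    have "(\<lambda>m. LINT \<omega>|P x. Y \<omega> * (\<Sum>i\<le>N m. a m i * Y \<omega> ^ i)) \<longlonglongrightarrow> (LINT \<omega>|P x. indicator ?A \<omega>)"
    proof (rule integral_dominated_convergence[where w = "\<lambda>\<omega>. C * Y \<omega> ^ 1"])
      show "AE \<omega> in P x. (\<lambda>m. Y \<omega> * (\<Sum>i\<le>N m. a m i * Y \<omega> ^ i)) \<longlonglongrightarrow> indicator ?A \<omega>"
      proof (rule AE_I2)
        fix \<omega> assume w: "\<omega> \<in> space (P x)"
        have "(\<lambda>m. Y \<omega> * (\<Sum>i\<le>N m. a m i * Y \<omega> ^ i)) \<longlonglongrightarrow> Y \<omega> * (if c \<le> Y \<omega> then 1 / Y \<omega> else 0)"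
          using Y[of \<omega>] by (intro tendsto_mult tendsto_const aN(1)) auto
        moreover have "c \<le> Y \<omega> \<longleftrightarrow> hitting_time B (cball 0 r) \<omega> \<le> ereal t"
          unfolding c_def Y_def using t by (intro discount_ge_iff hitting_time_nonneg) simp
        ultimately show "(\<lambda>m. Y \<omega> * (\<Sum>i\<le>N m. a m i * Y \<omega> ^ i)) \<longlonglongrightarrow> indicator ?A \<omega>"
          using w c by (auto simp: indicator_def split: if_splits)
      qed
      show "AE \<omega> in P x. norm (Y \<omega> * (\<Sum>i\<le>N m. a m i * Y \<omega> ^ i)) \<le> C * Y \<omega> ^ 1" for m
        by (rule AE_I2) (rule bd)
    qed (use A iC in \<open>auto intro!: borel_measurable_times borel_measurable_sum borel_measurable_power\<close>)
    then show "(\<lambda>m. F m x) \<longlonglongrightarrow> p x" unfolding FE p_def using A by simp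
  qed
  have imo: "integrable lborel (\<lambda>x. indicator ?D x *\<^sub>R mo n x)" if "n \<ge> 1" for n
    using mass(1)[OF that] by (simp add: set_integrable_def)
  have Fint: "integrable lborel (\<lambda>x. indicator ?D x *\<^sub>R F m x)" for m
  proof -
    have "integrable lborel (\<lambda>x. \<Sum>i\<le>N m. a m i * (indicator ?D x *\<^sub>R mo (Suc i) x))"
      by (intro Bochner_Integration.integrable_sum integrable_mult_right imo) simp
    then show ?thesis by (simp add: F_def sum_distrib_left mult.left_commute)
  qed
  have plim: "(\<lambda>m. LINT x|lborel. indicator ?D x *\<^sub>R F m x) \<longlonglongrightarrow> (LINT x|lborel. indicator ?D x *\<^sub>R p x)"
  proof (rule integral_dominated_convergence[where w = "\<lambda>x. C * (indicator ?D x *\<^sub>R mo 1 x)"])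
    show lim: "AE x in lborel. (\<lambda>m. indicator ?D x *\<^sub>R F m x) \<longlonglongrightarrow> indicator ?D x *\<^sub>R p x"
      by (intro AE_I2 tendsto_scaleR tendsto_const pt)
    show "(\<lambda>x. indicator ?D x *\<^sub>R p x) \<in> borel_measurable lborel"
      by (rule borel_measurable_LIMSEQ_real[where u = "\<lambda>m x. indicator ?D x *\<^sub>R F m x"])
         (use Fint in \<open>auto intro!: tendsto_mult tendsto_const pt\<close>)
    show "integrable lborel (\<lambda>x. C * (indicator ?D x *\<^sub>R mo 1 x))" by (intro integrable_mult_right imo) simp
    show "AE x in lborel. norm (indicator ?D x *\<^sub>R F m x) \<le> C * (indicator ?D x *\<^sub>R mo 1 x)" for m
      using pt(2) by (intro AE_I2) (auto simp: indicator_def)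
  qed (use Fint in auto)
  let ?S = "\<lambda>m v. \<Sum>i\<le>N m. a m i / (real (Suc i) + v)"
  note mlim = moment_functional_limit[OF aN(1)[unfolded c_def] aN(2) _ less_imp_le[OF t]]
  have ig': "integrable lborel (\<lambda>v. indicator {0<..} v *\<^sub>R (g v / (real n + v)))" if "n \<ge> 1" for n :: nat
    using ig[OF that] by (simp add: set_integrable_def)
  have split: "indicator {0<..} v *\<^sub>R (g v * ?S m v) = (\<Sum>i\<le>N m. a m i * (indicator {0<..} v *\<^sub>R (g v / (real (Suc i) + v))))" for m v
    by (simp add: sum_distrib_left mult.left_commute divide_inverse mult.assoc)
  have Fval: "(LINT x|lborel. indicator ?D x *\<^sub>R F m x) = 2 * pi\<^sup>2 * r\<^sup>2 * (?S m 0 + r\<^sup>2 / 2 * (LINT v|lborel. indicator {0<..} v *\<^sub>R (g v * ?S m v)))" for m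
  proof -
    have "(LINT x|lborel. indicator ?D x *\<^sub>R F m x) = (LINT x|lborel. (\<Sum>i\<le>N m. a m i * (indicator ?D x *\<^sub>R mo (Suc i) x)))"
      by (simp add: F_def sum_distrib_left mult.left_commute)
    also have "\<dots> = (\<Sum>i\<le>N m. a m i * (LINT x|lborel. indicator ?D x *\<^sub>R mo (Suc i) x))"
      using imo by (subst Bochner_Integration.integral_sum) auto
    also have "\<dots> = (\<Sum>i\<le>N m. a m i * (2 * pi\<^sup>2 * r\<^sup>2 * (1 / real (Suc i) + r\<^sup>2 / 2 * (LINT v|lborel. indicator {0<..} v *\<^sub>R (g v / (real (Suc i) + v))))))"
    proof (intro sum.cong refl)
      fix i
      have "(LINT x|lborel. indicator ?D x *\<^sub>R mo (Suc i) x) = 2 * pi\<^sup>2 * r\<^sup>2 * (1 / real (Suc i) + r\<^sup>2 / 2 * (LINT v|lborel. indicator {0<..} v *\<^sub>R (g v / (real (Suc i) + v))))"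
        using mass(2)[of "Suc i"] ratio[of "Suc i"] by (simp add: set_lebesgue_integral_def)
      then show "a m i * (LINT x|lborel. indicator ?D x *\<^sub>R mo (Suc i) x) = a m i * (2 * pi\<^sup>2 * r\<^sup>2 * (1 / real (Suc i) + r\<^sup>2 / 2 * (LINT v|lborel. indicator {0<..} v *\<^sub>R (g v / (real (Suc i) + v)))))"
        by (simp only:)
    qed
    also have "\<dots> = 2 * pi\<^sup>2 * r\<^sup>2 * (?S m 0 + r\<^sup>2 / 2 * (\<Sum>i\<le>N m. a m i * (LINT v|lborel. indicator {0<..} v *\<^sub>R (g v / (real (Suc i) + v)))))"
      by (simp add: sum_distrib_left sum.distrib distrib_left mult_ac)
    also have "(\<Sum>i\<le>N m. a m i * (LINT v|lborel. indicator {0<..} v *\<^sub>R (g v / (real (Suc i) + v)))) = (LINT v|lborel. indicator {0<..} v *\<^sub>R (g v * ?S m v))"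
      unfolding split
      by (subst Bochner_Integration.integral_sum) (simp_all only: integral_mult_right_zero, intro integrable_mult_right ig', simp)
    finally show ?thesis .
  qed
  have glim: "(\<lambda>m. LINT v|lborel. indicator {0<..} v *\<^sub>R (g v * ?S m v)) \<longlonglongrightarrow> (LINT v|lborel. indicator {0<..} v *\<^sub>R ((1 - exp (- (v * t))) * (g v / v)))"
  proof (rule integral_dominated_convergence[where w = "\<lambda>v. C * (indicator {0<..} v *\<^sub>R (g v / (real 1 + v)))"])
    show "AE v in lborel. (\<lambda>m. indicator {0<..} v *\<^sub>R (g v * ?S m v)) \<longlonglongrightarrow> indicator {0<..} v *\<^sub>R ((1 - exp (- (v * t))) * (g v / v))"
    proof (rule AE_I2)
      fix v :: real
      show "(\<lambda>m. indicator {0<..} v *\<^sub>R (g v * ?S m v)) \<longlonglongrightarrow> indicator {0<..} v *\<^sub>R ((1 - exp (- (v * t))) * (g v / v))"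
      proof (cases "v > 0")
        case True
        have "(\<lambda>m. indicator {0<..} v *\<^sub>R (g v * ?S m v)) \<longlonglongrightarrow> indicator {0<..} v *\<^sub>R (g v * ((1 - exp (- (v * t))) / v))"
          using mlim(1)[of v] True by (intro tendsto_scaleR tendsto_mult tendsto_const) auto
        then show ?thesis by (simp add: mult.commute)
      qed simp
    qed
    show "AE v in lborel. norm (indicator {0<..} v *\<^sub>R (g v * ?S m v)) \<le> C * (indicator {0<..} v *\<^sub>R (g v / (real 1 + v)))" for m
    proof (rule AE_I2)
      fix v :: real
      show "norm (indicator {0<..} v *\<^sub>R (g v * ?S m v)) \<le> C * (indicator {0<..} v *\<^sub>R (g v / (real 1 + v)))"
      proof (cases "v > 0")
        case True
        have "g v * \<bar>?S m v\<bar> \<le> g v * (C / (1 + v))" using mlim(2)[of v m] True g by (intro mult_left_mono) auto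
        then show ?thesis using True g by (simp add: abs_mult mult.commute)
      qed simp
    qed
    show "integrable lborel (\<lambda>v. C * (indicator {0<..} v *\<^sub>R (g v / (real 1 + v))))"
      by (intro integrable_mult_right ig') simp
    show "(\<lambda>v. indicator {0<..} v *\<^sub>R ((1 - exp (- (v * t))) * (g v / v))) \<in> borel_measurable lborel"
      using ilim unfolding set_integrable_def by (rule borel_measurable_integrable)
    show "(\<lambda>v. indicator {0<..} v *\<^sub>R (g v * ?S m v)) \<in> borel_measurable lborel" for m
      unfolding split by (intro borel_measurable_integrable Bochner_Integration.integrable_sum integrable_mult_right ig') simp
  qed
  have "(\<lambda>m. 2 * pi\<^sup>2 * r\<^sup>2 * (?S m 0 + r\<^sup>2 / 2 * (LINT v|lborel. indicator {0<..} v *\<^sub>R (g v * ?S m v))))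
     \<longlonglongrightarrow> 2 * pi\<^sup>2 * r\<^sup>2 * (t + r\<^sup>2 / 2 * (LINT v|lborel. indicator {0<..} v *\<^sub>R ((1 - exp (- (v * t))) * (g v / v))))"
    using mlim(1)[of 0] by (intro tendsto_mult tendsto_add tendsto_const glim) simp
  from LIMSEQ_unique[OF plim[unfolded Fval] this] show ?thesis
    by (simp add: hitting_integral_def p_def set_lebesgue_integral_def)
qed

theorem theorem2p2:
  fixes \<Omega> :: "'w measure"
    and P :: "real ^ 4 \<Rightarrow> 'w measure"
    and B :: "real \<Rightarrow> 'w \<Rightarrow> real ^ 4"
    and r :: real and M :: nat
  assumes "brownian_family \<Omega> P B"
    and "r > 0"
    and "M \<ge> 1"
  shows "\<exists>(\<sigma>1 :: real) (\<sigma>2 :: nat \<Rightarrow> nat \<Rightarrow> real) (\<sigma>3 :: nat \<Rightarrow> nat \<Rightarrow> real).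
    (\<lambda>t. hitting_integral P B (cball 0 r) t
        - 2 * pi^2 * r^2 *
          (t + 1/2 * r^2 * ln t + r^2 * \<sigma>1
           + (\<Sum>n=1..M. r^(2*n+2) / t^n * (\<Sum>k=0..n. \<sigma>2 n k * (ln t)^k))
           + (\<Sum>n=1..M. r^(2*n+3) / (t powr (real n + 1/2)) * (\<Sum>k=0..n. \<sigma>3 n k * (ln t)^k))))
      \<in> O[at_top](\<lambda>t. (ln t)^(M+1) / t^(M+1))"
proof -
  obtain \<kappa> where nz: "\<And>u. u > 0 \<Longrightarrow> cut_re \<kappa> u \<noteq> 0 \<or> cut_im u \<noteq> 0"
    and bd: "\<And>u. u > 0 \<Longrightarrow> cut_density \<kappa> u \<le> 2 / (pi * sqrt u)"
    and int: "\<And>x. x > 0 \<Longrightarrow> set_integrable lborel {0<..} (\<lambda>u. cut_density \<kappa> u / (x\<^sup>2 + u))"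
    and ratio: "\<And>x. x > 0 \<Longrightarrow> macdonald_ratio x = x / 2 * (LINT u:{0<..}|lborel. cut_density \<kappa> u / (x\<^sup>2 + u))"
  proof (rule macdonald_ratio_stieltjes)
    fix \<kappa>
    assume "\<And>u. u > 0 \<Longrightarrow> cut_re \<kappa> u \<noteq> 0 \<or> cut_im u \<noteq> 0"
      "\<And>u. u > 0 \<Longrightarrow> cut_density \<kappa> u \<le> 2 / (pi * sqrt u)"
      "\<And>x. x > 0 \<Longrightarrow> set_integrable lborel {0<..} (\<lambda>u. cut_density \<kappa> u / (x\<^sup>2 + u))"
      "\<And>x. x > 0 \<Longrightarrow> macdonald_ratio x = x / 2 * (LINT u:{0<..}|lborel. cut_density \<kappa> u / (x\<^sup>2 + u))"
    then show thesis by (rule that)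
  qed
  note r = \<open>r > 0\<close>
  define g where "g v = cut_density \<kappa> (2 * r\<^sup>2 * v)" for v
  have g0: "0 \<le> g v" for v by (simp add: g_def cut_density_def)
  have gb: "\<bar>g v\<bar> \<le> 2 / (pi * sqrt (2 * r\<^sup>2)) / sqrt v" if "v > 0" for v
    using bd[of "2 * r\<^sup>2 * v"] that r g0[of v] by (simp add: g_def real_sqrt_mult mult.assoc)
  have gc: "continuous_on {0<..} g"
    unfolding g_def[abs_def]
    by (rule continuous_on_compose2[OF continuous_on_cut_density[OF nz]]) (use r in \<open>auto intro!: continuous_intros\<close>)
  have ge: "log_expandable M (\<lambda>v. g v - 1)"
    unfolding g_def by (rule log_expandable_cut_density) (use r in simp)
  define I where "I t = (LINT v:{0<..}|lborel. (1 - exp (- (v * t))) * (g v / v))" for t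
  obtain C s where exp: "(\<lambda>t. I t - ln t - (C + (\<Sum>n=1..M. (\<Sum>k=0..n. s n k * ln t ^ k) / t ^ n))) \<in> O[at_top](\<lambda>t. (ln t / t) ^ Suc M)"
    using watson_log(2)[OF gc gb ge] unfolding tail_expansion_def I_def by blast
  define L where "L = hitting_integral P B (cball 0 r)"
  have L: "L t = 2 * pi^2 * r^2 * (t + r^2 / 2 * I t)" if "t > 0" for t
    unfolding L_def I_def
  proof (rule hitting_integral_formula[OF assms(1) r that])
    show "set_integrable lborel {0<..} (\<lambda>v. (1 - exp (- (v * t))) * (g v / v))"
      by (rule watson_log(1)[OF gc gb ge]) (use that in auto)
  qed (use g0 stieltjes_rescaled[OF r _ int ratio] in \<open>auto simp: g_def\<close>)
  \<comment> \<open>The factor \<open>r\<^sup>2\<^sup>n\<^sup>+\<^sup>2\<close> that the statement splits off is compensated here; the remaining \<open>r\<^sup>2 / 2\<close> is the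
    factor in front of \<open>I t\<close>.\<close>
  define \<sigma>2 where "\<sigma>2 n k = s n k / (2 * r ^ (2 * n))" for n k
  have diff: "L t - 2 * pi^2 * r^2 *
      (t + 1/2 * r^2 * ln t + r^2 * (C / 2)
       + (\<Sum>n=1..M. r^(2*n+2) / t^n * (\<Sum>k=0..n. \<sigma>2 n k * (ln t)^k))
       + (\<Sum>n=1..M. r^(2*n+3) / (t powr (real n + 1/2)) * (\<Sum>k=0..n. 0 * (ln t)^k)))
    = (2 * pi^2 * r^2 * (r^2 / 2)) * (I t - ln t - (C + (\<Sum>n=1..M. (\<Sum>k=0..n. s n k * ln t ^ k) / t ^ n)))" if "t > 0" for t
  proof -
    have "(\<Sum>n=1..M. r^(2*n+2) / t^n * (\<Sum>k=0..n. \<sigma>2 n k * (ln t)^k)) = r^2 / 2 * (\<Sum>n=1..M. (\<Sum>k=0..n. s n k * ln t ^ k) / t ^ n)"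
      unfolding sum_distrib_left
    proof (intro sum.cong refl)
      fix n
      have "(\<Sum>k=0..n. r ^ (2 * n + 2) / t ^ n * (\<sigma>2 n k * ln t ^ k)) = (\<Sum>k=0..n. r^2 / 2 * (s n k * ln t ^ k / t ^ n))"
        using r by (intro sum.cong refl) (simp add: \<sigma>2_def power_add power2_eq_square)
      then show "(\<Sum>k=0..n. r ^ (2 * n + 2) / t ^ n * (\<sigma>2 n k * ln t ^ k)) = r^2 / 2 * ((\<Sum>k=0..n. s n k * ln t ^ k) / t ^ n)"
        by (simp only: sum_distrib_left sum_divide_distrib)
    qed
    then show ?thesis unfolding L[OF that] by (simp only: mult_zero_left sum.neutral_const mult_zero_right) (simp add: right_diff_distrib distrib_left)
  qed
  have "(\<lambda>t. L t - 2 * pi^2 * r^2 *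
      (t + 1/2 * r^2 * ln t + r^2 * (C / 2)
       + (\<Sum>n=1..M. r^(2*n+2) / t^n * (\<Sum>k=0..n. \<sigma>2 n k * (ln t)^k))
       + (\<Sum>n=1..M. r^(2*n+3) / (t powr (real n + 1/2)) * (\<Sum>k=0..n. 0 * (ln t)^k))))
    \<in> O[at_top](\<lambda>t. (ln t / t) ^ Suc M)"
  proof (rule landau_o.big.in_cong[THEN iffD2])
    show "\<forall>\<^sub>F t in at_top. L t - 2 * pi^2 * r^2 *
      (t + 1/2 * r^2 * ln t + r^2 * (C / 2)
       + (\<Sum>n=1..M. r^(2*n+2) / t^n * (\<Sum>k=0..n. \<sigma>2 n k * (ln t)^k))
       + (\<Sum>n=1..M. r^(2*n+3) / (t powr (real n + 1/2)) * (\<Sum>k=0..n. 0 * (ln t)^k)))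
      = (2 * pi^2 * r^2 * (r^2 / 2)) * (I t - ln t - (C + (\<Sum>n=1..M. (\<Sum>k=0..n. s n k * ln t ^ k) / t ^ n)))"
      by (rule eventually_mono[OF eventually_gt_at_top[of 0]]) (rule diff)
    show "(\<lambda>t. (2 * pi^2 * r^2 * (r^2 / 2)) * (I t - ln t - (C + (\<Sum>n=1..M. (\<Sum>k=0..n. s n k * ln t ^ k) / t ^ n)))) \<in> O[at_top](\<lambda>t. (ln t / t) ^ Suc M)"
      using exp r by simp
  qed
  then show ?thesis unfolding L_def
    by (intro exI[of _ "C / 2"] exI[of _ \<sigma>2] exI[of _ "\<lambda>_ _. 0"]) (simp only: power_divide Suc_eq_plus1)
qed

end
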